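(* Let $m\ge 1$ and $n_1,\dots,n_m\ge 1$ be integers. Then $$\operatorname{Aut}_{ci}\big( *_{i=1}^m \mathfrak A_{n_i}\big)\;\simeq\;\operatorname{Aut}\big(\times_{i=1}^m \mathbb B_{n_i}\big),$$ the identification being given by the map $\varphi\mapsto\varphi^*$, which is a bijection from $\operatorname{Aut}_{ci}( *_{i=1}^m\mathfrak A_{n_i})$ onto $\operatorname{Aut}(\times_{i=1}^m\mathbb B_{n_i})$.
   Context: $\mathbb B_n$ is the open unit ball of $\mathbb C^n$ and $\operatorname{Aut}(\times_{i=1}^m\mathbb B_{n_i})$ is the group of biholomorphic automorphisms of the polyball $\times_{i=1}^m\mathbb B_{n_i}$. The noncommutative disc algebra $\mathfrak A_n$ is the universal unital operator algebra generated by the identity and a row contraction $(\mathfrak s_1,\dots,\mathfrak s_n)$, i.e. $\sum_{i}\mathfrak s_i\mathfrak s_i^*\le I$ (equivalently, the norm-closed algebra generated by the identity and the left creation operators on the full Fock space over $\mathbb C^n$). The free product $*_{i=1}^m\mathfrak A_{n_i}$ is amalgamated over the identity; it is the universal unital operator algebra generated by $m$ row contractions $(\mathfrak s_{i,1},\dots,\mathfrak s_{i,n_i})$, $1\le i\le m$: for any row contractions $(T_{i,1},\dots,T_{i,n_i})$, $1\le i\le m$, on a Hilbert space there is a unique unital completely contractive homomorphism sending $\mathfrak s_{i,j}$ to $T_{i,j}$. $\operatorname{Aut}_{ci}(\mathcal B)$ denotes the group of completely isometric automorphisms of $\mathcal B$. The characters (nonzero multiplicative linear functionals) of $*_{i=1}^m\mathfrak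 A_{n_i}$ are exactly the $\rho_\lambda$, $\lambda\in\times_{i=1}^m\overline{\mathbb B}_{n_i}$, determined by $\rho_\lambda(\mathfrak s_{i,j})=\lambda_{i,j}$. A bounded automorphism $\varphi$ induces a homeomorphism of the character space by $\varphi^*(\rho_\lambda)=\rho_\lambda\circ\varphi$; this maps $\{\rho_\lambda:\lambda\in\times_{i=1}^m\mathbb B_{n_i}\}$ onto itself, and one also writes $\varphi^*$ for the map of $\times_{i=1}^m\mathbb B_{n_i}$ given by $\varphi^*(\lambda)=\mu\Leftrightarrow\varphi^*(\rho_\lambda)=\rho_\mu$. *)

theory Defs
  imports "HOL-Analysis.Analysis" "HOL-Algebra.Bij"
begin

section \<open>Complex Hilbert spaces\<close>

text \<open>
  Every complex Hilbert space is unitarily equivalent to \<open>\<ell>\<^sup>2(I)\<close> for an index set \<open>I\<close>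
  of orthonormal basis vectors.  As an instance of \<open>real_inner\<close> it carries the real part of
  the complex inner product.
\<close>

typedef 'a ell2 = "{f :: 'a \<Rightarrow> complex. (\<lambda>a. (cmod (f a))\<^sup>2) summable_on UNIV}"
  morphisms coord Abs_ell2
  by (rule exI[of _ "\<lambda>_. 0"]) simp

setup_lifting type_definition_ell2

lemma ell2_eqI: "(\<And>a. coord x a = coord y a) \<Longrightarrow> x = y"
  by (simp add: coord_inject[symmetric] fun_eq_iff)

lemma coord_summable: "(\<lambda>a. (cmod (coord x a))\<^sup>2) summable_on UNIV"
  using coord[of x] by simp

lemma summable_sq_scale:
  "(\<lambda>a. (cmod (f a))\<^sup>2) summable_on UNIV \<Longrightarrow> (\<lambda>a. (cmod (c * f a))\<^sup>2) summable_on UNIV"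
  by (simp add: norm_mult power_mult_distrib summable_on_cmult_right)

lemma summable_sq_add:
  assumes "(\<lambda>a. (cmod (f a))\<^sup>2) summable_on UNIV" "(\<lambda>a. (cmod (g a))\<^sup>2) summable_on UNIV"
  shows "(\<lambda>a. (cmod (f a + g a))\<^sup>2) summable_on UNIV"
proof (rule summable_on_comparison_test)
  show "(\<lambda>a. 2 * (cmod (f a))\<^sup>2 + 2 * (cmod (g a))\<^sup>2) summable_on UNIV"
    by (intro summable_on_add summable_on_cmult_right assms)
  fix a
  have "(cmod (f a + g a))\<^sup>2 \<le> (cmod (f a) + cmod (g a))\<^sup>2"
    by (intro power_mono norm_triangle_ineq) auto
  also have "\<dots> \<le> 2 * (cmod (f a))\<^sup>2 + 2 * (cmod (g a))\<^sup>2"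
    using sum_squares_bound[of "cmod (f a)" "cmod (g a)"] by (simp add: power2_sum)
  finally show "(cmod (f a + g a))\<^sup>2 \<le> 2 * (cmod (f a))\<^sup>2 + 2 * (cmod (g a))\<^sup>2" .
qed auto

lift_definition cscale :: "complex \<Rightarrow> 'a ell2 \<Rightarrow> 'a ell2" (infixr \<open>*\<^sub>C\<close> 75)
  is "\<lambda>c f a. c * f a"
  by (simp add: summable_sq_scale)

lemma coord_cscale [simp]: "coord (c *\<^sub>C x) a = c * coord x a"
  by transfer simp

instantiation ell2 :: (type) real_inner
begin

lift_definition zero_ell2 :: "'a ell2" is "\<lambda>_. 0" by simp
lift_definition plus_ell2 :: "'a ell2 \<Rightarrow> 'a ell2 \<Rightarrow> 'a ell2" is "\<lambda>f g a. f a + g a"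
  by (simp add: summable_sq_add)
lift_definition uminus_ell2 :: "'a ell2 \<Rightarrow> 'a ell2" is "\<lambda>f a. - f a" by simp
definition minus_ell2 :: "'a ell2 \<Rightarrow> 'a ell2 \<Rightarrow> 'a ell2" where "minus_ell2 x y = x + - y"
definition scaleR_ell2 :: "real \<Rightarrow> 'a ell2 \<Rightarrow> 'a ell2" where "scaleR_ell2 r x = complex_of_real r *\<^sub>C x"
definition inner_ell2 :: "'a ell2 \<Rightarrow> 'a ell2 \<Rightarrow> real"
  where "inner_ell2 x y = Re (\<Sum>\<^sub>\<infinity>a. coord x a * cnj (coord y a))"
definition norm_ell2 :: "'a ell2 \<Rightarrow> real" where "norm_ell2 x = sqrt (inner x x)"
definition sgn_ell2 :: "'a ell2 \<Rightarrow> 'a ell2" where "sgn_ell2 x = scaleR (inverse (norm x)) x"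
definition dist_ell2 :: "'a ell2 \<Rightarrow> 'a ell2 \<Rightarrow> real" where "dist_ell2 x y = norm (x - y)"
definition uniformity_ell2 :: "('a ell2 \<times> 'a ell2) filter"
  where "uniformity_ell2 = (INF e\<in>{0<..}. principal {(x, y). dist x y < e})"
definition open_ell2 :: "'a ell2 set \<Rightarrow> bool"
  where "open_ell2 U = (\<forall>x\<in>U. eventually (\<lambda>(x', y). x' = x \<longrightarrow> y \<in> U) uniformity)"

lemma coord_simps [simp]:
  "coord (0 :: 'a ell2) a = 0"
  "coord (x + y) a = coord x a + coord y a"
  "coord (- x) a = - coord x a"
  "coord (x - y) a = coord x a - coord y a"
  "coord (r *\<^sub>R x) a = complex_of_real r * coord x a"
  unfolding minus_ell2_def scaleR_ell2_def by (transfer; simp)+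

lemma coord_product_summable: "(\<lambda>a. coord x a * cnj (coord y a)) summable_on UNIV"
proof -
  have "(\<lambda>a. norm (coord x a * cnj (coord y a))) summable_on UNIV"
    by (rule abs_summable_product)
       (use coord_summable[of x] coord_summable[of y] in
         \<open>simp_all add: norm_mult power2_eq_square\<close>)
  then show ?thesis by (rule abs_summable_summable)
qed

lemma inner_ell2_self: "inner x x = (\<Sum>\<^sub>\<infinity>a. (cmod (coord x a))\<^sup>2)" for x :: "'a ell2"
proof -
  have "inner x x = (\<Sum>\<^sub>\<infinity>a. Re (coord x a * cnj (coord x a)))"
    unfolding inner_ell2_def using infsum_Re[OF coord_product_summable[of x x]] by simp
  also have "(\<lambda>a. Re (coord x a * cnj (coord x a))) = (\<lambda>a. (cmod (coord x a))\<^sup>2)"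
    by (simp add: fun_eq_iff complex_mult_cnj cmod_power2)
  finally show ?thesis .
qed

instance
proof
  fix x y z :: "'a ell2" and r s :: real and U :: "'a ell2 set"
  show "x + y + z = x + (y + z)" "x + y = y + x" "0 + x = x" "- x + x = 0"
    "r *\<^sub>R (x + y) = r *\<^sub>R x + r *\<^sub>R y" "(r + s) *\<^sub>R x = r *\<^sub>R x + s *\<^sub>R x"
    "r *\<^sub>R s *\<^sub>R x = (r * s) *\<^sub>R x" "1 *\<^sub>R x = x" "x - y = x + - y"
    by (auto intro!: ell2_eqI simp: algebra_simps)
  show "sgn x = inverse (norm x) *\<^sub>R x" "dist x y = norm (x - y)" "norm x = sqrt (inner x x)"
    "uniformity = (INF e\<in>{0<..}. principal {(x, y). dist x (y :: 'a ell2) < e})"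
    "open U = (\<forall>x\<in>U. \<forall>\<^sub>F (x', y) in uniformity. x' = x \<longrightarrow> y \<in> U)"
    by (simp_all only: sgn_ell2_def dist_ell2_def norm_ell2_def uniformity_ell2_def open_ell2_def)
  have "inner x y = Re (cnj (\<Sum>\<^sub>\<infinity>a. coord x a * cnj (coord y a)))"
    by (simp add: inner_ell2_def)
  also have "\<dots> = inner y x"
    by (simp only: infsum_cnj[symmetric] complex_cnj_mult complex_cnj_cnj inner_ell2_def mult.commute)
  finally show "inner x y = inner y x" .
  show "inner (x + y) z = inner x z + inner y z"
    by (simp add: inner_ell2_def ring_distribs infsum_add coord_product_summable)
  show "inner (r *\<^sub>R x) y = r * inner x y"
    by (simp add: inner_ell2_def mult.assoc infsum_cmult_right')
  show "0 \<le> inner x x"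
    by (simp add: inner_ell2_self infsum_nonneg)
  show "inner x x = 0 \<longleftrightarrow> x = 0"
  proof
    assume 0: "inner x x = 0"
    have "(cmod (coord x a))\<^sup>2 = 0" for a
      by (rule nonneg_infsum_le_0D[where A = UNIV])
         (use 0 coord_summable[of x] in \<open>simp_all add: inner_ell2_self\<close>)
    then show "x = 0" by (auto intro: ell2_eqI)
  qed (simp add: inner_ell2_self)
qed

end

lemma norm_ell2_sq: "(norm x)\<^sup>2 = (\<Sum>\<^sub>\<infinity>a. (cmod (coord x a))\<^sup>2)" for x :: "'a ell2"
  by (simp add: power2_norm_eq_inner inner_ell2_self)

lemma cscale_add: "c *\<^sub>C (x + y) = c *\<^sub>C x + c *\<^sub>C y"
  by (rule ell2_eqI) (simp add: algebra_simps)

lemma norm_cscale: "norm (c *\<^sub>C x) = cmod c * norm x"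
proof -
  have "(norm (c *\<^sub>C x))\<^sup>2 = (cmod c * norm x)\<^sup>2"
    by (simp add: norm_ell2_sq norm_mult power_mult_distrib infsum_cmult_right')
  then show ?thesis by (simp add: power2_eq_iff_nonneg)
qed

lemma bounded_linear_cscale: "bounded_linear (cscale c)"
proof (rule bounded_linear_intro[where K = "cmod c"])
  show "c *\<^sub>C (r *\<^sub>R x) = r *\<^sub>R (c *\<^sub>C x)" for r x
    by (rule ell2_eqI) simp
qed (simp_all add: cscale_add norm_cscale mult.commute)


section \<open>Operators\<close>

type_synonym 'a op = "'a ell2 \<Rightarrow>\<^sub>L 'a ell2"

text \<open>
  The type \<open>'a op\<close> consists of the bounded real-linear operators, with the operator norm;
  the algebra of bounded complex-linear operators is a closed subset of it.
\<close>

definition bounded_ops :: "'a op set"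
  where "bounded_ops = {A. \<forall>c x. blinfun_apply A (c *\<^sub>C x) = c *\<^sub>C blinfun_apply A x}"

lift_definition scalar_op :: "complex \<Rightarrow> 'a op" is cscale
  by (rule bounded_linear_cscale)

text \<open>
  The adjoint with respect to the real inner product \<open>Re \<langle>x, y\<rangle>\<close> of a complex-linear operator
  is its Hilbert space adjoint, and \<open>\<Sum>\<^sub>j T\<^sub>j T\<^sub>j\<^sup>* \<le> I\<close> is an inequality between self-adjoint
  operators, so that it can be tested with the real inner product.
\<close>

definition row_contraction :: "nat \<Rightarrow> (nat \<Rightarrow> 'a op) \<Rightarrow> bool"
  where "row_contraction k T \<longleftrightarrow>
    (\<forall>j<k. T j \<in> bounded_ops) \<and>
    (\<forall>x. (\<Sum>j<k. T j (adjoint (T j) x)) \<bullet> x \<le> x \<bullet> x)"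

text \<open>
  The norm of the \<open>N \<times> N\<close> operator matrix \<open>(A p q)\<close> acting on the \<open>N\<close>-fold Hilbert space
  direct sum.
\<close>

definition mat_norm :: "nat \<Rightarrow> (nat \<Rightarrow> nat \<Rightarrow> 'a op) \<Rightarrow> real"
  where "mat_norm N A =
    (SUP x\<in>{x :: nat \<Rightarrow> 'a ell2. L2_set (\<lambda>q. norm (x q)) {..<N} \<le> 1}.
       L2_set (\<lambda>p. norm (\<Sum>q<N. A p q (x q))) {..<N})"

definition completely_contractive :: "'a op set \<Rightarrow> ('a op \<Rightarrow> 'b op) \<Rightarrow> bool"
  where "completely_contractive \<A> \<phi> \<longleftrightarrow>
    (\<forall>N A. (\<forall>p<N. \<forall>q<N. A p q \<in> \<A>) \<longrightarrow> mat_norm N (\<lambda>p q. \<phi> (A p q)) \<le> mat_norm N A)"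

definition completely_isometric :: "'a op set \<Rightarrow> ('a op \<Rightarrow> 'b op) \<Rightarrow> bool"
  where "completely_isometric \<A> \<phi> \<longleftrightarrow>
    (\<forall>N A. (\<forall>p<N. \<forall>q<N. A p q \<in> \<A>) \<longrightarrow> mat_norm N (\<lambda>p q. \<phi> (A p q)) = mat_norm N A)"

definition unital_hom :: "'a op set \<Rightarrow> ('a op \<Rightarrow> 'b op) \<Rightarrow> bool"
  where "unital_hom \<A> \<phi> \<longleftrightarrow>
    \<phi> id_blinfun = id_blinfun \<and>
    (\<forall>c. \<forall>A\<in>\<A>. \<phi> (scalar_op c o\<^sub>L A) = scalar_op c o\<^sub>L \<phi> A) \<and>
    (\<forall>A\<in>\<A>. \<forall>B\<in>\<A>. \<phi> (A + B) = \<phi> A + \<phi> B \<and> \<phi> (A o\<^sub>L B) = \<phi> A o\<^sub>L \<phi> B)"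


section \<open>The free product of noncommutative disc algebras\<close>

inductive_set generated_algebra :: "'a op set \<Rightarrow> 'a op set" for G
  where
    gen: "A \<in> G \<Longrightarrow> A \<in> generated_algebra G"
  | scalar: "scalar_op c \<in> generated_algebra G"
  | add: "A \<in> generated_algebra G \<Longrightarrow> B \<in> generated_algebra G \<Longrightarrow> A + B \<in> generated_algebra G"
  | mult: "A \<in> generated_algebra G \<Longrightarrow> B \<in> generated_algebra G \<Longrightarrow> A o\<^sub>L B \<in> generated_algebra G"

text \<open>
  The universal unital operator algebra generated by \<open>m\<close> row contractions, in a concrete
  representation on \<open>\<ell>\<^sup>2\<close>; it is determined up to a completely isometric isomorphism mapping
  generators to generators.  The generators are \<open>s i j\<close> for \<open>i < m\<close> and \<open>j < n i\<close>.
  The universal property is required for operators on \<open>\<ell>\<^sup>2(\<nat>)\<close>.  This implies it for operators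
  on any Hilbert space, since countably many operators have a decomposition of the
  space into separable reducing subspaces.  Maps are normalised to be extensional
  outside \<open>\<A>\<close>, so that uniqueness refers to their values on \<open>\<A>\<close>.
  Existence of such an \<open>\<A>\<close> is theorem \<open>free_product_exists\<close> below.
\<close>

definition is_free_product ::
    "nat \<Rightarrow> (nat \<Rightarrow> nat) \<Rightarrow> 'a op set \<Rightarrow> (nat \<Rightarrow> nat \<Rightarrow> 'a op) \<Rightarrow> bool"
  where "is_free_product m n \<A> s \<longleftrightarrow>
    (\<forall>i<m. row_contraction (n i) (s i)) \<and>
    \<A> = closure (generated_algebra {s i j | i j. i < m \<and> j < n i}) \<and>
    (\<forall>T :: nat \<Rightarrow> nat \<Rightarrow> nat op. (\<forall>i<m. row_contraction (n i) (T i)) \<longrightarrow>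
      (\<exists>!\<pi>. \<pi> \<in> extensional \<A> \<and> \<pi> ` \<A> \<subseteq> bounded_ops \<and> unital_hom \<A> \<pi> \<and>
        completely_contractive \<A> \<pi> \<and> (\<forall>i<m. \<forall>j<n i. \<pi> (s i j) = T i j)))"

definition Aut_ci :: "'a op set \<Rightarrow> ('a op \<Rightarrow> 'a op) monoid"
  where "Aut_ci \<A> = BijGroup \<A>
    \<lparr>carrier := {\<phi> \<in> Bij \<A>. unital_hom \<A> \<phi> \<and> completely_isometric \<A> \<phi>}\<rparr>"


section \<open>The polyball\<close>

text \<open>
  The space \<open>\<complex>\<^bsup>n\<^sub>0\<^esup> \<times> \<dots> \<times> \<complex>\<^bsup>n\<^sub>m\<^sub>-\<^sub>1\<^esup>\<close> is identified with the subspace of \<open>\<ell>\<^sup>2(\<nat> \<times> \<nat>)\<close>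
  of vectors supported on the index pairs \<open>(i, j)\<close> with \<open>i < m\<close> and \<open>j < n i\<close>.
\<close>

definition polyball :: "nat \<Rightarrow> (nat \<Rightarrow> nat) \<Rightarrow> (nat \<times> nat) ell2 set"
  where "polyball m n =
    {z. (\<forall>i j. \<not> (i < m \<and> j < n i) \<longrightarrow> coord z (i, j) = 0) \<and>
        (\<forall>i<m. (\<Sum>j<n i. (cmod (coord z (i, j)))\<^sup>2) < 1)}"

text \<open>
  The polyball is open in that subspace, so that \<open>at z within polyball m n\<close> gives
  the Frechet derivative in the subspace; outside the subspace, \<open>f'\<close> is an arbitrary extension.
\<close>

definition polyball_holomorphic ::
    "nat \<Rightarrow> (nat \<Rightarrow> nat) \<Rightarrow> ((nat \<times> nat) ell2 \<Rightarrow> (nat \<times> nat) ell2) \<Rightarrow> bool"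
  where "polyball_holomorphic m n f \<longleftrightarrow>
    (\<forall>z\<in>polyball m n. \<exists>f'. (f has_derivative f') (at z within polyball m n) \<and>
      (\<forall>c v. f' (c *\<^sub>C v) = c *\<^sub>C f' v))"

definition Aut_polyball ::
    "nat \<Rightarrow> (nat \<Rightarrow> nat) \<Rightarrow> ((nat \<times> nat) ell2 \<Rightarrow> (nat \<times> nat) ell2) monoid"
  where "Aut_polyball m n = BijGroup (polyball m n)
    \<lparr>carrier := {f \<in> Bij (polyball m n).
      polyball_holomorphic m n f \<and> polyball_holomorphic m n (inv_into (polyball m n) f)}\<rparr>"


section \<open>Characters\<close>

definition characters :: "'a op set \<Rightarrow> ('a op \<Rightarrow> complex) set"
  where "characters \<A> = {\<tau> \<in> extensional \<A>.
    (\<forall>c. \<forall>A\<in>\<A>. \<tau> (scalar_op c o\<^sub>L A) = c * \<tau> A) \<and>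
    (\<forall>A\<in>\<A>. \<forall>B\<in>\<A>. \<tau> (A + B) = \<tau> A + \<tau> B \<and> \<tau> (A o\<^sub>L B) = \<tau> A * \<tau> B) \<and>
    (\<exists>A\<in>\<A>. \<tau> A \<noteq> 0)}"

definition rho ::
    "nat \<Rightarrow> (nat \<Rightarrow> nat) \<Rightarrow> 'a op set \<Rightarrow> (nat \<Rightarrow> nat \<Rightarrow> 'a op) \<Rightarrow> (nat \<times> nat) ell2 \<Rightarrow> 'a op \<Rightarrow> complex"
  where "rho m n \<A> s z =
    (THE \<tau>. \<tau> \<in> characters \<A> \<and> (\<forall>i<m. \<forall>j<n i. \<tau> (s i j) = coord z (i, j)))"

text \<open>The map \<open>\<phi>\<^sup>*\<close> of the polyball, with \<open>\<phi>\<^sup>*(z) = w\<close> iff \<open>\<rho>\<^sub>z \<circ> \<phi> = \<rho>\<^sub>w\<close>.\<close>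

definition star ::
    "nat \<Rightarrow> (nat \<Rightarrow> nat) \<Rightarrow> 'a op set \<Rightarrow> (nat \<Rightarrow> nat \<Rightarrow> 'a op) \<Rightarrow> ('a op \<Rightarrow> 'a op) \<Rightarrow>
      (nat \<times> nat) ell2 \<Rightarrow> (nat \<times> nat) ell2"
  where "star m n \<A> s \<phi> = (\<lambda>z\<in>polyball m n.
    THE w. w \<in> polyball m n \<and> compose \<A> (rho m n \<A> s z) \<phi> = rho m n \<A> s w)"

section \<open>Adjoints and row contractions\<close>

lift_definition basis_vec :: "'a \<Rightarrow> 'a ell2" is "\<lambda>a b. if b = a then 1 else 0"
proof -
  fix a :: 'a
  have "finite {b \<in> UNIV. (cmod (if b = a then 1 else 0))\<^sup>2 \<noteq> 0}"
    by (rule finite_subset[of _ "{a}"]) auto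
  then show "(\<lambda>b. (cmod (if b = a then 1 else 0))\<^sup>2) summable_on UNIV"
    by (rule finite_nonzero_values_imp_summable_on)
qed

lemma coord_basis_vec: "coord (basis_vec a) b = (if b = a then 1 else 0)"
  by transfer simp

lemma coord_sum [simp]: "coord (\<Sum>i\<in>F. x i) a = (\<Sum>i\<in>F. coord (x i) a)"
  by (induction F rule: infinite_finite_induct) simp_all

definition finite_vec :: "'a set \<Rightarrow> ('a \<Rightarrow> complex) \<Rightarrow> 'a ell2"
  where "finite_vec F v = (\<Sum>a\<in>F. v a *\<^sub>C basis_vec a)"

lemma coord_finite_vec:
  assumes "finite F"
  shows "coord (finite_vec F v) a = (if a \<in> F then v a else 0)"
  using assms by (simp add: finite_vec_def coord_basis_vec if_distrib sum.delta' cong: if_cong)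

lemma norm_finite_vec:
  assumes "finite F"
  shows "(norm (finite_vec F v))\<^sup>2 = (\<Sum>a\<in>F. (cmod (v a))\<^sup>2)"
proof -
  have "(norm (finite_vec F v))\<^sup>2 = (\<Sum>\<^sub>\<infinity>a\<in>F. (cmod (v a))\<^sup>2)"
    unfolding norm_ell2_sq
    by (rule infsum_cong_neutral) (auto simp: coord_finite_vec assms)
  then show ?thesis using assms by simp
qed

lemma finite_vec_approx:
  assumes "e > 0"
  shows "\<exists>F. finite F \<and> norm (x - finite_vec F (coord x)) \<le> e"
proof -
  let ?g = "\<lambda>a. (cmod (coord x a))\<^sup>2"
  obtain F where F: "finite F" "dist (sum ?g F) (infsum ?g UNIV) \<le> e\<^sup>2"
    using infsum_finite_approximation[OF coord_summable[of x], of "e\<^sup>2"] assms by auto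
  have "(norm (x - finite_vec F (coord x)))\<^sup>2 = infsum ?g (UNIV - F)"
    unfolding norm_ell2_sq
    by (rule infsum_cong_neutral) (auto simp: coord_finite_vec F)
  also have "\<dots> = infsum ?g UNIV - infsum ?g F"
    by (rule infsum_Diff) (use F coord_summable[of x] in auto)
  also have "\<dots> \<le> e\<^sup>2"
    using F by (simp add: dist_real_def)
  finally show ?thesis
    using F assms by (intro exI[of _ F]) (simp add: power2_le_iff_abs_le)
qed

lemma riesz_ell2:
  fixes f :: "'a ell2 \<Rightarrow> real"
  assumes f: "bounded_linear f"
  shows "\<exists>v. \<forall>x. f x = x \<bullet> v"
proof -
  interpret f: bounded_linear f by fact
  define v where "v a = Complex (f (basis_vec a)) (f (\<i> *\<^sub>C basis_vec a))" for a
  have fe: "f (c *\<^sub>C basis_vec a) = Re (c * cnj (v a))" for c a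
  proof -
    have "c *\<^sub>C basis_vec a = Re c *\<^sub>R basis_vec a + Im c *\<^sub>R (\<i> *\<^sub>C basis_vec a)"
      by (rule ell2_eqI) (simp add: complex_eq_iff coord_basis_vec)
    then show ?thesis by (simp add: f.add f.scaleR v_def)
  qed
  obtain K where K: "\<And>x. norm (f x) \<le> norm x * K" "K > 0"
    using f.pos_bounded by auto
  have bound: "(\<Sum>a\<in>F. (cmod (v a))\<^sup>2) \<le> K\<^sup>2" if F: "finite F" for F
  proof -
    define S where "S = (\<Sum>a\<in>F. (cmod (v a))\<^sup>2)"
    have "f (finite_vec F v) = S"
      unfolding finite_vec_def f.sum fe S_def
      by (intro sum.cong refl) (simp add: complex_mult_cnj cmod_power2)
    then have "S \<le> norm (finite_vec F v) * K"
      using K(1)[of "finite_vec F v"] by simp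
    moreover have n: "(norm (finite_vec F v))\<^sup>2 = S"
      by (simp add: norm_finite_vec F S_def)
    ultimately have "norm (finite_vec F v) * norm (finite_vec F v) \<le> norm (finite_vec F v) * K"
      by (simp add: power2_eq_square)
    then have "norm (finite_vec F v) \<le> K"
      using K(2) by (cases "norm (finite_vec F v) = 0") (auto simp: mult_le_cancel_left)
    then show ?thesis unfolding S_def[symmetric] n[symmetric] by (simp add: power_mono)
  qed
  have sv: "(\<lambda>a. (cmod (v a))\<^sup>2) summable_on UNIV"
    by (rule nonneg_bdd_above_summable_on) (auto intro!: bdd_aboveI[of _ "K\<^sup>2"] bound)
  define w where "w = Abs_ell2 v"
  have w: "coord w a = v a" for a
    using sv by (simp add: w_def Abs_ell2_inverse)
  have we: "(c *\<^sub>C basis_vec a) \<bullet> w = Re (c * cnj (v a))" for c a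
  proof -
    have "(\<Sum>\<^sub>\<infinity>b. coord (c *\<^sub>C basis_vec a) b * cnj (coord w b)) = (\<Sum>\<^sub>\<infinity>b\<in>{a}. c * cnj (v b))"
      by (rule infsum_cong_neutral) (auto simp: coord_basis_vec w)
    then show ?thesis by (simp add: inner_ell2_def)
  qed
  define g where "g x = f x - x \<bullet> w" for x
  have g: "bounded_linear g"
    unfolding g_def by (intro bounded_linear_sub f bounded_linear_inner_left)
  interpret g: bounded_linear g by fact
  obtain L where L: "\<And>x. norm (g x) \<le> norm x * L" "L > 0"
    using g.pos_bounded by auto
  have g0: "g (finite_vec F u) = 0" for F u
    unfolding finite_vec_def g.sum by (simp add: g_def fe we)
  have "g x = 0" for x
  proof -
    have "\<bar>g x\<bar> \<le> e" if "e > 0" for e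
    proof -
      have "e / L > 0" using that L(2) by simp
      then obtain F where F: "norm (x - finite_vec F (coord x)) \<le> e / L"
        using finite_vec_approx by blast
      have "\<bar>g x\<bar> = norm (g (x - finite_vec F (coord x)))"
        by (simp add: g.diff g0)
      also have "\<dots> \<le> (e / L) * L"
        using L(1)[of "x - finite_vec F (coord x)"] F L(2) by (smt (verit) mult_right_mono)
      finally show ?thesis using L(2) by simp
    qed
    then show ?thesis by (metis abs_le_zero_iff field_le_epsilon add_0)
  qed
  then show ?thesis by (auto simp: g_def intro!: exI[of _ w])
qed

lemma adjoint_op:
  fixes A :: "'a op"
  shows "blinfun_apply A x \<bullet> y = x \<bullet> adjoint A y"
proof -
  have "\<forall>y. \<exists>v. \<forall>x. blinfun_apply A x \<bullet> y = x \<bullet> v"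
    by (intro allI riesz_ell2)
       (intro bounded_linear_compose[OF bounded_linear_inner_left] blinfun.bounded_linear_right)
  then have "\<exists>f'. \<forall>x y. blinfun_apply A x \<bullet> y = x \<bullet> f' y"
    by metis
  then show ?thesis
    unfolding adjoint_def by (rule someI2_ex) auto
qed

lemma row_contraction_iff:
  fixes T :: "nat \<Rightarrow> 'a op"
  shows "row_contraction k T \<longleftrightarrow> (\<forall>j<k. T j \<in> bounded_ops) \<and>
    (\<forall>x. (norm (\<Sum>j<k. T j (x j)))\<^sup>2 \<le> (\<Sum>j<k. (norm (x j))\<^sup>2))"
proof -
  let ?S = "\<lambda>x. \<Sum>j<k. (norm (adjoint (T j) x))\<^sup>2"
  have S: "(\<Sum>j<k. T j (adjoint (T j) x)) \<bullet> x = ?S x" for x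
    by (simp add: inner_sum_left adjoint_op power2_norm_eq_inner)
  have "(\<forall>x. ?S x \<le> x \<bullet> x) \<longleftrightarrow>
    (\<forall>x. (norm (\<Sum>j<k. T j (x j)))\<^sup>2 \<le> (\<Sum>j<k. (norm (x j))\<^sup>2))" (is "?L \<longleftrightarrow> ?R")
  proof
    assume L: ?L
    show ?R
    proof
      fix x :: "nat \<Rightarrow> 'a ell2"
      define y where "y = (\<Sum>j<k. T j (x j))"
      define X where "X = L2_set (\<lambda>j. norm (x j)) {..<k}"
      have X: "X \<ge> 0" "X\<^sup>2 = (\<Sum>j<k. (norm (x j))\<^sup>2)"
        by (simp_all add: X_def L2_set_def sum_nonneg)
      have "(norm y)\<^sup>2 = (\<Sum>j<k. T j (x j)) \<bullet> y"
        by (simp add: power2_norm_eq_inner y_def)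
      also have "\<dots> = (\<Sum>j<k. x j \<bullet> adjoint (T j) y)"
        by (simp add: inner_sum_left adjoint_op)
      also have "\<dots> \<le> (\<Sum>j<k. \<bar>norm (x j)\<bar> * \<bar>norm (adjoint (T j) y)\<bar>)"
        by (intro sum_mono) (simp add: norm_cauchy_schwarz)
      also have "\<dots> \<le> X * L2_set (\<lambda>j. norm (adjoint (T j) y)) {..<k}"
        unfolding X_def by (rule L2_set_mult_ineq)
      also have "\<dots> \<le> X * norm y"
        using L X(1) by (intro mult_left_mono) (auto simp: L2_set_def real_le_lsqrt power2_norm_eq_inner sum_nonneg)
      finally have "norm y * norm y \<le> X * norm y" by (simp add: power2_eq_square)
      then have "norm y \<le> X"
        using X(1) by (cases "norm y = 0") (auto simp: mult_le_cancel_right)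
      then show "(norm (\<Sum>j<k. T j (x j)))\<^sup>2 \<le> (\<Sum>j<k. (norm (x j))\<^sup>2)"
        unfolding X(2)[symmetric] y_def by (simp add: power_mono)
    qed
  next
    assume R: ?R
    show ?L
    proof
      fix x
      let ?z = "\<Sum>j<k. T j (adjoint (T j) x)"
      have z: "(norm ?z)\<^sup>2 \<le> ?S x" by (rule R[rule_format])
      have "?S x \<le> norm ?z * norm x"
        unfolding S[symmetric] by (rule norm_cauchy_schwarz)
      then have "(?S x)\<^sup>2 \<le> (norm ?z * norm x)\<^sup>2"
        by (intro power_mono) (auto simp: sum_nonneg)
      also have "\<dots> \<le> ?S x * (norm x)\<^sup>2"
        unfolding power_mult_distrib by (intro mult_right_mono z) auto
      finally have "?S x * ?S x \<le> ?S x * (norm x)\<^sup>2" by (simp add: power2_eq_square)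
      moreover have "?S x \<ge> 0" by (simp add: sum_nonneg)
      ultimately have "?S x \<le> (norm x)\<^sup>2"
        by (cases "?S x = 0") (simp_all only: mult_le_cancel_left, auto)
      then show "?S x \<le> x \<bullet> x" by (simp add: power2_norm_eq_inner)
    qed
  qed
  then show ?thesis by (auto simp: row_contraction_def S)
qed

lemma row_contraction_norm_le:
  assumes "row_contraction k T" "j < k"
  shows "norm (T j) \<le> 1"
proof (rule norm_blinfun_bound)
  fix x
  have "(norm (\<Sum>i<k. T i (if i = j then x else 0)))\<^sup>2 \<le> (\<Sum>i<k. (norm (if i = j then x else 0))\<^sup>2)"
    by (rule assms(1)[unfolded row_contraction_iff, THEN conjunct2, rule_format])
  moreover have "(\<Sum>i<k. T i (if i = j then x else 0)) = (\<Sum>i<k. if i = j then T j x else 0)"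
    by (intro sum.cong) auto
  moreover have "(\<Sum>i<k. (norm (if i = j then x else 0))\<^sup>2) = (\<Sum>i<k. if i = j then (norm x)\<^sup>2 else 0)"
    by (intro sum.cong) auto
  ultimately show "norm (T j x) \<le> 1 * norm x"
    using assms(2) by (simp add: sum.delta power2_le_iff_abs_le)
qed simp


section \<open>Existence of the free product\<close>

lemma scalar_op_apply [simp]: "scalar_op c x = c *\<^sub>C x"
  by transfer simp

lemma scalar_op_1: "scalar_op 1 = id_blinfun"
  by (rule blinfun_eqI) (auto intro: ell2_eqI)

lemma op_compose_id: "A o\<^sub>L id_blinfun = A" for A :: "'a op"
  by (rule blinfun_eqI) simp

lemma scalar_op_neg: "scalar_op (- 1) o\<^sub>L A = - A"
  by (rule blinfun_eqI) (auto intro: ell2_eqI simp: blinfun.minus_left)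

lemma closed_bounded_ops: "closed (bounded_ops :: 'a op set)"
proof -
  have "bounded_ops = (\<Inter>c. {A :: 'a op. A o\<^sub>L scalar_op c = scalar_op c o\<^sub>L A})"
    by (auto simp: bounded_ops_def blinfun_apply_inject[symmetric] fun_eq_iff)
  also have "closed \<dots>"
    by (intro closed_INT ballI closed_Collect_eq continuous_intros)
  finally show ?thesis .
qed

lemma generated_algebra_bounded_ops:
  assumes "G \<subseteq> bounded_ops" "A \<in> generated_algebra G"
  shows "A \<in> bounded_ops"
  using assms(2)
proof induction
  case (gen A)
  then show ?case using assms(1) by auto
qed (auto simp: bounded_ops_def blinfun.add_left cscale_add intro!: ell2_eqI)

text \<open>Operators acting as a direct sum of copies of \<open>\<ell>\<^sup>2(\<nat>)\<close>, one for each \<open>t :: 'f\<close>.\<close>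

lemma summable_slice:
  "(\<lambda>a. (cmod (f a))\<^sup>2) summable_on UNIV \<Longrightarrow> (\<lambda>k. (cmod (f (t, k)))\<^sup>2) summable_on UNIV"
proof -
  assume "(\<lambda>a. (cmod (f a))\<^sup>2) summable_on UNIV"
  then have "(\<lambda>a. (cmod (f a))\<^sup>2) summable_on range (Pair t)"
    by (rule summable_on_subset_banach) auto
  then show ?thesis
    by (subst (asm) summable_on_reindex) (auto simp: o_def inj_on_def)
qed

lift_definition slice_vec :: "'f \<Rightarrow> ('f \<times> 'b) ell2 \<Rightarrow> 'b ell2" is "\<lambda>t f k. f (t, k)"
  by (rule summable_slice)

lemma coord_slice_vec [simp]: "coord (slice_vec t x) k = coord x (t, k)"
  by transfer simp

lemma summable_prod_iff:
  fixes f :: "'f \<times> 'b \<Rightarrow> complex"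
  shows "(\<lambda>a. (cmod (f a))\<^sup>2) summable_on UNIV \<longleftrightarrow>
    (\<forall>t. (\<lambda>k. (cmod (f (t, k)))\<^sup>2) summable_on UNIV) \<and>
    (\<lambda>t. \<Sum>\<^sub>\<infinity>k. (cmod (f (t, k)))\<^sup>2) summable_on UNIV"
proof -
  have *: "(\<lambda>a. norm ((cmod (f a))\<^sup>2)) summable_on Sigma UNIV (\<lambda>_. UNIV) \<longleftrightarrow>
    (\<forall>t\<in>UNIV. (\<lambda>k. norm ((cmod (f (t, k)))\<^sup>2)) summable_on UNIV) \<and>
    (\<lambda>t. norm (\<Sum>\<^sub>\<infinity>k\<in>UNIV. norm ((cmod (f (t, k)))\<^sup>2))) summable_on UNIV"
    by (rule Infinite_Sum.abs_summable_on_Sigma_iff)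
  then show ?thesis by (simp add: infsum_nonneg)
qed

lemma slice_norms_summable: "(\<lambda>t. (norm (slice_vec t x))\<^sup>2) summable_on UNIV"
  and norm_slices: "(norm x)\<^sup>2 = (\<Sum>\<^sub>\<infinity>t. (norm (slice_vec t x))\<^sup>2)"
proof -
  show "(\<lambda>t. (norm (slice_vec t x))\<^sup>2) summable_on UNIV"
    using coord_summable[of x] unfolding summable_prod_iff by (simp add: norm_ell2_sq)
  have "(\<Sum>\<^sub>\<infinity>a\<in>Sigma UNIV (\<lambda>_. UNIV). (cmod (coord x a))\<^sup>2) =
    (\<Sum>\<^sub>\<infinity>t. \<Sum>\<^sub>\<infinity>k. (cmod (coord x (t, k)))\<^sup>2)"
    by (rule infsum_Sigma_banach[symmetric]) (use coord_summable[of x] in simp)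
  then show "(norm x)\<^sup>2 = (\<Sum>\<^sub>\<infinity>t. (norm (slice_vec t x))\<^sup>2)"
    by (simp add: norm_ell2_sq)
qed

lemma norm_slice_vec_le: "norm (slice_vec t x) \<le> norm x"
proof -
  have "(\<Sum>t'\<in>{t}. (norm (slice_vec t' x))\<^sup>2) \<le> (\<Sum>\<^sub>\<infinity>t. (norm (slice_vec t x))\<^sup>2)"
    by (rule finite_sum_le_infsum) (auto simp: slice_norms_summable)
  then show ?thesis by (simp flip: norm_slices)
qed

lift_definition slice_op :: "'f \<Rightarrow> ('f \<times> 'b) ell2 \<Rightarrow>\<^sub>L 'b ell2" is slice_vec
  by (rule bounded_linear_intro[where K = 1]) (auto intro: ell2_eqI simp: norm_slice_vec_le)

lift_definition incl_vec :: "'f \<Rightarrow> 'b ell2 \<Rightarrow> ('f \<times> 'b) ell2"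
  is "\<lambda>t f a. if fst a = t then f (snd a) else 0"
proof -
  fix t :: 'f and f :: "'b \<Rightarrow> complex"
  assume f: "(\<lambda>a. (cmod (f a))\<^sup>2) summable_on UNIV"
  let ?g = "\<lambda>u. \<Sum>\<^sub>\<infinity>k. (cmod (if u = t then f k else 0))\<^sup>2"
  have "?g u = 0" if "u \<noteq> t" for u
    using that by simp
  then have "{u \<in> UNIV. ?g u \<noteq> 0} \<subseteq> {t}"
    by blast
  then have "finite {u \<in> UNIV. ?g u \<noteq> 0}"
    by (rule finite_subset) simp
  then have "?g summable_on UNIV"
    by (rule finite_nonzero_values_imp_summable_on)
  moreover have "(\<lambda>k. (cmod (if u = t then f k else 0))\<^sup>2) summable_on UNIV" for u
    using f by (cases "u = t") simp_all
  ultimately show "(\<lambda>a. (cmod (if fst a = t then f (snd a) else 0))\<^sup>2) summable_on UNIV"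
    by (subst summable_prod_iff) (simp only: fst_conv snd_conv, blast)
qed

lemma coord_incl_vec [simp]:
  "coord (incl_vec t x) a = (if fst a = t then coord x (snd a) else 0)"
  by transfer simp

lemma slice_incl_vec: "slice_vec u (incl_vec t x) = (if u = t then x else 0)"
  by (rule ell2_eqI) simp

lemma norm_incl_vec: "norm (incl_vec t x) = norm x"
proof -
  have "(norm (incl_vec t x))\<^sup>2 = (\<Sum>\<^sub>\<infinity>u\<in>{t}. (norm x)\<^sup>2)"
    unfolding norm_slices by (rule infsum_cong_neutral) (auto simp: slice_incl_vec)
  then show ?thesis by simp
qed

lift_definition incl_op :: "'f \<Rightarrow> 'b ell2 \<Rightarrow>\<^sub>L ('f \<times> 'b) ell2" is incl_vec
  by (rule bounded_linear_intro[where K = 1]) (auto intro: ell2_eqI simp: norm_incl_vec)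

definition diag_vec :: "('f \<Rightarrow> 'b op) \<Rightarrow> ('f \<times> 'b) ell2 \<Rightarrow> ('f \<times> 'b) ell2"
  where "diag_vec R x = Abs_ell2 (\<lambda>(t, k). coord (R t (slice_vec t x)) k)"

lemma
  assumes R: "\<And>t. norm (R t) \<le> 1"
  shows slice_diag_vec: "slice_vec t (diag_vec R x) = R t (slice_vec t x)"
    and norm_diag_vec: "norm (diag_vec R x) \<le> norm x"
proof -
  have le: "(norm (R t (slice_vec t x)))\<^sup>2 \<le> (norm (slice_vec t x))\<^sup>2" for t x
  proof (rule power_mono)
    have "norm (R t (slice_vec t x)) \<le> norm (R t) * norm (slice_vec t x)"
      by (rule norm_blinfun)
    also have "\<dots> \<le> 1 * norm (slice_vec t x)"
      by (intro mult_right_mono R) auto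
    finally show "norm (R t (slice_vec t x)) \<le> norm (slice_vec t x)" by simp
  qed simp
  have "(\<lambda>t. (norm (R t (slice_vec t x)))\<^sup>2) summable_on UNIV"
    by (rule summable_on_comparison_test[OF slice_norms_summable[of x]]) (auto simp: le)
  then have "(\<lambda>a. (cmod (case a of (t, k) \<Rightarrow> coord (R t (slice_vec t x)) k))\<^sup>2) summable_on UNIV"
    unfolding summable_prod_iff by (simp add: coord_summable norm_ell2_sq)
  then have c: "coord (diag_vec R x) (t, k) = coord (R t (slice_vec t x)) k" for t k
    by (simp add: diag_vec_def Abs_ell2_inverse)
  show s: "slice_vec t (diag_vec R x) = R t (slice_vec t x)" for t
    by (rule ell2_eqI) (simp add: c)
  have "(norm (diag_vec R x))\<^sup>2 \<le> (norm x)\<^sup>2"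
    unfolding norm_slices s
    by (rule infsum_mono) (auto intro: summable_on_comparison_test[OF slice_norms_summable[of x]]
        simp: le slice_norms_summable)
  then show "norm (diag_vec R x) \<le> norm x"
    by (simp add: power2_le_iff_abs_le)
qed

lemma ell2_slice_eqI: "(\<And>t. slice_vec t x = slice_vec t y) \<Longrightarrow> x = y"
  by (rule ell2_eqI) (metis coord_slice_vec surj_pair)

definition diag_op :: "('f \<Rightarrow> 'b op) \<Rightarrow> ('f \<times> 'b) op"
  where "diag_op R = Blinfun (diag_vec R)"

lemma slice_simps:
  "slice_vec t (x + y) = slice_vec t x + slice_vec t y"
  "slice_vec t (r *\<^sub>R x) = r *\<^sub>R slice_vec t x"
  "slice_vec t (c *\<^sub>C x) = c *\<^sub>C slice_vec t x"
  "slice_vec t (\<Sum>i\<in>F. z i) = (\<Sum>i\<in>F. slice_vec t (z i))"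
  by (rule ell2_eqI; simp)+

lemma slice_diag_op:
  assumes R: "\<And>t. norm (R t) \<le> 1"
  shows "slice_vec t (diag_op R x) = R t (slice_vec t x)"
proof -
  have "bounded_linear (diag_vec R)"
    by (rule bounded_linear_intro[where K = 1])
       (auto intro: ell2_slice_eqI simp: slice_diag_vec R norm_diag_vec slice_simps
         blinfun.add_right blinfun.scaleR_right)
  then show ?thesis
    by (simp add: diag_op_def bounded_linear_Blinfun_apply slice_diag_vec R)
qed

lemma diag_op_bounded_ops:
  assumes "\<And>t. norm (R t) \<le> 1" "\<And>t. R t \<in> bounded_ops"
  shows "diag_op R \<in> bounded_ops"
  using assms unfolding bounded_ops_def
  by (auto intro!: ell2_slice_eqI simp: slice_diag_op slice_simps)

lemma row_contraction_diag_op: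
  fixes R :: "nat \<Rightarrow> 'f \<Rightarrow> 'b op"
  assumes "\<And>t. row_contraction k (\<lambda>j. R j t)" "\<And>j t. norm (R j t) \<le> 1"
  shows "row_contraction k (\<lambda>j. diag_op (R j))"
  unfolding row_contraction_iff
proof safe
  fix j assume "j < k"
  then show "diag_op (R j) \<in> bounded_ops"
    using assms by (intro diag_op_bounded_ops) (auto simp: row_contraction_def)
next
  fix x :: "nat \<Rightarrow> ('f \<times> 'b) ell2"
  let ?y = "\<Sum>j<k. diag_op (R j) (x j)"
  have s: "(\<lambda>t. \<Sum>j<k. (norm (slice_vec t (x j)))\<^sup>2) summable_on UNIV" for k
    by (induction k) (auto intro: summable_on_add slice_norms_summable)
  have le: "(norm (slice_vec t ?y))\<^sup>2 \<le> (\<Sum>j<k. (norm (slice_vec t (x j)))\<^sup>2)" for t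
    unfolding slice_simps slice_diag_op[OF assms(2)]
    by (rule assms(1)[unfolded row_contraction_iff, THEN conjunct2, rule_format])
  have "(norm ?y)\<^sup>2 \<le> (\<Sum>\<^sub>\<infinity>t. \<Sum>j<k. (norm (slice_vec t (x j)))\<^sup>2)"
    unfolding norm_slices[of ?y] by (rule infsum_mono[OF slice_norms_summable s le])
  also have "\<dots> = (\<Sum>j<k. (norm (x j))\<^sup>2)"
  proof (induction k)
    case (Suc k)
    then show ?case
      by (simp add: infsum_add slice_norms_summable s norm_slices[symmetric])
  qed simp
  finally show "(norm ?y)\<^sup>2 \<le> (\<Sum>j<k. (norm (x j))\<^sup>2)" .
qed

subsection \<open>Matrix norms\<close>

lemma mat_norm_bdd:
  "bdd_above ((\<lambda>x. L2_set (\<lambda>p. norm (\<Sum>q<N. blinfun_apply (A p q) (x q))) {..<N}) `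
    {x :: nat \<Rightarrow> 'a ell2. L2_set (\<lambda>q. norm (x q)) {..<N} \<le> 1})"
proof (rule bdd_aboveI2)
  fix x :: "nat \<Rightarrow> 'a ell2"
  assume x: "x \<in> {x. L2_set (\<lambda>q. norm (x q)) {..<N} \<le> 1}"
  have x1: "norm (x q) \<le> 1" if "q < N" for q
    using member_le_L2_set[of "{..<N}" q "\<lambda>q. norm (x q)"] that x by auto
  have "L2_set (\<lambda>p. norm (\<Sum>q<N. A p q (x q))) {..<N} \<le> (\<Sum>p<N. norm (\<Sum>q<N. A p q (x q)))"
    by (rule L2_set_le_sum) auto
  also have "\<dots> \<le> (\<Sum>p<N. \<Sum>q<N. norm (A p q))"
  proof (intro sum_mono order_trans[OF norm_sum])
    fix p q assume "q \<in> {..<N}"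
    then show "norm (A p q (x q)) \<le> norm (A p q)"
      using norm_blinfun[of "A p q" "x q"] x1[of q] mult_left_mono[of "norm (x q)" 1 "norm (A p q)"]
      by simp
  qed
  finally show "L2_set (\<lambda>p. norm (\<Sum>q<N. A p q (x q))) {..<N} \<le> (\<Sum>p<N. \<Sum>q<N. norm (A p q))" .
qed

lemma mat_norm_leI:
  fixes A :: "nat \<Rightarrow> nat \<Rightarrow> 'a op"
  assumes "\<And>x. L2_set (\<lambda>q. norm (x q)) {..<N} \<le> 1 \<Longrightarrow>
    L2_set (\<lambda>p. norm (\<Sum>q<N. blinfun_apply (A p q) (x q))) {..<N} \<le> C"
  shows "mat_norm N A \<le> C"
  unfolding mat_norm_def
proof (rule cSUP_least)
  have "(\<lambda>_. 0) \<in> {x :: nat \<Rightarrow> 'a ell2. L2_set (\<lambda>q. norm (x q)) {..<N} \<le> 1}"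
    by (simp add: L2_set_def)
  then show "{x :: nat \<Rightarrow> 'a ell2. L2_set (\<lambda>q. norm (x q)) {..<N} \<le> 1} \<noteq> {}"
    by (rule ex_in_conv[THEN iffD1, OF exI[where x = "\<lambda>_. 0"]])
next
  fix x :: "nat \<Rightarrow> 'a ell2"
  assume "x \<in> {x. L2_set (\<lambda>q. norm (x q)) {..<N} \<le> 1}"
  then show "L2_set (\<lambda>p. norm (\<Sum>q<N. A p q (x q))) {..<N} \<le> C"
    by (intro assms) simp
qed

lemma mat_norm_upper:
  "L2_set (\<lambda>q. norm (x q)) {..<N} \<le> 1 \<Longrightarrow>
    L2_set (\<lambda>p. norm (\<Sum>q<N. blinfun_apply (A p q) (x q))) {..<N} \<le> mat_norm N A"
  unfolding mat_norm_def by (rule cSUP_upper[OF _ mat_norm_bdd]) auto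

lemma mat_norm_1:
  fixes A :: "nat \<Rightarrow> nat \<Rightarrow> 'a op"
  shows "mat_norm 1 A = norm (A 0 0)"
proof (rule antisym)
  show "mat_norm 1 A \<le> norm (A 0 0)"
  proof (rule mat_norm_leI)
    fix x :: "nat \<Rightarrow> 'a ell2"
    assume "L2_set (\<lambda>q. norm (x q)) {..<1} \<le> 1"
    then have "norm (x 0) \<le> 1" by (simp add: L2_set_def)
    then show "L2_set (\<lambda>p. norm (\<Sum>q<1. A p q (x q))) {..<1} \<le> norm (A 0 0)"
      using norm_blinfun[of "A 0 0" "x 0"] mult_left_mono[of "norm (x 0)" 1 "norm (A 0 0)"]
      by (simp add: L2_set_def)
  qed
  have up: "norm (A 0 0 x) \<le> mat_norm 1 A" if "norm x \<le> 1" for x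
    using mat_norm_upper[of "\<lambda>_. x" 1 A] that by (simp add: L2_set_def)
  show "norm (A 0 0) \<le> mat_norm 1 A"
  proof (rule norm_blinfun_bound)
    show "0 \<le> mat_norm 1 A" using up[of 0] by simp
    fix x
    show "norm (A 0 0 x) \<le> mat_norm 1 A * norm x"
    proof (cases "x = 0")
      case False
      have "norm (A 0 0 (x /\<^sub>R norm x)) \<le> mat_norm 1 A"
        by (rule up) (simp add: False)
      then show ?thesis using False by (simp add: blinfun.scaleR_right field_simps)
    qed simp
  qed
qed

lemma completely_contractive_norm_le:
  assumes "completely_contractive \<A> \<phi>" "A \<in> \<A>"
  shows "norm (\<phi> A) \<le> norm A"
proof -
  have "(\<forall>p<1::nat. \<forall>q<1::nat. A \<in> \<A>) \<longrightarrow> mat_norm 1 (\<lambda>p q. \<phi> A) \<le> mat_norm 1 (\<lambda>p q. A)"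
    using assms(1)[unfolded completely_contractive_def, THEN spec, of 1, THEN spec, of "\<lambda>_ _. A"] .
  then have "mat_norm 1 (\<lambda>p q. \<phi> A) \<le> mat_norm 1 (\<lambda>p q. A)"
    using assms(2) by (elim mp) simp
  then show ?thesis unfolding mat_norm_1 .
qed

lemma unital_hom_eq_closure:
  fixes \<phi> \<psi> :: "'a op \<Rightarrow> 'b op"
  assumes \<A>: "\<A> = closure (generated_algebra G)"
    and h: "unital_hom \<A> \<phi>" "unital_hom \<A> \<psi>"
    and c: "completely_contractive \<A> \<phi>" "completely_contractive \<A> \<psi>"
    and eq: "\<And>A. A \<in> G \<Longrightarrow> \<phi> A = \<psi> A" and A: "A \<in> \<A>"
  shows "\<phi> A = \<psi> A"
proof -
  have sub: "B \<in> \<A>" if "B \<in> generated_algebra G" for B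
    using that \<A> closure_subset by blast
  have hs: "\<phi> (scalar_op c) = scalar_op c" if "unital_hom \<A> \<phi>" for c and \<phi> :: "'a op \<Rightarrow> 'b op"
  proof -
    have "id_blinfun \<in> \<A>" using sub generated_algebra.scalar[of 1 G] by (simp add: scalar_op_1)
    then have "\<phi> (scalar_op c o\<^sub>L id_blinfun) = scalar_op c o\<^sub>L \<phi> id_blinfun"
      using that by (auto simp: unital_hom_def)
    then show ?thesis using that by (simp add: unital_hom_def op_compose_id)
  qed
  have gen: "\<phi> B = \<psi> B" if "B \<in> generated_algebra G" for B
    using that
  proof induction
    case (add A B)
    then show ?case using h sub by (simp add: unital_hom_def)
  next
    case (mult A B)
    then show ?case using h sub by (simp add: unital_hom_def)
  qed (simp_all add: eq hs h)
  have add: "\<phi> (B + C) = \<phi> B + \<phi> C" if "B \<in> \<A>" "C \<in> \<A>" "unital_hom \<A> \<phi>" for B C and \<phi> :: "'a op \<Rightarrow> 'b op"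
    using that by (simp add: unital_hom_def)
  have "norm (\<phi> A - \<psi> A) \<le> e" if "e > 0" for e
  proof -
    obtain B where B: "B \<in> generated_algebra G" "dist B A < e / 2"
      using A \<open>e > 0\<close> unfolding \<A> closure_approachable by (metis half_gt_zero)
    have m: "A + (scalar_op (-1) o\<^sub>L B) \<in> \<A>" "scalar_op (-1) o\<^sub>L B \<in> \<A>"
    proof -
      show 1: "scalar_op (-1) o\<^sub>L B \<in> \<A>"
        by (intro sub generated_algebra.mult generated_algebra.scalar B)
      have "(\<lambda>X. X + (scalar_op (-1) o\<^sub>L B)) ` closure (generated_algebra G) \<subseteq> \<A>"
      proof (rule image_closure_subset)
        show "continuous_on (closure (generated_algebra G)) (\<lambda>X. X + (scalar_op (-1) o\<^sub>L B))"
          by (intro continuous_intros)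
        show "(\<lambda>X. X + (scalar_op (-1) o\<^sub>L B)) ` generated_algebra G \<subseteq> \<A>"
          by (auto intro!: sub generated_algebra.add generated_algebra.mult generated_algebra.scalar B)
      qed (simp add: \<A>)
      then show "A + (scalar_op (-1) o\<^sub>L B) \<in> \<A>" using A \<A> by auto
    qed
    have d: "\<phi> (A + (scalar_op (-1) o\<^sub>L B)) = \<phi> A - \<phi> B"
      if "unital_hom \<A> \<phi>" for \<phi> :: "'a op \<Rightarrow> 'b op"
    proof -
      have "\<phi> (scalar_op (-1) o\<^sub>L B) = scalar_op (-1) o\<^sub>L \<phi> B"
        using that sub[OF B(1)] by (simp add: unital_hom_def)
      then show ?thesis
        using add[OF A m(2) that] by (simp only: scalar_op_neg) simp
    qed
    have "norm (\<phi> A - \<phi> B) \<le> norm (A - B)" "norm (\<psi> A - \<psi> B) \<le> norm (A - B)"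
      using completely_contractive_norm_le[OF c(1) m(1)] completely_contractive_norm_le[OF c(2) m(1)]
      unfolding d[OF h(1)] d[OF h(2)] by (simp_all add: scalar_op_neg)
    moreover have "norm (A - B) < e / 2"
      using B(2) by (simp add: dist_norm norm_minus_commute)
    moreover have "norm (\<phi> A - \<psi> A) \<le> norm (\<phi> A - \<phi> B) + norm (\<psi> A - \<psi> B)"
      using norm_triangle_ineq4[of "\<phi> A - \<phi> B" "\<psi> A - \<psi> B"] gen[OF B(1)] by simp
    ultimately show ?thesis by linarith
  qed
  then have "norm (\<phi> A - \<psi> A) \<le> 0" by (metis field_le_epsilon add_0)
  then show ?thesis by simp
qed

text \<open>
  The direct sum of all families of row contractions on \<open>\<ell>\<^sup>2(\<nat>)\<close> generates a model of the
  free product.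
\<close>

theorem free_product_exists:
  "\<exists>\<A> s. is_free_product m n (\<A> :: ((nat \<Rightarrow> nat \<Rightarrow> nat op) \<times> nat) op set) s"
proof -
  define R :: "nat \<Rightarrow> nat \<Rightarrow> (nat \<Rightarrow> nat \<Rightarrow> nat op) \<Rightarrow> nat op"
    where "R i j T = (if i < m \<and> j < n i \<and> (\<forall>i<m. row_contraction (n i) (T i)) then T i j else 0)"
    for i j T
  have R1: "norm (R i j T) \<le> 1" for i j T
    by (auto simp: R_def intro: row_contraction_norm_le)
  have Rrow: "row_contraction (n i) (\<lambda>j. R i j T)" if "i < m" for i T
  proof (cases "\<forall>i<m. row_contraction (n i) (T i)")
    case True
    then show ?thesis using that by (auto simp: row_contraction_iff R_def)
  next
    case False
    then have "R i j T = 0" for j by (auto simp: R_def)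
    then show ?thesis by (auto simp: row_contraction_iff bounded_ops_def sum_nonneg intro!: ell2_eqI)
  qed
  define s where "s i j = diag_op (R i j)" for i j
  define G where "G = {s i j | i j. i < m \<and> j < n i}"
  define \<A> where "\<A> = closure (generated_algebra G)"
  have srow: "row_contraction (n i) (s i)" if "i < m" for i
    using row_contraction_diag_op[of "n i" "R i"] Rrow[OF that] R1 by (simp add: s_def[abs_def])
  have Gb: "G \<subseteq> bounded_ops"
    using srow by (auto simp: G_def row_contraction_def)
  have Ab: "\<A> \<subseteq> bounded_ops"
    unfolding \<A>_def
    by (rule closure_minimal) (auto intro: closed_bounded_ops generated_algebra_bounded_ops[OF Gb])
  have id: "id_blinfun \<in> \<A>"
    using generated_algebra.scalar[of 1 G] closure_subset unfolding \<A>_def scalar_op_1 by blast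
  have sA: "s i j \<in> \<A>" if "i < m" "j < n i" for i j
    using that closure_subset[of "generated_algebra G"]
    by (auto simp: \<A>_def G_def intro!: generated_algebra.gen)
  have ex: "\<exists>!\<pi>. \<pi> \<in> extensional \<A> \<and> \<pi> ` \<A> \<subseteq> bounded_ops \<and> unital_hom \<A> \<pi> \<and>
        completely_contractive \<A> \<pi> \<and> (\<forall>i<m. \<forall>j<n i. \<pi> (s i j) = T i j)"
    if T: "\<forall>i<m. row_contraction (n i) (T i)" for T :: "nat \<Rightarrow> nat \<Rightarrow> nat op"
  proof -
    define C where "C A = slice_op T o\<^sub>L A o\<^sub>L incl_op T"
      for A :: "((nat \<Rightarrow> nat \<Rightarrow> nat op) \<times> nat) op"
    have C: "C A x = slice_vec T (A (incl_vec T x))" for A x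
      by (simp add: C_def slice_op.rep_eq incl_op.rep_eq)
    define \<I> where "\<I> = {A. C A o\<^sub>L slice_op T = slice_op T o\<^sub>L A}"
    have \<I>: "A \<in> \<I> \<longleftrightarrow> (\<forall>x. C A (slice_vec T x) = slice_vec T (A x))" for A
      by (auto simp: \<I>_def blinfun_apply_inject[symmetric] fun_eq_iff slice_op.rep_eq)
    have "closed \<I>"
      unfolding \<I>_def C_def by (intro closed_Collect_eq continuous_intros)
    moreover have "generated_algebra G \<subseteq> \<I>"
    proof
      fix A assume "A \<in> generated_algebra G"
      then show "A \<in> \<I>"
      proof induction
        case (gen A)
        then show ?case
          by (auto simp: G_def \<I> C s_def slice_diag_op R1 slice_incl_vec)
      next
        case (mult A B)
        then show ?case unfolding \<I> by (simp add: C) (metis slice_incl_vec)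
      qed (auto simp: \<I> C slice_simps slice_incl_vec blinfun.add_left)
    qed
    ultimately have AI: "\<A> \<subseteq> \<I>"
      unfolding \<A>_def by (rule closure_minimal[rotated])
    define \<pi> where "\<pi> = restrict C \<A>"
    have clA: "\<A> = closure \<A>" by (simp add: \<A>_def)
    have g: "scalar_op c o\<^sub>L A \<in> \<A>" "A + B \<in> \<A>" "A o\<^sub>L B \<in> \<A>" if "A \<in> \<A>" "B \<in> \<A>" for A B c
    proof -
      have gA: "X \<in> \<A>" if "X \<in> generated_algebra G" for X
        using that closure_subset unfolding \<A>_def by blast
      have *: "f X Y \<in> \<A>" if "X \<in> \<A>" "Y \<in> \<A>" "continuous_on UNIV (\<lambda>p. f (fst p) (snd p))"
        "\<And>X Y. X \<in> generated_algebra G \<Longrightarrow> Y \<in> generated_algebra G \<Longrightarrow> f X Y \<in> generated_algebra G"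
        for f X Y
      proof -
        have "(\<lambda>p. f (fst p) (snd p)) ` closure (generated_algebra G \<times> generated_algebra G) \<subseteq> \<A>"
          by (rule image_closure_subset)
             (use that gA in \<open>auto simp: \<A>_def intro: continuous_on_subset\<close>)
        then show ?thesis using that(1,2) by (force simp: closure_Times \<A>_def)
      qed
      show "A + B \<in> \<A>"
        by (rule *[OF that]) (auto intro!: continuous_intros generated_algebra.add)
      show "A o\<^sub>L B \<in> \<A>"
        by (rule *[OF that]) (auto intro!: continuous_intros generated_algebra.mult)
      show "scalar_op c o\<^sub>L A \<in> \<A>"
        by (rule *[OF that, of "\<lambda>X Y. scalar_op c o\<^sub>L X"])
           (auto intro!: continuous_intros generated_algebra.mult generated_algebra.scalar)
    qed
    have hom: "unital_hom \<A> \<pi>"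
      unfolding unital_hom_def
    proof (intro conjI allI ballI)
      show "\<pi> id_blinfun = id_blinfun"
        using id by (auto intro!: blinfun_eqI simp: \<pi>_def C slice_incl_vec)
    next
      fix c A assume A: "A \<in> \<A>"
      show "\<pi> (scalar_op c o\<^sub>L A) = scalar_op c o\<^sub>L \<pi> A"
        using A g(1)[OF A A] by (auto intro!: blinfun_eqI simp: \<pi>_def C slice_simps)
    next
      fix A B assume A: "A \<in> \<A>" and B: "B \<in> \<A>"
      show "\<pi> (A + B) = \<pi> A + \<pi> B"
        using A B g(2)[OF A B] by (auto intro!: blinfun_eqI simp: \<pi>_def C slice_simps blinfun.add_left)
      have "C A (slice_vec T x) = slice_vec T (A x)" for x
        using A AI \<I> by auto
      then show "\<pi> (A o\<^sub>L B) = \<pi> A o\<^sub>L \<pi> B"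
        using A B g(3)[OF A B] by (auto intro!: blinfun_eqI simp: \<pi>_def C)
    qed
    have cc: "completely_contractive \<A> \<pi>"
      unfolding completely_contractive_def
    proof (intro allI impI mat_norm_leI)
      fix N A and x :: "nat \<Rightarrow> nat ell2"
      assume A: "\<forall>p<N. \<forall>q<N. A p q \<in> \<A>" and x: "L2_set (\<lambda>q. norm (x q)) {..<N} \<le> 1"
      have "L2_set (\<lambda>p. norm (\<Sum>q<N. \<pi> (A p q) (x q))) {..<N} \<le>
        L2_set (\<lambda>p. norm (\<Sum>q<N. A p q (incl_vec T (x q)))) {..<N}"
      proof (rule L2_set_mono)
        fix p assume p: "p \<in> {..<N}"
        have "(\<Sum>q<N. \<pi> (A p q) (x q)) = slice_vec T (\<Sum>q<N. A p q (incl_vec T (x q)))"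
          using A p by (simp add: slice_simps \<pi>_def C)
        then show "norm (\<Sum>q<N. \<pi> (A p q) (x q)) \<le> norm (\<Sum>q<N. A p q (incl_vec T (x q)))"
          by (simp add: norm_slice_vec_le)
      qed simp
      also have "\<dots> \<le> mat_norm N A"
        by (rule mat_norm_upper) (use x in \<open>simp add: norm_incl_vec\<close>)
      finally show "L2_set (\<lambda>p. norm (\<Sum>q<N. \<pi> (A p q) (x q))) {..<N} \<le> mat_norm N A" .
    qed
    have inclC: "incl_vec T (c *\<^sub>C x) = c *\<^sub>C incl_vec T x" for c and x :: "nat ell2"
      by (rule ell2_eqI) simp
    have bd: "\<pi> ` \<A> \<subseteq> bounded_ops"
      using Ab by (auto simp: \<pi>_def bounded_ops_def C slice_simps inclC subset_iff)
    have gens: "\<forall>i<m. \<forall>j<n i. \<pi> (s i j) = T i j"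
    proof (intro allI impI)
      fix i j assume ij: "i < m" "j < n i"
      have "s i j \<in> \<A>" by (rule sA[OF ij])
      then show "\<pi> (s i j) = T i j"
        using ij T by (auto intro!: blinfun_eqI simp: \<pi>_def C s_def slice_diag_op[OF R1] slice_incl_vec R_def)
    qed
    show ?thesis
    proof (rule ex1I[of _ \<pi>])
      show "\<pi> \<in> extensional \<A> \<and> \<pi> ` \<A> \<subseteq> bounded_ops \<and> unital_hom \<A> \<pi> \<and>
        completely_contractive \<A> \<pi> \<and> (\<forall>i<m. \<forall>j<n i. \<pi> (s i j) = T i j)"
        using hom cc bd gens by (simp add: \<pi>_def)
      fix \<psi>
      assume \<psi>: "\<psi> \<in> extensional \<A> \<and> \<psi> ` \<A> \<subseteq> bounded_ops \<and> unital_hom \<A> \<psi> \<and>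
        completely_contractive \<A> \<psi> \<and> (\<forall>i<m. \<forall>j<n i. \<psi> (s i j) = T i j)"
      show "\<psi> = \<pi>"
      proof (rule extensionalityI[of _ \<A>])
        show "\<psi> \<in> extensional \<A>" "\<pi> \<in> extensional \<A>"
          using \<psi> by (simp_all add: \<pi>_def)
        have h: "unital_hom \<A> \<psi>" "completely_contractive \<A> \<psi>"
          using \<psi> by simp_all
        have e: "\<psi> B = \<pi> B" if "B \<in> G" for B
          using that \<psi> gens by (auto simp: G_def)
        show "\<psi> A = \<pi> A" if "A \<in> \<A>" for A
          by (rule unital_hom_eq_closure[OF \<A>_def h(1) hom h(2) cc e that])
      qed
    qed
  qed
  show ?thesis
  proof (intro exI)
    show "is_free_product m n \<A> s"
      unfolding is_free_product_def
      by (intro conjI allI impI srow ex) (simp_all add: \<A>_def G_def)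
  qed
qed

end

theory Submission
  imports Defs "HOL-Complex_Analysis.Complex_Analysis"
begin

text \<open>
  Tensoring the generators with the unilateral shift gives every element \<open>A\<close> a sequence of homogeneous
  components, which determines \<open>A\<close> and whose squares sum to at most \<open>\<parallel>A\<parallel>\<^sup>2\<close>.  Hence a contraction \<open>A\<close> with
  \<open>\<rho>\<^sub>0(A) = 1\<close> is the identity; this maximum principle makes \<open>\<phi>\<^sup>*\<close> preserve the open polyball.
  If \<open>\<phi>\<^sup>*\<close> is the identity then \<open>\<phi>\<close> fixes the generators up to terms of higher degree, and iterating
  \<open>\<phi>\<close>, as in Cartan's uniqueness theorem, shows that these terms vanish; so \<open>\<phi> \<mapsto> \<phi>\<^sup>*\<close> is injective.
  For surjectivity, an automorphism of the polyball becomes, after composition with a Moebius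
  transformation of each ball, one that fixes \<open>0\<close>.  By the Schwarz lemma it is linear and isometric
  for the norm \<open>max\<^sub>i |z\<^sub>i|\<close>, so it permutes the blocks and acts on them by unitary matrices.
  Moebius transformations and unitary matrices map row contractions to row contractions, and by the
  universal property they lift to the free product.
\<close>

section \<open>Operators on \<open>\<ell>\<^sup>2\<close>\<close>

text \<open>The free product is accessible only through its universal property, so all maps out of
  it are produced from families of row contractions: scalars give the characters, shifted generators
  give the grading, and dilated, Moebius-transformed or linearly substituted generators give the
  endomorphisms. The universal property is stated on \<open>nat ell2\<close>, whereas the shifted
  generators act on countably many copies of the space of \<open>\<A>\<close>, whose index type is
  arbitrary; hence it is first extended to every \<open>'b ell2\<close>. The obstacle to having
  \<open>star\<close> on the open polyball is that contractivity alone only puts the new point into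
  the closed one; the maximum principle together with injectivity of \<open>\<phi>\<close> excludes
  the boundary. Since that principle is proved at the point 0 only, the Moebius automorphisms also
  serve to move an arbitrary point there, for this step as well as for differentiability. Complete
  isometry is obtained without estimates from below: two mutually inverse complete contractions are
  complete isometries.\<close>

instance ell2 :: (type) banach
proof
  fix X :: "nat \<Rightarrow> 'a ell2"
  assume C: "Cauchy X"
  \<comment> \<open>The limits against fixed vectors exist and form a bounded functional; its Riesz
    vector is the candidate for the norm limit.\<close>
  define f where "f y = lim (\<lambda>k. y \<bullet> X k)" for y
  have conv: "(\<lambda>k. y \<bullet> X k) \<longlonglongrightarrow> f y" for y
    using bounded_linear.Cauchy[OF bounded_linear_inner_right C]
    by (simp add: Cauchy_convergent_iff convergent_LIMSEQ_iff f_def)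
  obtain K where K: "\<And>k. norm (X k) \<le> K"
    using Cauchy_Bseq[OF C] by (auto simp: Bseq_def)
  have "bounded_linear f"
  proof (rule bounded_linear_intro[where K = K])
    show "f (x + y) = f x + f y" for x y
      using LIMSEQ_unique[OF conv[of "x + y"]] tendsto_add[OF conv[of x] conv[of y]]
      by (simp add: inner_add_left)
    show "f (r *\<^sub>R x) = r *\<^sub>R f x" for r x
      using LIMSEQ_unique[OF conv[of "r *\<^sub>R x"]] tendsto_mult_left[OF conv[of x], of r] by simp
    show "norm (f y) \<le> norm y * K" for y
    proof (rule tendsto_upperbound[OF tendsto_norm[OF conv]])
      show "\<forall>\<^sub>F k in sequentially. norm (y \<bullet> X k) \<le> norm y * K"
        using K Cauchy_Schwarz_ineq2[of y] mult_left_mono[OF K norm_ge_zero[of y]]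
        by (intro always_eventually allI) (metis order_trans real_norm_def)
    qed simp
  qed
  then obtain v where v: "\<And>y. f y = y \<bullet> v"
    using riesz_ell2 by blast
  have "X \<longlonglongrightarrow> v"
  proof (rule LIMSEQ_I)
    fix e :: real assume e: "e > 0"
    then obtain N where N: "\<And>i j. i \<ge> N \<Longrightarrow> j \<ge> N \<Longrightarrow> norm (X i - X j) < e / 2"
      using CauchyD[OF C, of "e / 2"] by auto
    have "norm (X i - v) < e" if "i \<ge> N" for i
    proof -
      \<comment> \<open>Testing with \<open>y\<close> itself turns the weak limit into the bound
        \<open>norm y \<le> e / 2\<close>.\<close>
      define y where "y = X i - v"
      have "(\<lambda>j. y \<bullet> (X i - X j)) \<longlonglongrightarrow> y \<bullet> X i - y \<bullet> v"
        unfolding inner_diff_right v[symmetric] by (intro tendsto_intros conv)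
      moreover have "\<forall>\<^sub>F j in sequentially. y \<bullet> (X i - X j) \<le> norm y * (e / 2)"
        using eventually_ge_at_top[of N]
      proof eventually_elim
        case (elim j)
        have "y \<bullet> (X i - X j) \<le> norm y * norm (X i - X j)" by (rule norm_cauchy_schwarz)
        also have "\<dots> \<le> norm y * (e / 2)" using N[OF that elim] by (intro mult_left_mono) auto
        finally show ?case .
      qed
      ultimately have "y \<bullet> X i - y \<bullet> v \<le> norm y * (e / 2)"
        by (rule tendsto_upperbound) simp
      then have "norm y * norm y \<le> norm y * (e / 2)"
        unfolding y_def by (simp add: inner_diff_right power2_norm_eq_inner[symmetric] power2_eq_square[symmetric])
          (simp add: y_def power2_norm_eq_inner inner_diff_right)
      then have "norm y \<le> e / 2" using e by (cases "norm y = 0") auto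
      then show ?thesis using e by (simp add: y_def)
    qed
    then show "\<exists>N. \<forall>i\<ge>N. norm (X i - v) < e" by blast
  qed
  then show "convergent X" by (auto simp: convergent_def)
qed

lemma inner_cscale_left: "(c *\<^sub>C x) \<bullet> y = x \<bullet> (cnj c *\<^sub>C y)"
  by (simp add: inner_ell2_def mult_ac)

lemma cscale_simps [simp]:
  "c *\<^sub>C d *\<^sub>C x = (c * d) *\<^sub>C x" "1 *\<^sub>C x = x" "0 *\<^sub>C x = 0" "c *\<^sub>C 0 = 0"
  "(- c) *\<^sub>C x = - (c *\<^sub>C x)" "c *\<^sub>C (- x) = - (c *\<^sub>C x)"
  by (rule ell2_eqI; simp)+

lemma cscale_add_left: "(c + d) *\<^sub>C x = c *\<^sub>C x + d *\<^sub>C x"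
  and cscale_diff_left: "(c - d) *\<^sub>C x = c *\<^sub>C x - d *\<^sub>C x"
  and cscale_of_real: "complex_of_real r *\<^sub>C x = r *\<^sub>R x"
  and cscale_scaleR: "c *\<^sub>C (r *\<^sub>R x) = r *\<^sub>R (c *\<^sub>C x)"
  by (rule ell2_eqI; simp add: algebra_simps)+

lemma cscale_sum: "c *\<^sub>C (\<Sum>i\<in>F. x i) = (\<Sum>i\<in>F. c *\<^sub>C x i)"
  by (rule ell2_eqI) (simp add: sum_distrib_left)

lemma sum_cscale_left: "(\<Sum>i\<in>F. c i) *\<^sub>C x = (\<Sum>i\<in>F. c i *\<^sub>C x)"
  by (rule ell2_eqI) (simp add: sum_distrib_right)

lemma norm_coord_le: "cmod (coord x a) \<le> norm x"
proof -
  have "(\<Sum>a'\<in>{a}. (cmod (coord x a'))\<^sup>2) \<le> (\<Sum>\<^sub>\<infinity>a'. (cmod (coord x a'))\<^sup>2)"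
    by (rule finite_sum_le_infsum) (auto simp: coord_summable)
  then show ?thesis by (simp flip: norm_ell2_sq)
qed

lemma bounded_linear_coord: "bounded_linear (\<lambda>x. coord x a)"
  by (rule bounded_linear_intro[where K = 1]) (auto simp: norm_coord_le scaleR_conv_of_real)

lemmas tendsto_coord = bounded_linear.tendsto[OF bounded_linear_coord]

lemma norm_basis_vec [simp]: "norm (basis_vec a) = 1"
proof -
  have "finite_vec {a} (\<lambda>_. 1) = basis_vec a" by (simp add: finite_vec_def)
  then have "(norm (basis_vec a))\<^sup>2 = 1" using norm_finite_vec[of "{a}" "\<lambda>_. 1"] by simp
  then show ?thesis by (simp add: power2_eq_1_iff) (metis norm_ge_zero neg_0_le_iff_le not_one_le_zero)
qed

lemma blinfun_cscale: "A \<in> bounded_ops \<Longrightarrow> blinfun_apply A (c *\<^sub>C x) = c *\<^sub>C A x"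
  by (simp add: bounded_ops_def)

lemma bounded_ops_intros [intro]:
  "scalar_op c \<in> bounded_ops" "0 \<in> bounded_ops" "id_blinfun \<in> bounded_ops"
  "A \<in> bounded_ops \<Longrightarrow> B \<in> bounded_ops \<Longrightarrow> A + B \<in> bounded_ops"
  "A \<in> bounded_ops \<Longrightarrow> B \<in> bounded_ops \<Longrightarrow> A o\<^sub>L B \<in> bounded_ops"
  by (auto simp: bounded_ops_def blinfun.add_left cscale_add mult.commute)

lemma adjoint_eqI:
  fixes A :: "'a op"
  assumes "\<And>x. A x \<bullet> y = x \<bullet> v"
  shows "adjoint A y = v"
proof -
  have "x \<bullet> (adjoint A y - v) = 0" for x
    using assms[of x] by (simp add: inner_diff_right adjoint_op)
  then show ?thesis by (metis inner_eq_zero_iff right_minus_eq)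
qed

lemma adjoint_simps:
  fixes A B :: "'a op"
  shows "adjoint (A + B) y = adjoint A y + adjoint B y"
    "adjoint (A o\<^sub>L B) y = adjoint B (adjoint A y)"
    "adjoint (scalar_op c :: 'a op) y = cnj c *\<^sub>C y"
    "adjoint (id_blinfun :: 'a op) y = y"
    "adjoint (0 :: 'a op) y = 0"
    "adjoint A (y + z) = adjoint A y + adjoint A z"
    "A \<in> bounded_ops \<Longrightarrow> adjoint A (c *\<^sub>C y) = c *\<^sub>C adjoint A y"
proof -
  show "adjoint A (c *\<^sub>C y) = c *\<^sub>C adjoint A y" if "A \<in> bounded_ops"
  proof (rule adjoint_eqI)
    fix x
    have "A x \<bullet> (c *\<^sub>C y) = (cnj c *\<^sub>C A x) \<bullet> y" by (simp add: inner_cscale_left)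
    also have "\<dots> = A (cnj c *\<^sub>C x) \<bullet> y" by (simp add: blinfun_cscale that)
    also have "\<dots> = x \<bullet> (c *\<^sub>C adjoint A y)" by (simp add: adjoint_op inner_cscale_left)
    finally show "A x \<bullet> (c *\<^sub>C y) = x \<bullet> (c *\<^sub>C adjoint A y)" .
  qed
qed (rule adjoint_eqI; simp add: adjoint_op inner_add_left inner_add_right blinfun.add_left
       inner_cscale_left)+

lemma adjoint_sum:
  fixes A :: "'i \<Rightarrow> 'a op"
  shows "adjoint (blinfun_apply (\<Sum>i\<in>F. A i)) y = (\<Sum>i\<in>F. adjoint (A i) y)"
  by (rule adjoint_eqI) (simp add: blinfun.sum_left inner_sum_left inner_sum_right adjoint_op)

lemma row_contraction_adjoint:
  "row_contraction k T \<longleftrightarrow> (\<forall>j<k. T j \<in> bounded_ops) \<and>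
    (\<forall>x. (\<Sum>j<k. (norm (adjoint (T j) x))\<^sup>2) \<le> (norm x)\<^sup>2)"
  by (simp add: row_contraction_def inner_sum_left adjoint_op power2_norm_eq_inner)

section \<open>Row contractions on arbitrary Hilbert spaces\<close>

text \<open>Without injectivity the pulled-back family may fail to be square summable, so that case
  is set to 0. This one construction yields the passage between a countable coordinate set and
  \<open>nat\<close>, and both shifts.\<close>

lift_definition reindex_vec :: "'d set \<Rightarrow> ('d \<Rightarrow> 'e) \<Rightarrow> 'e ell2 \<Rightarrow> 'd ell2"
  is "\<lambda>D g f a. if inj_on g D \<and> a \<in> D then f (g a) else 0"
proof -
  fix D :: "'d set" and g :: "'d \<Rightarrow> 'e" and f :: "'e \<Rightarrow> complex"
  assume f: "(\<lambda>a. (cmod (f a))\<^sup>2) summable_on UNIV"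
  show "(\<lambda>a. (cmod (if inj_on g D \<and> a \<in> D then f (g a) else 0))\<^sup>2) summable_on UNIV"
  proof (cases "inj_on g D")
    case True
    have "(\<lambda>a. (cmod (f a))\<^sup>2) summable_on g ` D"
      using f by (rule summable_on_subset_banach) auto
    then have "(\<lambda>a. (cmod (f (g a)))\<^sup>2) summable_on D"
      using True by (subst (asm) summable_on_reindex) (auto simp: o_def)
    then show ?thesis
      by (rule summable_on_cong_neutral[THEN iffD1, rotated -1]) (auto simp: True)
  qed simp
qed

lemma coord_reindex_vec [simp]:
  "coord (reindex_vec D g y) a = (if inj_on g D \<and> a \<in> D then coord y (g a) else 0)"
  by transfer simp

lemma norm_reindex_vec_le: "norm (reindex_vec D g y) \<le> norm y"
proof (cases "inj_on g D")
  case True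
  have "(norm (reindex_vec D g y))\<^sup>2 = (\<Sum>\<^sub>\<infinity>a\<in>D. (cmod (coord y (g a)))\<^sup>2)"
    unfolding norm_ell2_sq by (rule infsum_cong_neutral) (auto simp: True)
  also have "\<dots> = (\<Sum>\<^sub>\<infinity>b\<in>g ` D. (cmod (coord y b))\<^sup>2)"
    using True by (subst infsum_reindex) (auto simp: o_def)
  also have "\<dots> \<le> (\<Sum>\<^sub>\<infinity>b. (cmod (coord y b))\<^sup>2)"
    by (rule infsum_mono_neutral) (auto intro: coord_summable summable_on_subset_banach)
  finally show ?thesis by (simp flip: norm_ell2_sq)
next
  case False
  then have "reindex_vec D g y = 0" by (auto intro: ell2_eqI)
  then show ?thesis by simp
qed

lift_definition reindex_op :: "'d set \<Rightarrow> ('d \<Rightarrow> 'e) \<Rightarrow> 'e ell2 \<Rightarrow>\<^sub>L 'd ell2" is reindex_vec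
  by (rule bounded_linear_intro[where K = 1]) (auto intro: ell2_eqI simp: norm_reindex_vec_le)

definition supp :: "'a ell2 \<Rightarrow> 'a set"
  where "supp x = {a. coord x a \<noteq> 0}"

lemma countable_supp: "countable (supp x)"
proof -
  have "countable {a \<in> UNIV. (cmod (coord x a))\<^sup>2 \<noteq> 0}"
    using summable_countable_real coord_summable by blast
  then show ?thesis by (simp add: supp_def)
qed

text \<open>It is enough to know the images of the basis vectors: by linearity they control finite
  truncations of \<open>x\<close>, and these are dense.\<close>

lemma supp_apply_subset:
  fixes A :: "'a op"
  assumes A: "A \<in> bounded_ops" and inv: "\<And>a. a \<in> S \<Longrightarrow> supp (A (basis_vec a)) \<subseteq> S"
    and x: "supp x \<subseteq> S"
  shows "supp (A x) \<subseteq> S"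
proof -
  have "coord (A x) b = 0" if b: "b \<notin> S" for b
  proof -
    have "cmod (coord (A x) b) \<le> e" if e: "e > 0" for e
    proof -
      \<comment> \<open>The summand 1 avoids a division by zero when \<open>A\<close> is 0.\<close>
      have "e / (norm A + 1) > 0" using e by (simp add: add_nonneg_pos)
      then obtain F where F: "norm (x - finite_vec F (coord x)) \<le> e / (norm A + 1)"
        using finite_vec_approx by blast
      have "coord x a * coord (A (basis_vec a)) b = 0" for a
        using inv[of a] b x by (auto simp: supp_def)
      then have "coord (A (finite_vec F (coord x))) b = 0"
        by (simp only: finite_vec_def blinfun.sum_right blinfun_cscale[OF A] coord_sum coord_cscale)
           simp
      then have "cmod (coord (A x) b) = cmod (coord (A (x - finite_vec F (coord x))) b)"
        by (simp add: blinfun.diff_right)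
      also have "\<dots> \<le> norm A * norm (x - finite_vec F (coord x))"
        by (meson norm_coord_le norm_blinfun order_trans)
      also have "\<dots> \<le> (norm A + 1) * (e / (norm A + 1))"
        by (intro mult_mono F) auto
      also have "\<dots> = e"
        by (metis add_le_same_cancel1 add.commute nonzero_mult_div_cancel_left norm_ge_zero not_one_le_zero add_eq_0_iff_both_eq_0 zero_le_one zero_neq_one times_divide_eq_right)
      finally show ?thesis .
    qed
    then have "cmod (coord (A x) b) \<le> 0" by (metis field_le_epsilon add_0)
    then show ?thesis by simp
  qed
  then show ?thesis by (auto simp: supp_def)
qed

text \<open>Countably many operators applied to countably many basis vectors have countably many
  coordinates in their images; iterating this enlargement countably often gives an invariant
  set.\<close>

lemma countable_invariant_set:
  fixes \<T> :: "'a op set"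
  assumes "countable X" "countable \<T>" "\<T> \<subseteq> bounded_ops"
  shows "\<exists>S. countable S \<and> X \<subseteq> S \<and> (\<forall>A\<in>\<T>. \<forall>x. supp x \<subseteq> S \<longrightarrow> supp (A x) \<subseteq> S)"
proof -
  define nxt where "nxt Y = Y \<union> (\<Union>a\<in>Y. \<Union>A\<in>\<T>. supp (blinfun_apply A (basis_vec a)))" for Y
  define S where "S = (\<Union>k. (nxt ^^ k) X)"
  have "countable ((nxt ^^ k) X)" for k
    by (induction k) (auto simp: assms nxt_def countable_supp)
  then have "countable S" by (auto simp: S_def)
  moreover have "X \<subseteq> S" unfolding S_def by (rule order_trans[OF _ UN_upper[of 0]]) auto
  moreover have "supp (A (basis_vec a)) \<subseteq> S" if Aa: "A \<in> \<T>" "a \<in> S" for A a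
  proof -
    obtain k where "a \<in> (nxt ^^ k) X" using Aa by (auto simp: S_def)
    then have "supp (A (basis_vec a)) \<subseteq> (nxt ^^ Suc k) X" using Aa by (auto simp: nxt_def)
    then show ?thesis unfolding S_def by blast
  qed
  ultimately show ?thesis
    using assms(3) by (intro exI[of _ S] conjI ballI allI impI) (assumption | rule supp_apply_subset | auto)+
qed

section \<open>Completely contractive homomorphisms out of the free product\<close>

lemma contraction_tendsto:
  assumes "\<And>k :: nat. norm (f (X k) - f A) \<le> norm (X k - A)" "X \<longlonglongrightarrow> A"
  shows "(\<lambda>k. f (X k)) \<longlonglongrightarrow> f A"
  by (rule LIM_zero_cancel, rule tendsto_0_le[OF LIM_zero[OF assms(2)], where K = 1]) (simp add: assms(1))

text \<open>The maps supplied by the universal property, without the normalisation outside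
  \<open>\<A>\<close>, so that they can be composed freely.\<close>

definition cc_hom :: "'a op set \<Rightarrow> ('a op \<Rightarrow> 'b op) \<Rightarrow> bool"
  where "cc_hom \<A> \<pi> \<longleftrightarrow> unital_hom \<A> \<pi> \<and> completely_contractive \<A> \<pi> \<and> \<pi> ` \<A> \<subseteq> bounded_ops"

locale free_prod =
  fixes m :: nat and n :: "nat \<Rightarrow> nat" and \<A> :: "'a op set" and s :: "nat \<Rightarrow> nat \<Rightarrow> 'a op"
  assumes free_product: "is_free_product m n \<A> s"
begin

abbreviation "gens \<equiv> {s i j | i j. i < m \<and> j < n i}"

lemma A_eq: "\<A> = closure (generated_algebra gens)"
  and row_s: "i < m \<Longrightarrow> row_contraction (n i) (s i)"
  using free_product by (auto simp: is_free_product_def)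

lemma gen_in_A: "A \<in> generated_algebra gens \<Longrightarrow> A \<in> \<A>"
  using closure_subset unfolding A_eq by blast

lemma s_in [simp, intro]: "i < m \<Longrightarrow> j < n i \<Longrightarrow> s i j \<in> \<A>"
  by (rule gen_in_A, rule generated_algebra.gen) auto

lemma scalar_in [simp, intro]: "scalar_op c \<in> \<A>"
  by (rule gen_in_A, rule generated_algebra.scalar)

lemma id_in [simp, intro]: "id_blinfun \<in> \<A>"
  using scalar_in[of 1] by (simp add: scalar_op_1)

lemma zero_in [simp, intro]: "0 \<in> \<A>"
proof -
  have "scalar_op 0 = (0 :: 'a op)" by (rule blinfun_eqI) simp
  then show ?thesis using scalar_in[of 0] by simp
qed

lemma A_limit:
  assumes "\<And>k. X k \<in> \<A>" "X \<longlonglongrightarrow> A"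
  shows "A \<in> \<A>"
  using closed_sequentially[of \<A> X A] assms by (simp add: A_eq)

text \<open>Most statements about all of \<open>\<A>\<close> are identities between contractive
  expressions, which survive norm limits; this rule reduces them to generators, scalars, sums and
  products.\<close>

lemma dense_induct [consumes 1, case_names gen scalar add mult lim]:
  assumes A: "A \<in> \<A>"
    and gen: "\<And>i j. i < m \<Longrightarrow> j < n i \<Longrightarrow> P (s i j)"
    and scalar: "\<And>c. P (scalar_op c)"
    and add: "\<And>A B. A \<in> \<A> \<Longrightarrow> B \<in> \<A> \<Longrightarrow> P A \<Longrightarrow> P B \<Longrightarrow> P (A + B)"
    and mult: "\<And>A B. A \<in> \<A> \<Longrightarrow> B \<in> \<A> \<Longrightarrow> P A \<Longrightarrow> P B \<Longrightarrow> P (A o\<^sub>L B)"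
    and lim: "\<And>X A. (\<And>k. X k \<in> \<A>) \<Longrightarrow> (\<And>k. P (X k)) \<Longrightarrow> X \<longlonglongrightarrow> A \<Longrightarrow> A \<in> \<A> \<Longrightarrow> P A"
  shows "P A"
proof -
  have P: "P B" if "B \<in> generated_algebra gens" for B
    using that
  proof induction
    case (add A B)
    then show ?case using assms(4) gen_in_A by blast
  next
    case (mult A B)
    then show ?case using assms(5) gen_in_A by blast
  qed (use gen scalar in auto)
  obtain X where "\<And>k. X k \<in> generated_algebra gens" "X \<longlonglongrightarrow> A"
    using A unfolding A_eq closure_sequential by blast
  then show ?thesis using lim[of X A] P gen_in_A A by blast
qed

lemma A_bounded_ops: "A \<in> \<A> \<Longrightarrow> A \<in> bounded_ops"
proof (induction rule: dense_induct)
  case (gen i j)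
  then show ?case using row_s by (auto simp: row_contraction_def)
next
  case (lim X A)
  then show ?case using closed_bounded_ops closed_sequentially by blast
qed auto

lemma add_in [simp, intro]: "A \<in> \<A> \<Longrightarrow> B \<in> \<A> \<Longrightarrow> A + B \<in> \<A>"
  and mult_in [simp, intro]: "A \<in> \<A> \<Longrightarrow> B \<in> \<A> \<Longrightarrow> A o\<^sub>L B \<in> \<A>"
proof -
  assume A: "A \<in> \<A>" and B: "B \<in> \<A>"
  obtain X where X: "\<And>k. X k \<in> generated_algebra gens" "X \<longlonglongrightarrow> A"
    using A unfolding A_eq closure_sequential by blast
  obtain Y where Y: "\<And>k. Y k \<in> generated_algebra gens" "Y \<longlonglongrightarrow> B"
    using B unfolding A_eq closure_sequential by blast
  show "A + B \<in> \<A>"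
    by (rule A_limit[where X = "\<lambda>k. X k + Y k"])
       (auto intro!: gen_in_A generated_algebra.add X Y tendsto_add)
  show "A o\<^sub>L B \<in> \<A>"
    by (rule A_limit[where X = "\<lambda>k. X k o\<^sub>L Y k"])
       (auto intro!: gen_in_A generated_algebra.mult X Y
         bounded_bilinear.tendsto[OF bounded_bilinear_blinfun_compose])
qed

lemma minus_in [simp, intro]: "A \<in> \<A> \<Longrightarrow> - A \<in> \<A>"
  using mult_in[of "scalar_op (- 1)" A] by (simp add: scalar_op_neg)

lemma diff_in [simp, intro]: "A \<in> \<A> \<Longrightarrow> B \<in> \<A> \<Longrightarrow> A - B \<in> \<A>"
  using add_in[of A "- B"] by simp

lemma sum_in [intro]: "(\<And>i. i \<in> F \<Longrightarrow> f i \<in> \<A>) \<Longrightarrow> sum f F \<in> \<A>"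
  by (induction F rule: infinite_finite_induct) auto

lemma cc_hom_simps:
  assumes "cc_hom \<A> \<pi>"
  shows "\<pi> id_blinfun = id_blinfun" "\<pi> (scalar_op c) = scalar_op c"
    "A \<in> \<A> \<Longrightarrow> B \<in> \<A> \<Longrightarrow> \<pi> (A + B) = \<pi> A + \<pi> B"
    "A \<in> \<A> \<Longrightarrow> B \<in> \<A> \<Longrightarrow> \<pi> (A o\<^sub>L B) = \<pi> A o\<^sub>L \<pi> B"
    "A \<in> \<A> \<Longrightarrow> \<pi> (- A) = - \<pi> A"
    "A \<in> \<A> \<Longrightarrow> B \<in> \<A> \<Longrightarrow> \<pi> (A - B) = \<pi> A - \<pi> B"
    "A \<in> \<A> \<Longrightarrow> norm (\<pi> A) \<le> norm A" "A \<in> \<A> \<Longrightarrow> \<pi> A \<in> bounded_ops"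
    "\<pi> 0 = 0"
proof -
  have u: "unital_hom \<A> \<pi>" and c: "completely_contractive \<A> \<pi>"
    using assms by (auto simp: cc_hom_def)
  show 1: "\<pi> id_blinfun = id_blinfun" using u by (simp add: unital_hom_def)
  have "\<pi> (scalar_op c o\<^sub>L id_blinfun) = scalar_op c o\<^sub>L \<pi> id_blinfun" for c
    using u id_in by (simp only: unital_hom_def)
  then show 2: "\<pi> (scalar_op c) = scalar_op c" for c by (simp only: 1 op_compose_id)
  show 3: "A \<in> \<A> \<Longrightarrow> B \<in> \<A> \<Longrightarrow> \<pi> (A + B) = \<pi> A + \<pi> B" for A B
    using u by (simp add: unital_hom_def)
  show 4: "A \<in> \<A> \<Longrightarrow> B \<in> \<A> \<Longrightarrow> \<pi> (A o\<^sub>L B) = \<pi> A o\<^sub>L \<pi> B" for A B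
    using u by (simp add: unital_hom_def)
  show 5: "A \<in> \<A> \<Longrightarrow> \<pi> (- A) = - \<pi> A" for A
    using 4[of "scalar_op (- 1)" A] by (simp add: 2 scalar_op_neg)
  show 6: "A \<in> \<A> \<Longrightarrow> B \<in> \<A> \<Longrightarrow> \<pi> (A - B) = \<pi> A - \<pi> B"
    using 3[of A "- B"] by (simp add: 5)
  show "A \<in> \<A> \<Longrightarrow> norm (\<pi> A) \<le> norm A"
    using c completely_contractive_norm_le by blast
  show "A \<in> \<A> \<Longrightarrow> \<pi> A \<in> bounded_ops" using assms by (auto simp: cc_hom_def)
  show "\<pi> 0 = 0" using 3[of 0 0] by simp
qed

lemma cc_hom_sum:
  assumes "cc_hom \<A> \<pi>" "\<And>i. i \<in> F \<Longrightarrow> f i \<in> \<A>"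
  shows "\<pi> (sum f F) = (\<Sum>i\<in>F. \<pi> (f i))"
  using assms(2)
proof (induction F rule: infinite_finite_induct)
  case (insert x F)
  then show ?case by (simp add: cc_hom_simps[OF assms(1)] sum_in)
qed (simp_all add: cc_hom_simps[OF assms(1)])

lemma cc_hom_tendsto:
  assumes \<pi>: "cc_hom \<A> \<pi>" and X: "\<And>k. X k \<in> \<A>" "X \<longlonglongrightarrow> A" "A \<in> \<A>"
  shows "(\<lambda>k. \<pi> (X k)) \<longlonglongrightarrow> \<pi> A"
proof (rule contraction_tendsto[OF _ X(2)])
  show "norm (\<pi> (X k) - \<pi> A) \<le> norm (X k - A)" for k
    using cc_hom_simps(7)[OF \<pi>, of "X k - A"] X
    by (simp add: cc_hom_simps(6)[OF \<pi>])
qed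

lemma cc_hom_tendsto_apply:
  assumes "cc_hom \<A> \<pi>" "\<And>k. X k \<in> \<A>" "X \<longlonglongrightarrow> A" "A \<in> \<A>"
  shows "(\<lambda>k. \<pi> (X k) x) \<longlonglongrightarrow> \<pi> A x"
  by (rule bounded_linear.tendsto[OF blinfun.bounded_linear_left cc_hom_tendsto[OF assms]])

lemma cc_hom_eqI:
  assumes "cc_hom \<A> \<phi>" "cc_hom \<A> \<psi>" "\<And>i j. i < m \<Longrightarrow> j < n i \<Longrightarrow> \<phi> (s i j) = \<psi> (s i j)" "A \<in> \<A>"
  shows "\<phi> A = \<psi> A"
  by (rule unital_hom_eq_closure[OF A_eq])
     (use assms in \<open>auto simp: cc_hom_def\<close>)

lemma cc_hom_compose:
  assumes "cc_hom \<A> \<phi>" "\<phi> ` \<A> \<subseteq> \<A>" "cc_hom \<A> \<pi>"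
  shows "cc_hom \<A> (\<lambda>A. \<pi> (\<phi> A))"
  unfolding cc_hom_def
proof (intro conjI)
  have \<phi>: "\<phi> A \<in> \<A>" if "A \<in> \<A>" for A using that assms(2) by auto
  show "(\<lambda>A. \<pi> (\<phi> A)) ` \<A> \<subseteq> bounded_ops"
    using \<phi> cc_hom_simps(8)[OF assms(3)] by auto
  show "completely_contractive \<A> (\<lambda>A. \<pi> (\<phi> A))"
    unfolding completely_contractive_def
  proof (intro allI impI)
    fix N and A :: "nat \<Rightarrow> nat \<Rightarrow> 'a op"
    assume A: "\<forall>p<N. \<forall>q<N. A p q \<in> \<A>"
    have "mat_norm N (\<lambda>p q. \<pi> (\<phi> (A p q))) \<le> mat_norm N (\<lambda>p q. \<phi> (A p q))"
      using assms(3) A \<phi> by (simp add: cc_hom_def completely_contractive_def)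
    also have "\<dots> \<le> mat_norm N A"
      using assms(1) A by (simp add: cc_hom_def completely_contractive_def)
    finally show "mat_norm N (\<lambda>p q. \<pi> (\<phi> (A p q))) \<le> mat_norm N A" .
  qed
  show "unital_hom \<A> (\<lambda>A. \<pi> (\<phi> A))"
    unfolding unital_hom_def
    by (intro conjI allI ballI)
       (simp_all add: cc_hom_simps[OF assms(1)] cc_hom_simps[OF assms(3)] \<phi>)
qed

lemma universal_nat:
  assumes "\<forall>i<m. row_contraction (n i) (T i)"
  shows "\<exists>\<pi>. cc_hom \<A> \<pi> \<and> (\<forall>i<m. \<forall>j<n i. \<pi> (s i j) = (T i j :: nat op))"
proof -
  have "\<exists>!\<pi>. \<pi> \<in> extensional \<A> \<and> \<pi> ` \<A> \<subseteq> bounded_ops \<and> unital_hom \<A> \<pi> \<and>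
        completely_contractive \<A> \<pi> \<and> (\<forall>i<m. \<forall>j<n i. \<pi> (s i j) = T i j)"
    by (rule free_product[unfolded is_free_product_def, THEN conjunct2, THEN conjunct2, rule_format])
       (use assms in blast)
  from ex1_implies_ex[OF this] show ?thesis
    unfolding cc_hom_def by (elim exE conjE) (intro exI conjI, assumption+)
qed

text \<open>
  The compression of \<open>T\<close> to the coordinates in a countable invariant set \<open>S\<close> is a family of row
  contractions on a separable space, to which the universal property applies.
\<close>

lemma universal_countable:
  fixes T :: "nat \<Rightarrow> nat \<Rightarrow> 'b op"
  assumes T: "\<forall>i<m. row_contraction (n i) (T i)" and S: "countable S"
    and inv: "\<And>i j x. i < m \<Longrightarrow> j < n i \<Longrightarrow> supp x \<subseteq> S \<Longrightarrow> supp (T i j x) \<subseteq> S"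
  shows "\<exists>\<pi> (V :: 'b ell2 \<Rightarrow>\<^sub>L nat ell2) (W :: nat ell2 \<Rightarrow>\<^sub>L 'b ell2). cc_hom \<A> \<pi> \<and> (\<forall>x. norm (V x) \<le> norm x) \<and>
    (\<forall>x. norm (W x) \<le> norm x) \<and> (\<forall>c x. V (c *\<^sub>C x) = c *\<^sub>C V x) \<and> (\<forall>c x. W (c *\<^sub>C x) = c *\<^sub>C W x) \<and>
    (\<forall>x. supp (W x) \<subseteq> S) \<and> (\<forall>x. supp x \<subseteq> S \<longrightarrow> W (V x) = x) \<and>
    (\<forall>A\<in>\<A>. \<forall>x. V (W (\<pi> A (V x))) = \<pi> A (V x)) \<and>
    (\<forall>i<m. \<forall>j<n i. \<forall>x. supp x \<subseteq> S \<longrightarrow> W (\<pi> (s i j) (V x)) = T i j x)"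
proof -
  have inj: "inj_on (to_nat_on S) S" by (rule inj_on_to_nat_on[OF S])
  define V :: "'b ell2 \<Rightarrow>\<^sub>L nat ell2" where "V = reindex_op (to_nat_on S ` S) (inv_into S (to_nat_on S))"
  define W :: "nat ell2 \<Rightarrow>\<^sub>L 'b ell2" where "W = reindex_op S (to_nat_on S)"
  have V: "norm (V x) \<le> norm x" "V (c *\<^sub>C x) = c *\<^sub>C V x" for c x
    by (auto simp: V_def reindex_op.rep_eq norm_reindex_vec_le intro!: ell2_eqI)
  have W: "norm (W x) \<le> norm x" "W (c *\<^sub>C x) = c *\<^sub>C W x" "supp (W x) \<subseteq> S" for c x
    by (auto simp: W_def reindex_op.rep_eq norm_reindex_vec_le supp_def intro!: ell2_eqI)
  have WV: "W (V x) = x" if "supp x \<subseteq> S" for x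
    using that inj inj_on_inv_into[of "to_nat_on S ` S" "to_nat_on S" S]
    by (auto simp: W_def V_def reindex_op.rep_eq supp_def inv_into_f_f intro!: ell2_eqI)
  have VWV: "V (W (V x)) = V x" for x
    using inj inj_on_inv_into[of "to_nat_on S ` S" "to_nat_on S" S]
    by (auto simp: W_def V_def reindex_op.rep_eq inv_into_into f_inv_into_f intro!: ell2_eqI)
  define T' where "T' i j = V o\<^sub>L T i j o\<^sub>L W" for i j
  have "row_contraction (n i) (T' i)" if "i < m" for i
    unfolding row_contraction_iff
  proof (intro conjI allI impI)
    have Ti: "row_contraction (n i) (T i)" using T that by auto
    show "T' i j \<in> bounded_ops" if "j < n i" for j
      using that Ti V W by (simp add: bounded_ops_def T'_def row_contraction_def)
    fix x :: "nat \<Rightarrow> nat ell2"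
    have "(norm (\<Sum>j<n i. T' i j (x j)))\<^sup>2 = (norm (V (\<Sum>j<n i. T i j (W (x j)))))\<^sup>2"
      by (simp add: T'_def blinfun.sum_right)
    also have "\<dots> \<le> (norm (\<Sum>j<n i. T i j (W (x j))))\<^sup>2"
      by (intro power_mono V) auto
    also have "\<dots> \<le> (\<Sum>j<n i. (norm (W (x j)))\<^sup>2)"
      by (rule Ti[unfolded row_contraction_iff, THEN conjunct2, rule_format])
    also have "\<dots> \<le> (\<Sum>j<n i. (norm (x j))\<^sup>2)"
      by (intro sum_mono power_mono W) auto
    finally show "(norm (\<Sum>j<n i. T' i j (x j)))\<^sup>2 \<le> (\<Sum>j<n i. (norm (x j))\<^sup>2)" .
  qed
  then obtain \<pi> where \<pi>: "cc_hom \<A> \<pi>" "\<And>i j. i < m \<Longrightarrow> j < n i \<Longrightarrow> \<pi> (s i j) = T' i j"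
    using universal_nat[of T'] by blast
  \<comment> \<open>\<open>V o\<^sub>L W\<close> is the identity on the range of \<open>V\<close>.
    That range is thus invariant under every \<open>\<pi> A\<close>, which makes the compression
    \<open>W (\<pi> A (V x))\<close> multiplicative in \<open>A\<close>.\<close>
  have VW: "V (W (\<pi> A (V x))) = \<pi> A (V x)" if "A \<in> \<A>" for A x
    using that
  proof (induction arbitrary: x rule: dense_induct)
    case (gen i j)
    then show ?case by (simp add: \<pi> T'_def VWV)
  next
    case (scalar c)
    then show ?case
      by (simp add: cc_hom_simps[OF \<pi>(1)] V(2) W(2) VWV)
  next
    case (add A B)
    then show ?case by (simp add: cc_hom_simps[OF \<pi>(1)] blinfun.add_left blinfun.add_right)
  next
    case (mult A B)
    show ?case
      using mult.IH(1)[of "W (\<pi> B (V x))"] mult by (simp add: cc_hom_simps[OF \<pi>(1)])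
  next
    case (lim X A)
    have l: "(\<lambda>k. \<pi> (X k) (V x)) \<longlonglongrightarrow> \<pi> A (V x)"
      by (rule cc_hom_tendsto_apply[OF \<pi>(1) lim(1-3)])
    then have "(\<lambda>k. V (W (\<pi> (X k) (V x)))) \<longlonglongrightarrow> V (W (\<pi> A (V x)))"
      by (intro bounded_linear.tendsto[OF blinfun.bounded_linear_right])
    then have "(\<lambda>k. \<pi> (X k) (V x)) \<longlonglongrightarrow> V (W (\<pi> A (V x)))"
      by (simp only: lim(4))
    then show ?case by (rule LIMSEQ_unique[OF _ l])
  qed
  have gens: "W (\<pi> (s i j) (V x)) = T i j x" if "i < m" "j < n i" "supp x \<subseteq> S" for i j x
    by (simp add: \<pi> that T'_def WV inv)
  show ?thesis
  proof (rule exI[of _ \<pi>], rule exI[of _ V], rule exI[of _ W], intro conjI allI ballI impI)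
    show "supp x \<subseteq> S \<Longrightarrow> W (V x) = x" for x by (rule WV)
    show "A \<in> \<A> \<Longrightarrow> V (W (\<pi> A (V x))) = \<pi> A (V x)" for A x by (rule VW)
    show "i < m \<Longrightarrow> j < n i \<Longrightarrow> supp x \<subseteq> S \<Longrightarrow> W (\<pi> (s i j) (V x)) = T i j x" for i j x
      by (rule gens)
  qed (rule \<pi>(1) V W)+
qed

text \<open>A countable invariant set \<open>S\<close> containing the support of \<open>x\<close>
  determines a value for \<open>\<pi> A x\<close>. The values do not depend on \<open>S\<close>, so
  the separable pieces glue. Each property to be checked involves only countably many vectors at a
  time, for which one common \<open>S\<close> serves.\<close>

theorem universal:
  fixes T :: "nat \<Rightarrow> nat \<Rightarrow> 'b op"
  assumes T: "\<forall>i<m. row_contraction (n i) (T i)"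
  shows "\<exists>\<pi>. cc_hom \<A> \<pi> \<and> (\<forall>i<m. \<forall>j<n i. \<pi> (s i j) = T i j)"
proof -
  let ?\<T> = "{T i j | i j. i < m \<and> j < n i}"
  have "?\<T> = (\<lambda>(i, j). T i j) ` (SIGMA i:{..<m}. {..<n i})" by auto
  then have c\<T>: "countable ?\<T>" by simp
  have b\<T>: "?\<T> \<subseteq> bounded_ops" using T by (auto simp: row_contraction_def)
  define invariant where "invariant S \<longleftrightarrow> countable S \<and>
    (\<forall>i j x. i < m \<longrightarrow> j < n i \<longrightarrow> supp x \<subseteq> S \<longrightarrow> supp (T i j x) \<subseteq> S)" for S
  have ex_inv: "\<exists>S. invariant S \<and> X \<subseteq> S" if X: "countable X" for X
  proof -
    obtain S where "countable S" "X \<subseteq> S" "\<forall>A\<in>?\<T>. \<forall>x. supp x \<subseteq> S \<longrightarrow> supp (A x) \<subseteq> S"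
      using countable_invariant_set[OF X c\<T> b\<T>] by blast
    then have "supp (T i j x) \<subseteq> S" if "i < m" "j < n i" "supp x \<subseteq> S" for i j x
      using that by auto
    then show ?thesis
      unfolding invariant_def using \<open>countable S\<close> \<open>X \<subseteq> S\<close> by (intro exI[of _ S]) simp
  qed
  define Q where "Q S \<pi> V W \<longleftrightarrow> cc_hom \<A> \<pi> \<and> (\<forall>x. norm (blinfun_apply V x) \<le> norm x) \<and>
    (\<forall>x. norm (blinfun_apply W x) \<le> norm x) \<and> (\<forall>c x. V (c *\<^sub>C x) = c *\<^sub>C V x) \<and> (\<forall>c x. W (c *\<^sub>C x) = c *\<^sub>C W x) \<and>
    (\<forall>x. supp (W x) \<subseteq> S) \<and> (\<forall>x. supp x \<subseteq> S \<longrightarrow> W (V x) = x) \<and>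
    (\<forall>A\<in>\<A>. \<forall>x. V (W (\<pi> A (V x))) = \<pi> A (V x)) \<and>
    (\<forall>i<m. \<forall>j<n i. \<forall>x. supp x \<subseteq> S \<longrightarrow> W (\<pi> (s i j) (V x)) = T i j x)"
    for S \<pi> and V :: "'b ell2 \<Rightarrow>\<^sub>L nat ell2" and W
  have "\<exists>\<pi> V W. Q S \<pi> V W" if "invariant S" for S
    unfolding Q_def by (rule universal_countable[OF T]) (use that in \<open>auto simp: invariant_def\<close>)
  then obtain p V W where "\<And>S. invariant S \<Longrightarrow> Q S (p S) (V S) (W S)"
    by metis
  note q = this[unfolded Q_def]
  note q1 = q[THEN conjunct1] and q2 = q[THEN conjunct2]
  note q3 = q2[THEN conjunct2] note q4 = q3[THEN conjunct2] note q5 = q4[THEN conjunct2]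
  note q6 = q5[THEN conjunct2] note q7 = q6[THEN conjunct2] note q8 = q7[THEN conjunct2]
  note p = q1
    and V = q2[THEN conjunct1, rule_format] q4[THEN conjunct1, rule_format]
    and W = q3[THEN conjunct1, rule_format] q5[THEN conjunct1, rule_format]
      q6[THEN conjunct1, rule_format]
    and WV = q7[THEN conjunct1, rule_format]
    and VW = q8[THEN conjunct1, rule_format]
    and ps = q8[THEN conjunct2, rule_format]
  define E where "E S A x = W S (p S A (V S x))" for S A x
  have E_mult: "E S (A o\<^sub>L B) x = E S A (E S B x)" if "invariant S" "A \<in> \<A>" "B \<in> \<A>" for S A B x
    using that by (simp add: E_def cc_hom_simps[OF p] VW)
  \<comment> \<open>For a product, the intermediate vector \<open>E S B x = E S' B x\<close> is
    supported in both sets, so the hypothesis for the left factor applies to it.\<close>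
  have E_indep: "E S A x = E S' A x" if SS: "invariant S" "invariant S'" and "A \<in> \<A>" "supp x \<subseteq> S" "supp x \<subseteq> S'" for S S' A x
    using that(3-5)
  proof (induction arbitrary: x rule: dense_induct)
    case (gen i j)
    then show ?case by (simp add: E_def ps SS)
  next
    case (scalar c)
    then show ?case by (simp add: E_def cc_hom_simps[OF p] SS V W WV)
  next
    case (add A B)
    then show ?case
      by (simp add: E_def cc_hom_simps[OF p] SS blinfun.add_left blinfun.add_right)
  next
    case (mult A B)
    have e: "E S B x = E S' B x" by (rule mult.IH(2)[OF mult.prems])
    have "supp (E S B x) \<subseteq> S" "supp (E S' B x) \<subseteq> S'"
      unfolding E_def by (intro W SS)+
    then show ?case using mult.IH(1)[of "E S' B x"] e
      by (simp add: E_mult[OF SS(1) mult(1,2)] E_mult[OF SS(2) mult(1,2)])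
  next
    case (lim X A)
    have l: "(\<lambda>k. E S (X k) x) \<longlonglongrightarrow> E S A x" if "invariant S" for S
      unfolding E_def
      by (intro blinfun.tendsto tendsto_const cc_hom_tendsto[OF p[OF that] lim(1-3)])
    show ?case
      using LIMSEQ_unique[OF l[OF SS(1)]] l[OF SS(2)] lim(4)[OF lim.prems] by simp
  qed
  define St where "St x = (SOME S. invariant S \<and> supp x \<subseteq> S)" for x :: "'b ell2"
  have St: "invariant (St x)" "supp x \<subseteq> St x" for x
    using someI_ex[OF ex_inv[OF countable_supp[of x]]] by (auto simp: St_def)
  define P where "P A x = E (St x) A x" for A x
  have P: "P A x = E S A x" if "invariant S" "supp x \<subseteq> S" "A \<in> \<A>" for S A x
    unfolding P_def using E_indep[OF St(1)[of x] that(1) that(3) St(2) that(2)] .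
  \<comment> \<open>The chosen \<open>St x\<close> varies with \<open>x\<close> without any
    compatibility; linearity and matrix norms are computed in a set containing all supports
    involved.\<close>
  have common: "\<exists>S. invariant S \<and> (\<forall>x\<in>Y. supp x \<subseteq> S)" if Y: "countable Y" for Y :: "'b ell2 set"
  proof -
    have "countable (\<Union>x\<in>Y. supp x)" using Y by (auto intro: countable_supp)
    from ex_inv[OF this] show ?thesis by blast
  qed
  have E_lin: "E S A (x + y) = E S A x + E S A y" "E S A (r *\<^sub>R x) = r *\<^sub>R E S A x" for S A x y r
    by (simp_all add: E_def blinfun.add_right blinfun.scaleR_right)
  have lin: "bounded_linear (P A)" if A: "A \<in> \<A>" for A
  proof (rule bounded_linear_intro[where K = "norm A"])
    fix x y :: "'b ell2" and r
    have "countable {x, y, x + y, r *\<^sub>R x}" by simp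
    from common[OF this] obtain S where S: "invariant S" "\<forall>z\<in>{x, y, x + y, r *\<^sub>R x}. supp z \<subseteq> S" by blast
    show "P A (x + y) = P A x + P A y" "P A (r *\<^sub>R x) = r *\<^sub>R P A x"
      using S A by (simp_all add: P[of S] E_lin)
    have "norm (E S A x) \<le> norm (p S A (V S x))" unfolding E_def by (rule W[OF S(1)])
    also have "\<dots> \<le> norm (p S A) * norm (V S x)" by (rule norm_blinfun)
    also have "\<dots> \<le> norm A * norm x"
      by (intro mult_mono cc_hom_simps[OF p] V S A) auto
    finally show "norm (P A x) \<le> norm x * norm A" using S A by (simp add: P[of S] mult.commute)
  qed
  define \<pi> where "\<pi> A = Blinfun (P A)" for A
  have \<pi>: "\<pi> A x = E S A x" if "invariant S" "supp x \<subseteq> S" "A \<in> \<A>" for S A x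
    using that lin by (simp add: \<pi>_def bounded_linear_Blinfun_apply P[of S])
  have "unital_hom \<A> \<pi>"
    unfolding unital_hom_def
  proof (intro conjI allI ballI)
    show "\<pi> id_blinfun = id_blinfun"
      by (rule blinfun_eqI) (simp add: \<pi>[OF St] E_def cc_hom_simps[OF p] St WV)
    show "\<pi> (scalar_op c o\<^sub>L A) = scalar_op c o\<^sub>L \<pi> A" if "A \<in> \<A>" for c A
      using that
      by (intro blinfun_eqI) (simp add: \<pi>[OF St] E_def cc_hom_simps[OF p] St W)
    fix A B assume AB: "A \<in> \<A>" "B \<in> \<A>"
    then show "\<pi> (A + B) = \<pi> A + \<pi> B"
      by (intro blinfun_eqI) (simp add: \<pi>[OF St] E_def cc_hom_simps[OF p] St blinfun.add_left blinfun.add_right)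
    show "\<pi> (A o\<^sub>L B) = \<pi> A o\<^sub>L \<pi> B"
    proof (rule blinfun_eqI)
      fix x
      have "supp (E (St x) B x) \<subseteq> St x" unfolding E_def by (rule W[OF St(1)])
      then show "\<pi> (A o\<^sub>L B) x = (\<pi> A o\<^sub>L \<pi> B) x"
        using AB by (simp add: \<pi>[OF St(1)[of x]] St(2)[of x] E_mult[OF St(1)])
    qed
  qed
  moreover have "completely_contractive \<A> \<pi>"
    unfolding completely_contractive_def
  proof (intro allI impI mat_norm_leI)
    fix N A and x :: "nat \<Rightarrow> 'b ell2"
    assume A: "\<forall>p<N. \<forall>q<N. A p q \<in> \<A>" and x: "L2_set (\<lambda>q. norm (x q)) {..<N} \<le> 1"
    obtain S where S: "invariant S" "\<And>q. supp (x q) \<subseteq> S"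
      using common[of "range x"] by auto
    have "L2_set (\<lambda>r. norm (\<Sum>q<N. \<pi> (A r q) (x q))) {..<N} \<le>
        L2_set (\<lambda>r. norm (\<Sum>q<N. p S (A r q) (V S (x q)))) {..<N}"
    proof (rule L2_set_mono)
      fix r assume r: "r \<in> {..<N}"
      have "(\<Sum>q<N. \<pi> (A r q) (x q)) = W S (\<Sum>q<N. p S (A r q) (V S (x q)))"
        using A r by (simp add: \<pi>[OF S] E_def blinfun.sum_right)
      then show "norm (\<Sum>q<N. \<pi> (A r q) (x q)) \<le> norm (\<Sum>q<N. p S (A r q) (V S (x q)))"
        by (simp add: W S)
    qed simp
    also have "\<dots> \<le> mat_norm N (\<lambda>r q. p S (A r q))"
    proof (rule mat_norm_upper)
      have "L2_set (\<lambda>q. norm (V S (x q))) {..<N} \<le> L2_set (\<lambda>q. norm (x q)) {..<N}"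
        by (rule L2_set_mono) (simp_all add: V S)
      then show "L2_set (\<lambda>q. norm (V S (x q))) {..<N} \<le> 1" using x by simp
    qed
    also have "\<dots> \<le> mat_norm N A"
      using p[OF S(1)] A by (simp add: cc_hom_def completely_contractive_def)
    finally show "L2_set (\<lambda>r. norm (\<Sum>q<N. \<pi> (A r q) (x q))) {..<N} \<le> mat_norm N A" .
  qed
  moreover have "\<pi> A \<in> bounded_ops" if A: "A \<in> \<A>" for A
    unfolding bounded_ops_def
  proof safe
    fix c and x :: "'b ell2"
    obtain S where S: "invariant S" "supp x \<subseteq> S" "supp (c *\<^sub>C x) \<subseteq> S"
      using common[of "{x, c *\<^sub>C x}"] by auto
    show "\<pi> A (c *\<^sub>C x) = c *\<^sub>C \<pi> A x"
      using S A cc_hom_simps(8)[OF p[OF S(1)] A] by (simp add: \<pi>[of S] E_def V W blinfun_cscale)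
  qed
  ultimately have "cc_hom \<A> \<pi>" by (auto simp: cc_hom_def)
  moreover have "\<pi> (s i j) = T i j" if "i < m" "j < n i" for i j
    using that by (intro blinfun_eqI) (simp add: \<pi>[OF St] E_def ps St)
  ultimately show ?thesis by blast
qed

text \<open>The choice is immaterial on \<open>\<A>\<close>, where the values at the generators
  determine such a homomorphism.\<close>

definition rep :: "(nat \<Rightarrow> nat \<Rightarrow> 'b op) \<Rightarrow> 'a op \<Rightarrow> 'b op"
  where "rep T = (SOME \<pi>. cc_hom \<A> \<pi> \<and> (\<forall>i<m. \<forall>j<n i. \<pi> (s i j) = T i j))"

lemma
  assumes "\<And>i. i < m \<Longrightarrow> row_contraction (n i) (T i)"
  shows rep_hom: "cc_hom \<A> (rep T)" and rep_s: "i < m \<Longrightarrow> j < n i \<Longrightarrow> rep T (s i j) = T i j"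
  using someI_ex[OF universal[of T]] assms by (auto simp: rep_def)

end

section \<open>Invertible elements and characters\<close>

lemma bounded_bilinear_cscale: "bounded_bilinear (cscale :: complex \<Rightarrow> 'a ell2 \<Rightarrow> 'a ell2)"
proof
  show "\<exists>K. \<forall>c (x :: 'a ell2). norm (c *\<^sub>C x) \<le> norm c * norm x * K"
    by (intro exI[of _ 1]) (simp add: norm_cscale)
  show "(r *\<^sub>R c) *\<^sub>C x = r *\<^sub>R (c *\<^sub>C x)" for r c and x :: "'a ell2"
    by (rule ell2_eqI) (simp add: scaleR_conv_of_real)
qed (simp_all add: cscale_add cscale_add_left cscale_scaleR)

lemmas tendsto_cscale = bounded_bilinear.tendsto[OF bounded_bilinear_cscale]

lemma scaleR_op: "r *\<^sub>R A = scalar_op (complex_of_real r) o\<^sub>L A"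
  by (rule blinfun_eqI) (simp add: blinfun.scaleR_left cscale_of_real)

lemma norm_scalar_op_compose_le: "norm (scalar_op c o\<^sub>L A) \<le> cmod c * norm A"
proof (rule norm_blinfun_bound)
  show "norm ((scalar_op c o\<^sub>L A) x) \<le> cmod c * norm A * norm x" for x
    using mult_left_mono[OF norm_blinfun[of A x], of "cmod c"] by (simp add: norm_cscale mult.assoc)
qed simp

context free_prod
begin

lemma scaleR_in [simp, intro]: "A \<in> \<A> \<Longrightarrow> r *\<^sub>R A \<in> \<A>"
  by (simp add: scaleR_op)

text \<open>The partial sums of the series of powers of \<open>- B\<close> lie in
  \<open>\<A>\<close>, which is closed, so the inverse does too. This serves both the continuity of
  characters and the denominators of Moebius transformations.\<close>

lemma neumann:
  assumes B: "B \<in> \<A>" "norm B < 1"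
  shows "\<exists>X\<in>\<A>. X o\<^sub>L (id_blinfun + B) = id_blinfun \<and> (id_blinfun + B) o\<^sub>L X = id_blinfun"
proof -
  define p where "p k = (((o\<^sub>L) (- B)) ^^ k) id_blinfun" for k
  have p0: "p 0 = id_blinfun" and pS: "p (Suc k) = - B o\<^sub>L p k" for k
    by (simp_all add: p_def)
  \<comment> \<open>The recursion multiplies on the left only; this gives the two-sided
    inverse.\<close>
  have pS': "p k o\<^sub>L (- B) = p (Suc k)" for k
  proof (induction k)
    case (Suc k)
    have "p (Suc k) o\<^sub>L (- B) = - B o\<^sub>L (p k o\<^sub>L (- B))"
      unfolding pS by (rule blinfun_eqI) simp
    then show ?case by (simp only: Suc pS)
  qed (auto simp: p0 pS intro: blinfun_eqI)
  have pA: "p k \<in> \<A>" for k by (induction k) (simp_all add: p0 pS B)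
  have "norm (p k) \<le> norm B ^ k" for k
  proof (induction k)
    case (Suc k)
    have "norm (p (Suc k)) \<le> norm (- B) * norm (p k)" unfolding pS by (rule norm_blinfun_compose)
    also have "\<dots> \<le> norm B * norm B ^ k" using Suc by (intro mult_mono) auto
    finally show ?case by simp
  qed (simp add: p0 norm_blinfun_id_le)
  then have "summable p"
    by (rule summable_comparison_test'[where g = "\<lambda>k. norm B ^ k" and N = 0, rotated])
       (use B(2) in \<open>simp add: summable_geometric\<close>)
  then obtain X where X: "p sums X" by blast
  have "X \<in> \<A>"
    by (rule A_limit[OF _ X[unfolded sums_def]]) (auto intro: sum_in pA)
  have "(\<lambda>k. p (Suc k)) sums (X - id_blinfun)"
    using sums_split_initial_segment[OF X, of 1] by (simp add: p0)
  moreover have "(\<lambda>k. p (Suc k)) sums (- B o\<^sub>L X)" "(\<lambda>k. p (Suc k)) sums (X o\<^sub>L - B)"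
    using bounded_linear.sums[OF bounded_bilinear.bounded_linear_right[OF bounded_bilinear_blinfun_compose] X, of "- B"]
      bounded_linear.sums[OF bounded_bilinear.bounded_linear_left[OF bounded_bilinear_blinfun_compose] X, of "- B"]
    by (simp_all add: pS[symmetric] pS')
  ultimately have e: "- B o\<^sub>L X = X - id_blinfun" "X o\<^sub>L - B = X - id_blinfun"
    using sums_unique2 by blast+
  have "X o\<^sub>L (id_blinfun + B) = X - (X o\<^sub>L - B)" "(id_blinfun + B) o\<^sub>L X = X - (- B o\<^sub>L X)"
    by (intro blinfun_eqI; simp add: blinfun.add_left blinfun.add_right blinfun.diff_left blinfun.minus_left blinfun.minus_right)+
  then have "X o\<^sub>L (id_blinfun + B) = id_blinfun" "(id_blinfun + B) o\<^sub>L X = id_blinfun"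
    unfolding e by simp_all
  then show ?thesis using \<open>X \<in> \<A>\<close> by blast
qed

text \<open>Continuity is automatic: if \<open>norm A < cmod (\<tau> A)\<close>, then
  \<open>id_blinfun - A / \<tau> A\<close> has an inverse in \<open>\<A>\<close> by the Neumann
  series, although \<open>\<tau>\<close> maps it to 0.\<close>

lemma character_simps:
  assumes "\<tau> \<in> characters \<A>"
  shows "\<tau> (scalar_op c) = c" "\<tau> id_blinfun = 1"
    "A \<in> \<A> \<Longrightarrow> B \<in> \<A> \<Longrightarrow> \<tau> (A + B) = \<tau> A + \<tau> B"
    "A \<in> \<A> \<Longrightarrow> B \<in> \<A> \<Longrightarrow> \<tau> (A o\<^sub>L B) = \<tau> A * \<tau> B"
    "A \<in> \<A> \<Longrightarrow> \<tau> (- A) = - \<tau> A"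
    "A \<in> \<A> \<Longrightarrow> B \<in> \<A> \<Longrightarrow> \<tau> (A - B) = \<tau> A - \<tau> B"
    "A \<in> \<A> \<Longrightarrow> cmod (\<tau> A) \<le> norm A" "\<tau> 0 = 0"
proof -
  have t: "\<And>c A. A \<in> \<A> \<Longrightarrow> \<tau> (scalar_op c o\<^sub>L A) = c * \<tau> A"
    "\<And>A B. A \<in> \<A> \<Longrightarrow> B \<in> \<A> \<Longrightarrow> \<tau> (A + B) = \<tau> A + \<tau> B"
    "\<And>A B. A \<in> \<A> \<Longrightarrow> B \<in> \<A> \<Longrightarrow> \<tau> (A o\<^sub>L B) = \<tau> A * \<tau> B"
    using assms by (auto simp: characters_def)
  have "\<exists>A\<in>\<A>. \<tau> A \<noteq> 0" using assms by (simp add: characters_def)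
  then have 1: "\<tau> id_blinfun = 1" using t(3)[of _ id_blinfun] by (auto simp: op_compose_id)
  then show "\<tau> id_blinfun = 1" .
  show s: "\<tau> (scalar_op c) = c" for c
    using t(1)[of id_blinfun c] 1 by (simp add: op_compose_id)
  show 3: "A \<in> \<A> \<Longrightarrow> B \<in> \<A> \<Longrightarrow> \<tau> (A + B) = \<tau> A + \<tau> B" for A B by (rule t)
  show "A \<in> \<A> \<Longrightarrow> B \<in> \<A> \<Longrightarrow> \<tau> (A o\<^sub>L B) = \<tau> A * \<tau> B" by (rule t)
  show 5: "A \<in> \<A> \<Longrightarrow> \<tau> (- A) = - \<tau> A" for A
    using t(1)[of A "- 1"] by (simp add: scalar_op_neg)
  show "A \<in> \<A> \<Longrightarrow> B \<in> \<A> \<Longrightarrow> \<tau> (A - B) = \<tau> A - \<tau> B"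
    using 3[of A "- B"] 5 by simp
  show "\<tau> 0 = 0" using 3[of 0 0] by simp
  show "cmod (\<tau> A) \<le> norm A" if A: "A \<in> \<A>"
  proof (rule ccontr)
    assume "\<not> cmod (\<tau> A) \<le> norm A"
    then have l: "norm A < cmod (\<tau> A)" by simp
    define B where "B = scalar_op (- 1 / \<tau> A) o\<^sub>L A"
    have BA: "B \<in> \<A>" using A by (simp add: B_def)
    have "norm B \<le> cmod (- 1 / \<tau> A) * norm A" unfolding B_def by (rule norm_scalar_op_compose_le)
    also have "\<dots> < 1" using l by (simp add: norm_divide divide_simps)
    finally obtain X where X: "X \<in> \<A>" "X o\<^sub>L (id_blinfun + B) = id_blinfun"
      using neumann[OF BA] by blast
    have "\<tau> A \<noteq> 0" using l by auto
    then have "\<tau> B = - 1" using t(1)[OF A] by (simp add: B_def)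
    then have "\<tau> (X o\<^sub>L (id_blinfun + B)) = 0" using X(1) BA by (simp add: t 1)
    then show False by (simp add: X 1)
  qed
qed

lemma character_sum:
  assumes "\<tau> \<in> characters \<A>" "\<And>i. i \<in> F \<Longrightarrow> f i \<in> \<A>"
  shows "\<tau> (sum f F) = (\<Sum>i\<in>F. \<tau> (f i))"
  using assms(2)
proof (induction F rule: infinite_finite_induct)
  case (insert x F)
  then show ?case by (simp add: character_simps[OF assms(1)] sum_in)
qed (simp_all add: character_simps[OF assms(1)])

lemma character_tendsto:
  assumes \<tau>: "\<tau> \<in> characters \<A>" and X: "\<And>k. X k \<in> \<A>" "X \<longlonglongrightarrow> A" "A \<in> \<A>"
  shows "(\<lambda>k. \<tau> (X k)) \<longlonglongrightarrow> \<tau> A"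
proof (rule contraction_tendsto[OF _ X(2)])
  show "norm (\<tau> (X k) - \<tau> A) \<le> norm (X k - A)" for k
    using character_simps(7)[OF \<tau>, of "X k - A"] X
    by (simp add: character_simps(6)[OF \<tau>])
qed

lemma character_eqI:
  assumes \<tau>: "\<tau> \<in> characters \<A>" and \<tau>': "\<tau>' \<in> characters \<A>"
    and eq: "\<And>i j. i < m \<Longrightarrow> j < n i \<Longrightarrow> \<tau> (s i j) = \<tau>' (s i j)"
  shows "\<tau> = \<tau>'"
proof (rule extensionalityI[of _ \<A>])
  show "\<tau> \<in> extensional \<A>" "\<tau>' \<in> extensional \<A>" using assms by (auto simp: characters_def)
  show "\<tau> A = \<tau>' A" if "A \<in> \<A>" for A
    using that
  proof (induction rule: dense_induct)
    case (lim X A)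
    then show ?case
      using LIMSEQ_unique[OF character_tendsto[OF \<tau> lim(1-3)]] character_tendsto[OF \<tau>' lim(1-3)] by simp
  qed (simp_all add: eq character_simps[OF \<tau>] character_simps[OF \<tau>'])
qed

lemma polyball_row_contraction:
  assumes "z \<in> polyball m n" "i < m"
  shows "row_contraction (n i) (\<lambda>j. scalar_op (coord z (i, j)))"
  unfolding row_contraction_adjoint
proof (intro conjI allI impI)
  fix x :: "'b ell2"
  have "(\<Sum>j<n i. (cmod (coord z (i, j)))\<^sup>2) \<le> 1" using assms by (auto simp: polyball_def)
  then have "(\<Sum>j<n i. (cmod (coord z (i, j)))\<^sup>2) * (norm x)\<^sup>2 \<le> 1 * (norm x)\<^sup>2"
    by (intro mult_right_mono) auto
  then show "(\<Sum>j<n i. (norm (adjoint (scalar_op (coord z (i, j))) x))\<^sup>2) \<le> (norm x)\<^sup>2"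
    by (simp add: adjoint_simps norm_cscale power_mult_distrib sum_distrib_right)
qed auto

text \<open>The scalar operators given by the coordinates of \<open>z\<close> form row contractions.
  The representation which they induce takes scalar values only, since scalars are closed under
  sums, products and limits, and its scalar is the character.\<close>

lemma character_exists:
  assumes z: "z \<in> polyball m n"
  shows "\<exists>\<tau>. \<tau> \<in> characters \<A> \<and> (\<forall>i<m. \<forall>j<n i. \<tau> (s i j) = coord z (i, j))"
proof -
  define \<pi> where "\<pi> = rep (\<lambda>i j. scalar_op (coord z (i, j)) :: nat op)"
  have \<pi>: "cc_hom \<A> \<pi>" and \<pi>s: "\<And>i j. i < m \<Longrightarrow> j < n i \<Longrightarrow> \<pi> (s i j) = scalar_op (coord z (i, j))"
    using rep_hom[of "\<lambda>i j. scalar_op (coord z (i, j))"] rep_s[of "\<lambda>i j. scalar_op (coord z (i, j))"]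
      polyball_row_contraction[OF z] by (auto simp: \<pi>_def)
  define e :: "nat ell2" where "e = basis_vec 0"
  have ex: "\<exists>c. \<pi> A = scalar_op c" if "A \<in> \<A>" for A
    using that
  proof (induction rule: dense_induct)
    case (gen i j)
    then show ?case using \<pi>s by blast
  next
    case (scalar c)
    then show ?case using cc_hom_simps[OF \<pi>] by blast
  next
    case (add A B)
    then obtain c d where "\<pi> A = scalar_op c" "\<pi> B = scalar_op d" by blast
    then have "\<pi> (A + B) = scalar_op (c + d)"
      using add by (intro blinfun_eqI) (simp add: cc_hom_simps[OF \<pi>] blinfun.add_left cscale_add_left)
    then show ?case ..
  next
    case (mult A B)
    then obtain c d where "\<pi> A = scalar_op c" "\<pi> B = scalar_op d" by blast
    then have "\<pi> (A o\<^sub>L B) = scalar_op (c * d)"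
      using mult by (intro blinfun_eqI) (simp add: cc_hom_simps[OF \<pi>])
    then show ?case ..
  next
    case (lim X A)
    from lim(4) have "\<forall>k. \<exists>c. \<pi> (X k) = scalar_op c" by blast
    from choice[OF this] obtain c where c: "\<And>k. \<pi> (X k) = scalar_op (c k)" by blast
    have l: "(\<lambda>k. c k *\<^sub>C x) \<longlonglongrightarrow> \<pi> A x" for x
      using cc_hom_tendsto_apply[OF \<pi> lim(1-3), of x] by (simp only: c scalar_op_apply)
    \<comment> \<open>The scalars are recovered from their action on one basis vector, hence they
      converge.\<close>
    have "c \<longlonglongrightarrow> coord (\<pi> A e) 0"
      using tendsto_coord[OF l[of e], of 0] by (simp add: e_def coord_basis_vec)
    then have "\<pi> A x = scalar_op (coord (\<pi> A e) 0) x" for x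
      unfolding scalar_op_apply by (intro LIMSEQ_unique[OF l] tendsto_cscale tendsto_const)
    then show ?case by (intro exI) (rule blinfun_eqI)
  qed
  define \<tau> where "\<tau> = restrict (\<lambda>A. coord (\<pi> A e) 0) \<A>"
  have \<tau>: "\<tau> A = c" if "A \<in> \<A>" "\<pi> A = scalar_op c" for A c
    using that by (simp add: \<tau>_def e_def coord_basis_vec)
  have p: "\<pi> A = scalar_op (\<tau> A)" if "A \<in> \<A>" for A
    using ex[OF that] \<tau>[OF that] by auto
  have "\<tau> \<in> characters \<A>"
    unfolding characters_def
  proof (intro CollectI conjI allI ballI)
    show "\<tau> \<in> extensional \<A>" by (simp add: \<tau>_def)
    show "\<tau> (scalar_op c o\<^sub>L A) = c * \<tau> A" if "A \<in> \<A>" for c A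
      using that p[OF that] by (intro \<tau>) (auto simp: cc_hom_simps[OF \<pi>] intro!: blinfun_eqI)
    show "\<tau> (A + B) = \<tau> A + \<tau> B" if "A \<in> \<A>" "B \<in> \<A>" for A B
      using that p[OF that(1)] p[OF that(2)]
      by (intro \<tau>) (auto simp: cc_hom_simps[OF \<pi>] blinfun.add_left cscale_add_left intro!: blinfun_eqI)
    show "\<tau> (A o\<^sub>L B) = \<tau> A * \<tau> B" if "A \<in> \<A>" "B \<in> \<A>" for A B
      using that p[OF that(1)] p[OF that(2)]
      by (intro \<tau>) (auto simp: cc_hom_simps[OF \<pi>] intro!: blinfun_eqI)
    show "\<exists>A\<in>\<A>. \<tau> A \<noteq> 0"
      by (rule bexI[of _ id_blinfun]) (simp_all add: \<tau>_def cc_hom_simps[OF \<pi>] e_def coord_basis_vec)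
  qed
  moreover have "\<tau> (s i j) = coord z (i, j)" if "i < m" "j < n i" for i j
    using that by (intro \<tau> \<pi>s) auto
  ultimately show ?thesis by blast
qed

abbreviation \<rho> where "\<rho> z \<equiv> rho m n \<A> s z"

lemma
  assumes z: "z \<in> polyball m n"
  shows rho_character: "\<rho> z \<in> characters \<A>"
    and rho_s: "i < m \<Longrightarrow> j < n i \<Longrightarrow> \<rho> z (s i j) = coord z (i, j)"
proof -
  have "\<exists>!\<tau>. \<tau> \<in> characters \<A> \<and> (\<forall>i<m. \<forall>j<n i. \<tau> (s i j) = coord z (i, j))"
  proof (rule ex_ex1I[OF character_exists[OF z]])
    show "\<tau> = \<tau>'"
      if "\<tau> \<in> characters \<A> \<and> (\<forall>i<m. \<forall>j<n i. \<tau> (s i j) = coord z (i, j))"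
        "\<tau>' \<in> characters \<A> \<and> (\<forall>i<m. \<forall>j<n i. \<tau>' (s i j) = coord z (i, j))" for \<tau> \<tau>'
      using that by (intro character_eqI) auto
  qed
  from theI'[OF this] show "\<rho> z \<in> characters \<A>" "i < m \<Longrightarrow> j < n i \<Longrightarrow> \<rho> z (s i j) = coord z (i, j)"
    unfolding rho_def by blast+
qed

lemmas rho_simps = character_simps[OF rho_character]
lemmas rho_sum = character_sum[OF rho_character]
lemmas rho_tendsto = character_tendsto[OF rho_character]

lemma compose_rho_character:
  assumes \<phi>: "cc_hom \<A> \<phi>" "\<phi> ` \<A> \<subseteq> \<A>" and z: "z \<in> polyball m n"
  shows "compose \<A> (\<rho> z) \<phi> \<in> characters \<A>"
proof -
  have \<phi>A: "\<phi> A \<in> \<A>" if "A \<in> \<A>" for A using that \<phi> by auto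
  show ?thesis
    unfolding characters_def
  proof (intro CollectI conjI allI ballI)
    show "\<exists>A\<in>\<A>. compose \<A> (\<rho> z) \<phi> A \<noteq> 0"
      by (rule bexI[of _ id_blinfun])
         (simp_all add: compose_eq cc_hom_simps[OF \<phi>(1)] rho_simps[OF z])
  qed (simp_all add: compose_extensional compose_eq cc_hom_simps[OF \<phi>(1)] \<phi>A rho_simps[OF z])
qed

lemma rho_compose:
  assumes "cc_hom \<A> \<phi>" "\<phi> ` \<A> \<subseteq> \<A>" "z \<in> polyball m n" "w \<in> polyball m n"
    and "\<And>i j. i < m \<Longrightarrow> j < n i \<Longrightarrow> \<rho> z (\<phi> (s i j)) = coord w (i, j)"
  shows "compose \<A> (\<rho> z) \<phi> = \<rho> w"
  by (rule character_eqI)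
     (simp_all add: assms compose_rho_character rho_character rho_s compose_eq)

lemma rho_compose_apply:
  assumes "cc_hom \<A> \<phi>" "\<phi> ` \<A> \<subseteq> \<A>" "z \<in> polyball m n" "w \<in> polyball m n"
    and "\<And>i j. i < m \<Longrightarrow> j < n i \<Longrightarrow> \<rho> z (\<phi> (s i j)) = coord w (i, j)" and "A \<in> \<A>"
  shows "\<rho> z (\<phi> A) = \<rho> w A"
  using fun_cong[OF rho_compose[OF assms(1-5)], of A] assms(6) by (simp add: compose_eq)

lemma cc_hom_image:
  assumes \<phi>: "cc_hom \<A> \<phi>" and s: "\<And>i j. i < m \<Longrightarrow> j < n i \<Longrightarrow> \<phi> (s i j) \<in> \<A>"
  shows "\<phi> ` \<A> \<subseteq> \<A>"
proof safe
  show "\<phi> A \<in> \<A>" if "A \<in> \<A>" for A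
    using that
  proof (induction rule: dense_induct)
    case (lim X A)
    then show ?case using A_limit[OF _ cc_hom_tendsto[OF \<phi> lim(1-3)]] by blast
  qed (simp_all add: s cc_hom_simps[OF \<phi>])
qed

end

section \<open>The grading\<close>

text \<open>The domain leaves out first index 0: truncated subtraction would identify it with 1 and
  destroy injectivity. Slice 0 of the result is therefore 0.\<close>

definition right_shift :: "(nat \<times> 'b) op"
  where "right_shift = reindex_op {a. fst a \<ge> 1} (\<lambda>a. (fst a - 1, snd a))"

definition left_shift :: "(nat \<times> 'b) op"
  where "left_shift = reindex_op UNIV (\<lambda>a. (Suc (fst a), snd a))"

lemma slice_right_shift:
  "slice_vec k (right_shift \<xi>) = (case k of 0 \<Rightarrow> 0 | Suc k \<Rightarrow> slice_vec k \<xi>)"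
proof -
  have "inj_on (\<lambda>a :: nat \<times> 'b. (fst a - 1, snd a)) {a. 1 \<le> fst a}"
    by (rule inj_onI) (auto simp: prod_eq_iff)
  then show ?thesis
    by (auto simp: right_shift_def reindex_op.rep_eq split: nat.split intro!: ell2_eqI)
qed

lemma slice_left_shift: "slice_vec k (left_shift \<xi>) = slice_vec (Suc k) \<xi>"
proof -
  have "inj (\<lambda>a :: nat \<times> 'b. (Suc (fst a), snd a))"
    by (rule injI) (auto simp: prod_eq_iff)
  then show ?thesis
    by (auto simp: left_shift_def reindex_op.rep_eq intro!: ell2_eqI)
qed

lemma shift_decomposition: "\<xi> = incl_vec 0 (slice_vec 0 \<xi>) + right_shift (left_shift \<xi>)"
  by (rule ell2_slice_eqI)
     (auto simp: slice_simps slice_incl_vec slice_right_shift slice_left_shift split: nat.split)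

lemma norm_slice_op_le: "norm (slice_op k) \<le> 1"
  by (rule norm_blinfun_bound) (simp_all add: slice_op.rep_eq norm_slice_vec_le)

lemma bounded_op_right_shift: "right_shift \<in> bounded_ops"
  by (auto simp: bounded_ops_def slice_simps slice_right_shift split: nat.split intro!: ell2_slice_eqI)

lemma norm_right_shift_le: "norm (right_shift \<xi>) \<le> norm \<xi>"
  by (simp add: right_shift_def reindex_op.rep_eq norm_reindex_vec_le)

text \<open>Evaluation of the power series with coefficients \<open>slice_vec k \<xi>\<close> at
  \<open>t\<close>; it turns the shift into multiplication by \<open>t\<close>.\<close>

definition geometric_op :: "real \<Rightarrow> (nat \<times> 'b) ell2 \<Rightarrow>\<^sub>L 'b ell2"
  where "geometric_op t = (\<Sum>k. t ^ k *\<^sub>R slice_op k)"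

lemma geometric_op_sums:
  assumes t: "0 \<le> t" "t < 1"
  shows "(\<lambda>k. t ^ k *\<^sub>R slice_vec k \<xi>) sums geometric_op t \<xi>"
proof -
  have "norm (t ^ k *\<^sub>R (slice_op k :: (nat \<times> 'b) ell2 \<Rightarrow>\<^sub>L 'b ell2)) \<le> t ^ k" for k
    using mult_left_mono[OF norm_slice_op_le[of k], of "t ^ k"] t by simp
  then have "summable (\<lambda>k. t ^ k *\<^sub>R (slice_op k :: (nat \<times> 'b) ell2 \<Rightarrow>\<^sub>L 'b ell2))"
    by (rule summable_comparison_test'[where g = "\<lambda>k. t ^ k" and N = 0, rotated])
       (use t in \<open>simp add: summable_geometric\<close>)
  then have "(\<lambda>k. t ^ k *\<^sub>R slice_op k) sums (geometric_op t :: (nat \<times> 'b) ell2 \<Rightarrow>\<^sub>L 'b ell2)"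
    unfolding geometric_op_def by (rule summable_sums)
  from bounded_linear.sums[OF blinfun.bounded_linear_left this, of \<xi>]
  show ?thesis by (simp add: blinfun.scaleR_left slice_op.rep_eq)
qed

context free_prod
begin

abbreviation I :: "(nat \<times> nat) set" where "I \<equiv> SIGMA i:{..<m}. {..<n i}"

abbreviation sg :: "nat \<times> nat \<Rightarrow> 'a op" where "sg p \<equiv> s (fst p) (snd p)"

lemma zero_in_polyball [simp]: "0 \<in> polyball m n"
  by (simp add: polyball_def)

text \<open>This is the shift tensored with \<open>s i j\<close>. The value 0 at foreign indices
  keeps the diagonal part contractive for all \<open>i\<close> and \<open>j\<close>, as the lemmas
  about \<open>diag_op\<close> demand.\<close>

definition shifted :: "nat \<Rightarrow> nat \<Rightarrow> (nat \<times> 'a) op"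
  where "shifted i j = right_shift o\<^sub>L diag_op (\<lambda>_. if i < m \<and> j < n i then s i j else 0)"

lemma norm_s_le: "i < m \<Longrightarrow> j < n i \<Longrightarrow> norm (s i j) \<le> 1"
  using row_contraction_norm_le[OF row_s] by blast

lemma slice_shifted:
  assumes "i < m" "j < n i"
  shows "slice_vec k (shifted i j \<xi>) = (case k of 0 \<Rightarrow> 0 | Suc k \<Rightarrow> s i j (slice_vec k \<xi>))"
  using assms norm_s_le[OF assms] by (auto simp: shifted_def slice_right_shift slice_diag_op split: nat.split)

lemma row_contraction_shifted:
  assumes i: "i < m"
  shows "row_contraction (n i) (shifted i)"
  unfolding row_contraction_iff
proof (intro conjI allI impI)
  define D :: "nat \<Rightarrow> (nat \<times> 'a) op"
    where "D j = diag_op (\<lambda>_. if i < m \<and> j < n i then s i j else 0)" for j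
  have "row_contraction (n i) (\<lambda>j. if i < m \<and> j < n i then s i j else 0)"
    using row_s[OF i] i by (simp add: row_contraction_iff)
  then have D: "row_contraction (n i) D"
    unfolding D_def by (intro row_contraction_diag_op) (auto simp: norm_s_le)
  have sh: "shifted i j = right_shift o\<^sub>L D j" for j by (simp add: shifted_def D_def)
  show "shifted i j \<in> bounded_ops" if "j < n i" for j
    using D that unfolding sh by (auto simp: row_contraction_def intro: bounded_op_right_shift)
  fix x :: "nat \<Rightarrow> (nat \<times> 'a) ell2"
  have "norm (\<Sum>j<n i. shifted i j (x j)) = norm (right_shift (\<Sum>j<n i. D j (x j)))"
    by (simp add: sh blinfun.sum_right)
  also have "\<dots> \<le> norm (\<Sum>j<n i. D j (x j))" by (rule norm_right_shift_le)
  finally have "(norm (\<Sum>j<n i. shifted i j (x j)))\<^sup>2 \<le> (norm (\<Sum>j<n i. D j (x j)))\<^sup>2"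
    by (intro power_mono) auto
  also have "\<dots> \<le> (\<Sum>j<n i. (norm (x j))\<^sup>2)"
    by (rule D[unfolded row_contraction_iff, THEN conjunct2, rule_format])
  finally show "(norm (\<Sum>j<n i. shifted i j (x j)))\<^sup>2 \<le> (\<Sum>j<n i. (norm (x j))\<^sup>2)" .
qed

definition shift_rep :: "'a op \<Rightarrow> (nat \<times> 'a) op" where "shift_rep = rep shifted"

lemma shift_rep_hom: "cc_hom \<A> shift_rep"
  and shift_rep_s: "i < m \<Longrightarrow> j < n i \<Longrightarrow> shift_rep (s i j) = shifted i j"
  unfolding shift_rep_def by (simp_all add: rep_hom rep_s row_contraction_shifted)

text \<open>
  \<open>\<Phi> k A\<close> is the homogeneous component of degree \<open>k\<close>: mapping \<open>s\<^sub>i\<^sub>j\<close> to \<open>S \<otimes> s\<^sub>i\<^sub>j\<close>, with the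
  unilateral shift \<open>S\<close>, turns elements of the algebra into lower triangular Toeplitz operators.
\<close>

definition \<Phi> :: "nat \<Rightarrow> 'a op \<Rightarrow> 'a op"
  where "\<Phi> k A = slice_op k o\<^sub>L shift_rep A o\<^sub>L incl_op 0"

lemma Phi_apply: "\<Phi> k A x = slice_vec k (shift_rep A (incl_vec 0 x))"
  by (simp add: \<Phi>_def slice_op.rep_eq incl_op.rep_eq)

text \<open>The vectors \<open>\<Phi> k A x\<close> are the slices of the single vector
  \<open>shift_rep A (incl_vec 0 x)\<close>, whose norm is controlled by contractivity of
  \<open>shift_rep\<close>.\<close>

lemma Phi_sumsq:
  assumes "A \<in> \<A>"
  shows "(\<Sum>k\<in>F. (norm (\<Phi> k A x))\<^sup>2) \<le> (norm A * norm x)\<^sup>2"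
proof (cases "finite F")
  case True
  let ?y = "shift_rep A (incl_vec 0 x)"
  have "(\<Sum>k\<in>F. (norm (slice_vec k ?y))\<^sup>2) \<le> (\<Sum>\<^sub>\<infinity>k. (norm (slice_vec k ?y))\<^sup>2)"
    by (rule finite_sum_le_infsum) (auto simp: slice_norms_summable True)
  also have "\<dots> = (norm ?y)\<^sup>2" by (rule norm_slices[symmetric])
  also have "\<dots> \<le> (norm A * norm x)\<^sup>2"
  proof (rule power_mono)
    have "norm ?y \<le> norm (shift_rep A) * norm (incl_vec (0 :: nat) x)" by (rule norm_blinfun)
    also have "\<dots> \<le> norm A * norm x"
      unfolding norm_incl_vec by (intro mult_right_mono cc_hom_simps(7)[OF shift_rep_hom] assms) auto
    finally show "norm ?y \<le> norm A * norm x" .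
  qed simp
  finally show ?thesis by (simp add: Phi_apply)
qed simp

lemma norm_Phi_apply_le:
  assumes "A \<in> \<A>"
  shows "norm (\<Phi> k A x) \<le> norm A * norm x"
  using Phi_sumsq[OF assms, where F = "{k}" and x = x] by (simp add: power2_le_iff_abs_le)

lemma norm_Phi_le: "A \<in> \<A> \<Longrightarrow> norm (\<Phi> k A) \<le> norm A"
  by (rule norm_blinfun_bound) (simp_all add: norm_Phi_apply_le)

lemma Phi_s: "i < m \<Longrightarrow> j < n i \<Longrightarrow> \<Phi> k (s i j) = (if k = 1 then s i j else 0)"
  by (rule blinfun_eqI) (auto simp: Phi_apply shift_rep_s slice_shifted slice_incl_vec split: nat.split)

lemma Phi_scalar: "\<Phi> k (scalar_op c) = (if k = 0 then scalar_op c else 0)"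
  by (rule blinfun_eqI)
     (auto simp: Phi_apply cc_hom_simps[OF shift_rep_hom] slice_simps slice_incl_vec)

lemma Phi_zero: "\<Phi> k 0 = 0"
  by (rule blinfun_eqI) (auto simp: Phi_apply cc_hom_simps[OF shift_rep_hom] intro: ell2_eqI)

lemma Phi_add: "A \<in> \<A> \<Longrightarrow> B \<in> \<A> \<Longrightarrow> \<Phi> k (A + B) = \<Phi> k A + \<Phi> k B"
  by (rule blinfun_eqI) (simp add: Phi_apply cc_hom_simps[OF shift_rep_hom] slice_simps blinfun.add_left)

lemma Phi_diff: "A \<in> \<A> \<Longrightarrow> B \<in> \<A> \<Longrightarrow> \<Phi> k (A - B) = \<Phi> k A - \<Phi> k B"
  using Phi_add[of "A - B" B k] by simp

lemma Phi_tendsto: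
  assumes "\<And>k. X k \<in> \<A>" "X \<longlonglongrightarrow> A" "A \<in> \<A>"
  shows "(\<lambda>k. \<Phi> l (X k)) \<longlonglongrightarrow> \<Phi> l A"
proof (rule contraction_tendsto[OF _ assms(2)])
  show "norm (\<Phi> l (X k) - \<Phi> l A) \<le> norm (X k - A)" for k
    using norm_Phi_le[of "X k - A"] assms by (simp add: Phi_diff)
qed

lemma shift_rep_commute:
  assumes "A \<in> \<A>"
  shows "shift_rep A (right_shift \<xi>) = right_shift (shift_rep A \<xi>)"
  using assms
proof (induction arbitrary: \<xi> rule: dense_induct)
  case (gen i j)
  then show ?case
    by (intro ell2_slice_eqI) (simp add: shift_rep_s slice_shifted slice_right_shift split: nat.split)
next
  case (lim X A)
  have l: "(\<lambda>k. shift_rep (X k) x) \<longlonglongrightarrow> shift_rep A x" for x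
    by (rule cc_hom_tendsto_apply[OF shift_rep_hom lim(1-3)])
  have "(\<lambda>k. shift_rep (X k) (right_shift \<xi>)) \<longlonglongrightarrow> right_shift (shift_rep A \<xi>)"
    unfolding lim(4) by (intro bounded_linear.tendsto[OF blinfun.bounded_linear_right] l)
  then show ?case by (rule LIMSEQ_unique[OF l])
qed (simp_all add: cc_hom_simps[OF shift_rep_hom] blinfun.add_left blinfun.add_right
    blinfun_cscale[OF bounded_op_right_shift])

text \<open>Splitting off slice 0 and moving the shift past \<open>shift_rep A\<close> reduces slice
  \<open>Suc k\<close> to slice \<open>k\<close> of the left-shifted vector. The convolution formula
  for products follows from this.\<close>

lemma slice_shift_rep:
  assumes "A \<in> \<A>"
  shows "slice_vec k (shift_rep A \<xi>) = (\<Sum>j\<le>k. \<Phi> (k - j) A (slice_vec j \<xi>))"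
proof (induction k arbitrary: \<xi>)
  have *: "slice_vec k (shift_rep A \<xi>) = \<Phi> k A (slice_vec 0 \<xi>) +
    slice_vec k (right_shift (shift_rep A (left_shift \<xi>)))" for k \<xi>
    by (subst shift_decomposition[of \<xi>])
       (simp add: blinfun.add_right slice_simps Phi_apply shift_rep_commute[OF assms])
  {
    case 0
    show ?case by (simp add: *[of 0] slice_right_shift)
  next
    case (Suc k)
    have "slice_vec (Suc k) (shift_rep A \<xi>) = \<Phi> (Suc k) A (slice_vec 0 \<xi>) +
      slice_vec k (shift_rep A (left_shift \<xi>))"
      by (simp add: *[of "Suc k"] slice_right_shift)
    then show ?case
      by (simp add: Suc slice_left_shift sum.atMost_Suc_shift del: sum.atMost_Suc)
  }
qed

lemma Phi_mult:
  assumes "A \<in> \<A>" "B \<in> \<A>"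
  shows "\<Phi> k (A o\<^sub>L B) = (\<Sum>j\<le>k. \<Phi> (k - j) A o\<^sub>L \<Phi> j B)"
proof (rule blinfun_eqI)
  fix x
  have "\<Phi> k (A o\<^sub>L B) x = slice_vec k (shift_rep A (shift_rep B (incl_vec 0 x)))"
    by (simp add: Phi_apply cc_hom_simps[OF shift_rep_hom] assms)
  also have "\<dots> = (\<Sum>j\<le>k. \<Phi> (k - j) A (\<Phi> j B x))"
    unfolding slice_shift_rep[OF assms(1)] Phi_apply[of _ B] ..
  finally show "\<Phi> k (A o\<^sub>L B) x = (\<Sum>j\<le>k. \<Phi> (k - j) A o\<^sub>L \<Phi> j B) x"
    by (simp add: blinfun.sum_left)
qed

lemma Phi_scalar_mult:
  assumes "A \<in> \<A>"
  shows "\<Phi> k (scalar_op c o\<^sub>L A) = scalar_op c o\<^sub>L \<Phi> k A"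
    and "\<Phi> k (A o\<^sub>L scalar_op c) = \<Phi> k A o\<^sub>L scalar_op c"
proof -
  have "(\<Sum>j\<le>k. \<Phi> (k - j) (scalar_op c) o\<^sub>L \<Phi> j A) = (\<Sum>j\<le>k. if j = k then scalar_op c o\<^sub>L \<Phi> k A else 0)"
    by (rule sum.cong) (auto simp: Phi_scalar blinfun_eqI)
  then show "\<Phi> k (scalar_op c o\<^sub>L A) = scalar_op c o\<^sub>L \<Phi> k A" using assms by (simp add: Phi_mult)
  have "(\<Sum>j\<le>k. \<Phi> (k - j) A o\<^sub>L \<Phi> j (scalar_op c)) = (\<Sum>j\<le>k. if j = 0 then \<Phi> k A o\<^sub>L scalar_op c else 0)"
    by (rule sum.cong) (auto simp: Phi_scalar blinfun_eqI)
  then show "\<Phi> k (A o\<^sub>L scalar_op c) = \<Phi> k A o\<^sub>L scalar_op c" using assms by (simp add: Phi_mult)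
qed

text \<open>The components of a product are finite sums of products of components, and a component
  of a limit is the limit of the components, so nothing leaves the closed algebra.\<close>

lemma Phi_in [simp, intro]: "A \<in> \<A> \<Longrightarrow> \<Phi> k A \<in> \<A>"
proof (induction arbitrary: k rule: dense_induct)
  case (mult A B)
  then show ?case by (auto simp: Phi_mult intro!: sum_in)
next
  case (lim X A)
  then show ?case using A_limit[OF _ Phi_tendsto[OF lim(1-3)]] by blast
qed (simp_all add: Phi_s Phi_scalar Phi_add)

text \<open>In degree 0 the convolution has one term, so \<open>\<Phi> 0\<close> is multiplicative;
  it annihilates the generators, as does the character at 0.\<close>

lemma Phi_0: "A \<in> \<A> \<Longrightarrow> \<Phi> 0 A = scalar_op (\<rho> 0 A)"
proof (induction rule: dense_induct)
  case (gen i j)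
  then show ?case by (auto simp: Phi_s rho_s intro: blinfun_eqI)
next
  case (lim X A)
  have "(\<lambda>k. \<rho> 0 (X k) *\<^sub>C x) \<longlonglongrightarrow> \<rho> 0 A *\<^sub>C x" for x :: "'a ell2"
    by (intro tendsto_cscale tendsto_const rho_tendsto lim) simp
  moreover have "(\<lambda>k. \<rho> 0 (X k) *\<^sub>C x) \<longlonglongrightarrow> \<Phi> 0 A x" for x
    using bounded_linear.tendsto[OF blinfun.bounded_linear_left Phi_tendsto[OF lim(1-3)], of 0 x]
    by (simp add: lim(4))
  ultimately show ?case by (intro blinfun_eqI) (auto intro: LIMSEQ_unique)
qed (auto simp: Phi_scalar Phi_add Phi_mult rho_simps blinfun.add_left cscale_add_left intro!: blinfun_eqI)

text \<open>Radial dilation by \<open>t\<close>. Its expansion \<open>gamma_sums\<close> is Abel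
  summation: the factors \<open>t ^ k\<close> force convergence, and \<open>t\<close> tending to 1
  recovers \<open>A\<close>.\<close>

definition \<gamma> :: "real \<Rightarrow> 'a op \<Rightarrow> 'a op"
  where "\<gamma> t = rep (\<lambda>i j. t *\<^sub>R s i j)"

lemma
  assumes t: "0 \<le> t" "t \<le> 1"
  shows gamma_hom: "cc_hom \<A> (\<gamma> t)"
    and gamma_s: "i < m \<Longrightarrow> j < n i \<Longrightarrow> \<gamma> t (s i j) = t *\<^sub>R s i j"
    and gamma_image: "\<gamma> t ` \<A> \<subseteq> \<A>"
proof -
  have "row_contraction (n i) (\<lambda>j. t *\<^sub>R s i j)" if i: "i < m" for i
    unfolding row_contraction_iff
  proof (intro conjI allI impI)
    show "t *\<^sub>R s i j \<in> bounded_ops" if "j < n i" for j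
      using i that by (intro A_bounded_ops) auto
    fix x :: "nat \<Rightarrow> 'a ell2"
    have "norm (\<Sum>j<n i. (t *\<^sub>R s i j) (x j)) = t * norm (\<Sum>j<n i. s i j (x j))"
      using t by (simp add: blinfun.scaleR_left scaleR_sum_right[symmetric])
    also have "\<dots> \<le> 1 * norm (\<Sum>j<n i. s i j (x j))"
      using t by (intro mult_right_mono) auto
    finally have "(norm (\<Sum>j<n i. (t *\<^sub>R s i j) (x j)))\<^sup>2 \<le> (norm (\<Sum>j<n i. s i j (x j)))\<^sup>2"
      by (intro power_mono) auto
    also have "\<dots> \<le> (\<Sum>j<n i. (norm (x j))\<^sup>2)"
      by (rule row_s[OF i, unfolded row_contraction_iff, THEN conjunct2, rule_format])
    finally show "(norm (\<Sum>j<n i. (t *\<^sub>R s i j) (x j)))\<^sup>2 \<le> (\<Sum>j<n i. (norm (x j))\<^sup>2)" .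
  qed
  then show 1: "cc_hom \<A> (\<gamma> t)" and 2: "i < m \<Longrightarrow> j < n i \<Longrightarrow> \<gamma> t (s i j) = t *\<^sub>R s i j" for i j
    unfolding \<gamma>_def by (simp_all add: rep_hom rep_s)
  show "\<gamma> t ` \<A> \<subseteq> \<A>" by (rule cc_hom_image[OF 1]) (simp add: 2)
qed

text \<open>On a generator the shift raises the degree by one, which costs a factor
  \<open>t\<close>; this is the dilated generator.\<close>

lemma geometric_op_intertwines:
  assumes t: "0 \<le> t" "t < 1" and "A \<in> \<A>"
  shows "geometric_op t (shift_rep A \<xi>) = \<gamma> t A (geometric_op t \<xi>)"
  using assms(3)
proof (induction arbitrary: \<xi> rule: dense_induct)
  case (gen i j)
  let ?f = "\<lambda>k. t ^ k *\<^sub>R slice_vec k (shifted i j \<xi>)"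
  have "(\<lambda>k. t ^ k *\<^sub>R s i j (slice_vec k \<xi>)) sums s i j (geometric_op t \<xi>)"
    using bounded_linear.sums[OF blinfun.bounded_linear_right geometric_op_sums[OF t, of \<xi>], of "s i j"]
    by (simp add: blinfun.scaleR_right)
  from sums_scaleR_right[OF this, of t]
  \<comment> \<open>\<open>shifted\<close> leaves slice 0 empty, so the sum may start at index 1,
    and the extra factor \<open>t\<close> comes from this index shift.\<close>
  have "(\<lambda>k. ?f (Suc k)) sums (t *\<^sub>R s i j (geometric_op t \<xi>))"
    by (simp add: slice_shifted gen)
  then have "?f sums (t *\<^sub>R s i j (geometric_op t \<xi>))"
    using sums_Suc[of ?f] by (simp add: slice_shifted gen)
  then have "geometric_op t (shifted i j \<xi>) = t *\<^sub>R s i j (geometric_op t \<xi>)"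
    by (rule sums_unique2[OF geometric_op_sums[OF t]])
  then show ?case using t by (simp add: shift_rep_s gen gamma_s blinfun.scaleR_left)
next
  case (scalar c)
  have "geometric_op t (c *\<^sub>C \<xi>) = c *\<^sub>C geometric_op t \<xi>"
  proof (rule sums_unique2[OF geometric_op_sums[OF t]])
    show "(\<lambda>k. t ^ k *\<^sub>R slice_vec k (c *\<^sub>C \<xi>)) sums (c *\<^sub>C geometric_op t \<xi>)"
      using bounded_linear.sums[OF bounded_linear_cscale geometric_op_sums[OF t, of \<xi>], of c]
      by (simp add: slice_simps cscale_scaleR)
  qed
  then show ?case using t
    by (simp add: cc_hom_simps[OF shift_rep_hom] cc_hom_simps[OF gamma_hom])
next
  case (lim X A)
  have "(\<lambda>k. geometric_op t (shift_rep (X k) \<xi>)) \<longlonglongrightarrow> geometric_op t (shift_rep A \<xi>)"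
    by (intro bounded_linear.tendsto[OF blinfun.bounded_linear_right]
        cc_hom_tendsto_apply[OF shift_rep_hom lim(1-3)])
  moreover have "(\<lambda>k. geometric_op t (shift_rep (X k) \<xi>)) \<longlonglongrightarrow> \<gamma> t A (geometric_op t \<xi>)"
    unfolding lim(4) by (rule cc_hom_tendsto_apply[OF gamma_hom lim(1-3)]) (use t in auto)
  ultimately show ?case by (rule LIMSEQ_unique)
qed (use t in \<open>simp_all add: cc_hom_simps[OF shift_rep_hom] cc_hom_simps[OF gamma_hom]
    blinfun.add_left blinfun.add_right\<close>)

lemma gamma_sums:
  assumes t: "0 \<le> t" "t < 1" and A: "A \<in> \<A>"
  shows "(\<lambda>k. t ^ k *\<^sub>R \<Phi> k A x) sums \<gamma> t A x"
proof -
  have "(\<lambda>k. t ^ k *\<^sub>R slice_vec k (incl_vec 0 x)) sums x"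
    using sums_single[of 0 "\<lambda>_. x"] by (simp add: slice_incl_vec if_distrib cong: if_cong)
  then have "geometric_op t (incl_vec 0 x) = x"
    by (rule sums_unique2[OF geometric_op_sums[OF t]])
  then show ?thesis
    using geometric_op_sums[OF t, of "shift_rep A (incl_vec 0 x)"]
    by (simp add: geometric_op_intertwines[OF t A] Phi_apply)
qed

text \<open>All dilations are contractive, so convergence on a dense set passes to limits by
  splitting into three small errors. The parameter \<open>1 - inverse (real (Suc N))\<close> stays
  in the half-open unit interval, where the Abel sums are available.\<close>

lemma gamma_tendsto:
  assumes "A \<in> \<A>"
  shows "(\<lambda>N. \<gamma> (1 - inverse (real (Suc N))) A) \<longlonglongrightarrow> A"
  using assms
proof (induction rule: dense_induct)
  let ?t = "\<lambda>N. 1 - inverse (real (Suc N))"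
  have t: "0 \<le> ?t N" "?t N \<le> 1" for N by (auto simp: field_simps)
  {
    case (gen i j)
    have "(\<lambda>N. ?t N *\<^sub>R s i j) \<longlonglongrightarrow> (1 - 0) *\<^sub>R s i j"
      by (intro tendsto_intros LIMSEQ_inverse_real_of_nat)
    then show ?case using gen by (simp only: gamma_s[OF t]) simp
  next
    case (scalar c)
    then show ?case by (simp only: cc_hom_simps[OF gamma_hom[OF t]] tendsto_const)
  next
    case (add A B)
    then show ?case by (simp only: cc_hom_simps[OF gamma_hom[OF t]] tendsto_add)
  next
    case (mult A B)
    then show ?case
      by (simp only: cc_hom_simps[OF gamma_hom[OF t]]
          bounded_bilinear.tendsto[OF bounded_bilinear_blinfun_compose])
  next
    case (lim X A)
    show ?case
    proof (rule LIMSEQ_I)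
      fix e :: real assume e: "e > 0"
      then obtain k where k: "norm (X k - A) < e / 3"
        using LIMSEQ_D[OF lim(2), of "e / 3"] by auto
      obtain N0 where N0: "\<And>N. N \<ge> N0 \<Longrightarrow> norm (\<gamma> (?t N) (X k) - X k) < e / 3"
        using LIMSEQ_D[OF lim(4)[of k], of "e / 3"] e by auto
      have "norm (\<gamma> (?t N) A - A) < e" if "N \<ge> N0" for N
      proof -
        note g = gamma_hom[OF t[of N]]
        have "norm (\<gamma> (?t N) A - \<gamma> (?t N) (X k)) \<le> norm (A - X k)"
          unfolding cc_hom_simps(6)[OF g lim(3) lim(1), symmetric]
          by (rule cc_hom_simps(7)[OF g]) (use lim in auto)
        moreover have "norm (\<gamma> (?t N) A - A) \<le> norm (\<gamma> (?t N) A - \<gamma> (?t N) (X k)) +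
          (norm (\<gamma> (?t N) (X k) - X k) + norm (X k - A))"
          using norm_triangle_ineq[of "\<gamma> (?t N) A - \<gamma> (?t N) (X k)" "\<gamma> (?t N) (X k) - A"]
            norm_triangle_ineq[of "\<gamma> (?t N) (X k) - X k" "X k - A"] by simp
        ultimately show ?thesis using k N0[OF that] by (simp add: norm_minus_commute)
      qed
      then show "\<exists>N0. \<forall>N\<ge>N0. norm (\<gamma> (?t N) A - A) < e" by blast
    qed
  }
qed

text \<open>The components determine every dilation with parameter below 1, and the dilations
  determine the element in the limit.\<close>

lemma Phi_eqI:
  assumes A: "A \<in> \<A>" "B \<in> \<A>" and eq: "\<And>k. \<Phi> k A = \<Phi> k B"
  shows "A = B"
proof -
  have "\<gamma> (1 - inverse (real (Suc N))) A = \<gamma> (1 - inverse (real (Suc N))) B" for N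
  proof (rule blinfun_eqI)
    have t: "0 \<le> 1 - inverse (real (Suc N))" "1 - inverse (real (Suc N)) < 1"
      by (auto simp: field_simps)
    show "\<gamma> (1 - inverse (real (Suc N))) A x = \<gamma> (1 - inverse (real (Suc N))) B x" for x
      using sums_unique2[OF gamma_sums[OF t A(1)]] gamma_sums[OF t A(2)] by (simp add: eq)
  qed
  then show ?thesis using LIMSEQ_unique[OF gamma_tendsto[OF A(1)]] gamma_tendsto[OF A(2)] by simp
qed

lemma maximum_principle:
  assumes A: "A \<in> \<A>" "norm A \<le> 1" "\<rho> 0 A = 1"
  shows "A = id_blinfun"
proof (rule Phi_eqI)
  fix k
  have 0: "\<Phi> 0 A = id_blinfun" using A by (simp add: Phi_0 scalar_op_1)
  have "\<Phi> k A x = 0" if "k > 0" for x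
  proof -
    \<comment> \<open>Degree 0 alone already contributes the full \<open>norm x\<close> squared,
      which leaves no room for degree \<open>k\<close>.\<close>
    have "(\<Sum>l\<in>{0, k}. (norm (\<Phi> l A x))\<^sup>2) \<le> (norm A * norm x)\<^sup>2" by (rule Phi_sumsq[OF A(1)])
    also have "\<dots> \<le> (1 * norm x)\<^sup>2" by (intro power_mono mult_right_mono A) auto
    finally show ?thesis using that by (simp add: 0)
  qed
  then show "\<Phi> k A = \<Phi> k id_blinfun"
    using 0 by (auto simp: scalar_op_1[symmetric] Phi_scalar intro!: blinfun_eqI)
qed (use A in auto)

text \<open>Each component is bounded by \<open>norm A\<close>, so the terms from degree 2 on are
  dominated by a geometric series with sum \<open>t\<^sup>2 / (1 - t)\<close>; the factor 2 bounds
  \<open>1 / (1 - t)\<close> for \<open>t \<le> 1 / 2\<close>.\<close>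

lemma gamma_first_order:
  assumes t: "0 \<le> t" "t \<le> 1 / 2" and A: "A \<in> \<A>"
  shows "norm (\<gamma> t A - \<Phi> 0 A - t *\<^sub>R \<Phi> 1 A) \<le> 2 * t\<^sup>2 * norm A"
proof (rule norm_blinfun_bound)
  fix x
  let ?f = "\<lambda>k. t ^ k *\<^sub>R \<Phi> k A x"
  have "?f sums \<gamma> t A x" by (rule gamma_sums) (use t A in auto)
  then have s: "(\<lambda>k. ?f (k + 2)) sums (\<gamma> t A x - (\<Sum>k<2. ?f k))"
    by (rule sums_split_initial_segment)
  have g: "(\<lambda>k. t\<^sup>2 * (norm A * norm x) * t ^ k) sums (t\<^sup>2 * (norm A * norm x) * (1 / (1 - t)))"
    by (intro sums_mult geometric_sums) (use t in auto)
  have le: "norm (?f (k + 2)) \<le> t\<^sup>2 * (norm A * norm x) * t ^ k" for k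
    using mult_left_mono[OF norm_Phi_apply_le[OF A, of "k + 2" x], of "t ^ (k + 2)"] t
    by (simp add: power_add power2_eq_square mult_ac)
  have "norm (\<gamma> t A x - (\<Sum>k<2. ?f k)) \<le> t\<^sup>2 * (norm A * norm x) * (1 / (1 - t))"
    by (rule norm_sums_le[OF s g le])
  also have "\<dots> \<le> t\<^sup>2 * (norm A * norm x) * 2"
    using t by (intro mult_left_mono) (auto simp: field_simps)
  finally show "norm ((\<gamma> t A - \<Phi> 0 A - t *\<^sub>R \<Phi> 1 A) x) \<le> 2 * t\<^sup>2 * norm A * norm x"
    by (simp add: blinfun.diff_left blinfun.add_left blinfun.scaleR_left numeral_2_eq_2 algebra_simps)
qed simp

end

section \<open>First-order terms and derivatives at the origin\<close>

lemma polyballD: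
  assumes "z \<in> polyball m n"
  shows "\<not> (i < m \<and> j < n i) \<Longrightarrow> coord z (i, j) = 0"
    and "i < m \<Longrightarrow> (\<Sum>j<n i. (cmod (coord z (i, j)))\<^sup>2) < 1"
  using assms by (auto simp: polyball_def)

lemma polyball_cscale:
  assumes z: "z \<in> polyball m n" and c: "cmod c \<le> 1"
  shows "c *\<^sub>C z \<in> polyball m n"
  unfolding polyball_def
proof (intro CollectI conjI allI impI)
  show "coord (c *\<^sub>C z) (i, j) = 0" if "\<not> (i < m \<and> j < n i)" for i j
    using polyballD(1)[OF z that] by simp
  fix i assume "i < m"
  have "(\<Sum>j<n i. (cmod (coord (c *\<^sub>C z) (i, j)))\<^sup>2) = (cmod c)\<^sup>2 * (\<Sum>j<n i. (cmod (coord z (i, j)))\<^sup>2)"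
    by (simp add: norm_mult power_mult_distrib sum_distrib_left)
  also have "\<dots> \<le> 1 * (\<Sum>j<n i. (cmod (coord z (i, j)))\<^sup>2)"
    using c by (intro mult_right_mono) (auto simp: power_le_one intro: sum_nonneg)
  also have "\<dots> < 1" using polyballD(2)[OF z \<open>i < m\<close>] by simp
  finally show "(\<Sum>j<n i. (cmod (coord (c *\<^sub>C z) (i, j)))\<^sup>2) < 1" .
qed

lemma polyball_scaleR:
  assumes "z \<in> polyball m n" "0 \<le> t" "t \<le> 1"
  shows "t *\<^sub>R z \<in> polyball m n"
  using polyball_cscale[OF assms(1), of "complex_of_real t"] assms by (simp add: cscale_of_real)

lemma sum_coord_le_norm: fixes k :: nat shows "(\<Sum>j<k. (cmod (coord z (i, j)))\<^sup>2) \<le> (norm z)\<^sup>2"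
proof -
  have "(\<Sum>p\<in>Pair i ` {..<k}. (cmod (coord z p))\<^sup>2) \<le> (norm z)\<^sup>2"
    unfolding norm_ell2_sq by (rule finite_sum_le_infsum) (auto simp: coord_summable)
  then show ?thesis by (subst (asm) sum.reindex) (auto simp: inj_on_def)
qed

context free_prod
begin

lemma rho_scaleR: "z \<in> polyball m n \<Longrightarrow> A \<in> \<A> \<Longrightarrow> \<rho> z (t *\<^sub>R A) = of_real t * \<rho> z A"
  by (simp add: scaleR_op rho_simps)

lemma rho_gamma:
  assumes z: "z \<in> polyball m n" and t: "0 \<le> t" "t \<le> 1" and A: "A \<in> \<A>"
  shows "\<rho> z (\<gamma> t A) = \<rho> (t *\<^sub>R z) A"
  by (rule rho_compose_apply[OF gamma_hom[OF t] gamma_image[OF t] z polyball_scaleR[OF z t] _ A])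
     (simp add: gamma_s[OF t] rho_scaleR rho_s z)

text \<open>Characters are contractive and turn the dilation of \<open>A\<close> into the dilation
  of the point. Hence \<open>\<rho> z (\<Phi> 1 A)\<close> is the derivative at 0 in direction
  \<open>z\<close>.\<close>

lemma rho_first_order:
  assumes z: "z \<in> polyball m n" and t: "0 \<le> t" "t \<le> 1 / 2" and A: "A \<in> \<A>"
  shows "cmod (\<rho> (t *\<^sub>R z) A - \<rho> 0 A - of_real t * \<rho> z (\<Phi> 1 A)) \<le> 2 * t\<^sup>2 * norm A"
proof -
  have t1: "t \<le> 1" using t by simp
  have gA: "\<gamma> t A \<in> \<A>" using gamma_image[OF t(1) t1] A by auto
  have "\<rho> z (\<gamma> t A - \<Phi> 0 A - t *\<^sub>R \<Phi> 1 A) = \<rho> (t *\<^sub>R z) A - \<rho> 0 A - of_real t * \<rho> z (\<Phi> 1 A)"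
    using gA A t t1 by (simp add: rho_simps z rho_gamma rho_scaleR Phi_0)
  moreover have "cmod (\<rho> z (\<gamma> t A - \<Phi> 0 A - t *\<^sub>R \<Phi> 1 A)) \<le> norm (\<gamma> t A - \<Phi> 0 A - t *\<^sub>R \<Phi> 1 A)"
    by (rule rho_simps[OF z]) (use gA A in auto)
  moreover note gamma_first_order[OF t A]
  ultimately show ?thesis by simp
qed

lemma half_basis_in_polyball: "p \<in> I \<Longrightarrow> (1 / 2) *\<^sub>C basis_vec p \<in> polyball m n"
proof -
  assume p: "p \<in> I"
  have "(\<Sum>j<n i. (cmod (coord ((1 / 2) *\<^sub>C basis_vec p) (i, j)))\<^sup>2) < 1" for i
    using sum_coord_le_norm[of "(1 / 2) *\<^sub>C basis_vec p" i "n i"]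
    by (simp only: norm_cscale norm_basis_vec) (simp add: norm_divide power2_eq_square)
  then show ?thesis using p by (auto simp: polyball_def coord_basis_vec)
qed

text \<open>The coefficient of the generator \<open>sg p\<close> in the linear part of
  \<open>A\<close>. The vector \<open>basis_vec p\<close> lies on the boundary of the polyball, so
  its half is used for the evaluation and the value doubled.\<close>

definition \<delta> :: "'a op \<Rightarrow> nat \<times> nat \<Rightarrow> complex"
  where "\<delta> A p = 2 * \<rho> ((1 / 2) *\<^sub>C basis_vec p) (\<Phi> 1 A)"

lemma Phi_1_mult:
  assumes "A \<in> \<A>" "B \<in> \<A>"
  shows "\<Phi> 1 (A o\<^sub>L B) = (\<Phi> 1 A o\<^sub>L scalar_op (\<rho> 0 B)) + (scalar_op (\<rho> 0 A) o\<^sub>L \<Phi> 1 B)"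
  using assms by (simp add: Phi_mult Phi_0)

text \<open>In degree 1 the product formula is the Leibniz rule at 0, which the coefficients obey
  too. There are finitely many generators, so linear combinations of them pass to limits
  coefficientwise.\<close>

lemma Phi_1_apply:
  assumes "A \<in> \<A>"
  shows "\<Phi> 1 A x = (\<Sum>p\<in>I. \<delta> A p *\<^sub>C sg p x)"
  using assms
proof (induction rule: dense_induct)
  case (gen i j)
  have "\<delta> (s i j) p = (if p = (i, j) then 1 else 0)" if "p \<in> I" for p
    using half_basis_in_polyball[OF that] gen by (simp add: \<delta>_def Phi_s rho_s coord_basis_vec)
  then have "(\<Sum>p\<in>I. \<delta> (s i j) p *\<^sub>C sg p x) = (\<Sum>p\<in>I. if p = (i, j) then s i j x else 0)"
    by (intro sum.cong) auto
  then show ?case using gen by (simp add: Phi_s)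
next
  case (scalar c)
  have "\<delta> (scalar_op c) p = 0" if "p \<in> I" for p
    using half_basis_in_polyball[OF that] by (simp add: \<delta>_def Phi_scalar rho_simps)
  then show ?case by (simp add: Phi_scalar)
next
  case (add A B)
  have "\<delta> (A + B) p = \<delta> A p + \<delta> B p" if "p \<in> I" for p
    using half_basis_in_polyball[OF that] add by (simp add: \<delta>_def Phi_add rho_simps ring_distribs)
  then show ?case
    using add by (simp add: Phi_add blinfun.add_left cscale_add_left sum.distrib)
next
  case (mult A B)
  have "\<delta> (A o\<^sub>L B) p = \<rho> 0 B * \<delta> A p + \<rho> 0 A * \<delta> B p" if "p \<in> I" for p
    using half_basis_in_polyball[OF that] mult
    by (simp add: \<delta>_def Phi_1_mult[simplified] rho_simps ring_distribs)
  then have "(\<Sum>p\<in>I. \<delta> (A o\<^sub>L B) p *\<^sub>C sg p x) =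
    \<rho> 0 B *\<^sub>C (\<Sum>p\<in>I. \<delta> A p *\<^sub>C sg p x) + \<rho> 0 A *\<^sub>C (\<Sum>p\<in>I. \<delta> B p *\<^sub>C sg p x)"
    by (simp add: cscale_add_left sum.distrib cscale_sum)
  then show ?case
    using mult A_bounded_ops[OF Phi_in[OF mult(1), of 1]]
    by (simp only: Phi_1_mult) (simp add: blinfun.add_left blinfun_cscale)
next
  case (lim X A)
  have "(\<lambda>k. \<Phi> 1 (X k) x) \<longlonglongrightarrow> \<Phi> 1 A x"
    by (rule bounded_linear.tendsto[OF blinfun.bounded_linear_left Phi_tendsto[OF lim(1-3)]])
  moreover have "(\<lambda>k. \<delta> (X k) p) \<longlonglongrightarrow> \<delta> A p" if "p \<in> I" for p
    unfolding \<delta>_def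
    by (intro tendsto_mult tendsto_const rho_tendsto[OF half_basis_in_polyball[OF that]]
        Phi_tendsto[OF lim(1-3)] Phi_in lim)
  then have "(\<lambda>k. \<Sum>p\<in>I. \<delta> (X k) p *\<^sub>C sg p x) \<longlonglongrightarrow> (\<Sum>p\<in>I. \<delta> A p *\<^sub>C sg p x)"
    by (intro tendsto_sum tendsto_cscale tendsto_const)
  ultimately show ?case unfolding lim(4) by (rule LIMSEQ_unique)
qed

lemma Phi_1_eq: "A \<in> \<A> \<Longrightarrow> \<Phi> 1 A = (\<Sum>p\<in>I. scalar_op (\<delta> A p) o\<^sub>L sg p)"
  by (rule blinfun_eqI) (simp only: Phi_1_apply blinfun.sum_left blinfun_apply_blinfun_compose scalar_op_apply)

lemma rho_Phi_1:
  assumes "z \<in> polyball m n" "A \<in> \<A>"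
  shows "\<rho> z (\<Phi> 1 A) = (\<Sum>p\<in>I. \<delta> A p * coord z p)"
proof -
  have "\<rho> z (\<Phi> 1 A) = (\<Sum>p\<in>I. \<rho> z (scalar_op (\<delta> A p) o\<^sub>L sg p))"
    unfolding Phi_1_eq[OF assms(2)] by (rule rho_sum[OF assms(1)]) auto
  also have "\<dots> = (\<Sum>p\<in>I. \<delta> A p * coord z p)"
    by (rule sum.cong) (auto simp: rho_simps rho_s assms)
  finally show ?thesis .
qed

lemma rho_has_derivative_0:
  assumes A: "A \<in> \<A>"
  shows "((\<lambda>w. \<rho> w A) has_derivative (\<lambda>v. \<Sum>p\<in>I. \<delta> A p * coord v p)) (at 0 within polyball m n)"
  unfolding has_derivative_within_alt
proof (intro conjI allI impI)
  show "bounded_linear (\<lambda>v. \<Sum>p\<in>I. \<delta> A p * coord v p)"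
    by (intro bounded_linear_sum bounded_linear_const_mult bounded_linear_coord)
  fix e :: real assume e: "e > 0"
  \<comment> \<open>The bound 1/4 keeps \<open>t = 2 * norm w\<close> within 1/2. The 8 arises when
    this \<open>t\<close> is inserted into the error \<open>2 * t\<^sup>2 * norm A\<close>; adding 1
    avoids a zero denominator.\<close>
  define d where "d = min (1 / 4) (e / (8 * (norm A + 1)))"
  have d: "d > 0" "d \<le> 1 / 4" "8 * (norm A + 1) * d \<le> e"
  proof -
    show "d > 0" using e by (auto simp: d_def intro!: divide_pos_pos add_nonneg_pos)
    show "d \<le> 1 / 4" unfolding d_def by (rule min.cobounded1)
    have p: "8 * (norm A + 1) > 0" by (simp add: add_nonneg_pos)
    have "d \<le> e / (8 * (norm A + 1))" by (simp add: d_def)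
    then show "8 * (norm A + 1) * d \<le> e" using p by (simp add: pos_le_divide_eq mult.commute)
  qed
  have "cmod (\<rho> w A - \<rho> 0 A - (\<Sum>p\<in>I. \<delta> A p * coord (w - 0) p)) \<le> e * norm (w - 0)"
    if w: "w \<in> polyball m n" "norm (w - 0) < d" for w
  proof (cases "w = 0")
    case False
    \<comment> \<open>With this scaling \<open>z\<close> has norm 1/2, which places it inside the
      polyball whatever its direction.\<close>
    define t where "t = 2 * norm w"
    define z where "z = (1 / t) *\<^sub>R w"
    have t: "t > 0" "t \<le> 1 / 2" using w False d by (auto simp: t_def)
    have wz: "w = t *\<^sub>R z" using t by (simp add: z_def)
    have nz: "norm z = 1 / 2" using False by (simp add: z_def t_def)
    have z: "z \<in> polyball m n"
      unfolding polyball_def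
    proof (intro CollectI conjI allI impI)
      show "coord z (i, j) = 0" if "\<not> (i < m \<and> j < n i)" for i j
        using polyballD(1)[OF w(1) that] by (simp add: z_def)
      show "(\<Sum>j<n i. (cmod (coord z (i, j)))\<^sup>2) < 1" for i
        using sum_coord_le_norm[of z i "n i"] by (simp add: nz power2_eq_square)
    qed
    have "of_real t * \<rho> z (\<Phi> 1 A) = (\<Sum>p\<in>I. \<delta> A p * coord w p)"
      unfolding rho_Phi_1[OF z A] wz by (simp add: sum_distrib_left mult_ac)
    then have "cmod (\<rho> w A - \<rho> 0 A - (\<Sum>p\<in>I. \<delta> A p * coord w p)) \<le> 2 * t\<^sup>2 * norm A"
      using rho_first_order[OF z less_imp_le[OF t(1)] t(2) A] wz by simp
    also have "\<dots> = 8 * norm A * norm w * norm w" by (simp add: t_def power2_eq_square)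
    also have "\<dots> \<le> 8 * (norm A + 1) * d * norm w"
      using w d(1) by (intro mult_mono) (auto intro!: mult_nonneg_nonneg add_nonneg_nonneg)
    also have "\<dots> \<le> e * norm w" using d by (intro mult_right_mono) auto
    finally show ?thesis by simp
  qed simp
  then show "\<exists>d>0. \<forall>y\<in>polyball m n. norm (y - 0) < d \<longrightarrow>
      norm (\<rho> y A - \<rho> 0 A - (\<Sum>p\<in>I. \<delta> A p * coord (y - 0) p)) \<le> e * norm (y - 0)"
    using d(1) by blast
qed

text \<open>Values of characters see only the commutative part of \<open>B\<close>, but in degrees 0
  and 1 this is everything: the linear part is determined by its coefficients. This supplies the
  hypotheses of \<open>endomorphism_eq_id\<close>.\<close>

lemma Phi_1_of_rho:
  assumes B: "B \<in> \<A>" and p: "i < m" "j < n i"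
    and eq: "\<And>z. z \<in> polyball m n \<Longrightarrow> \<rho> z B = coord z (i, j)"
  shows "\<Phi> 0 B = 0" and "\<Phi> 1 B = s i j"
proof -
  have 0: "\<rho> 0 B = 0" using eq[of 0] by simp
  then show "\<Phi> 0 B = 0" using B by (simp add: Phi_0 blinfun_eqI)
  have r: "\<rho> z (\<Phi> 1 B) = coord z (i, j)" if z: "z \<in> polyball m n" for z
  proof -
    have "cmod (coord z (i, j) - \<rho> z (\<Phi> 1 B)) \<le> 0 + e" if e: "e > 0" for e
    proof -
      \<comment> \<open>After division by \<open>t\<close> the quadratic error of
        \<open>rho_first_order\<close> is at most \<open>2 * norm B * t\<close>; this
        \<open>t\<close> makes it smaller than \<open>e\<close>.\<close>
      define t where "t = min (1 / 2) (e / (2 * (norm B + 1)))"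
      have pos: "2 * (norm B + 1) > 0" by (simp add: add_nonneg_pos)
      have t: "t > 0" "t \<le> 1 / 2" "2 * (norm B + 1) * t \<le> e"
      proof -
        show "t > 0" using e pos by (auto simp: t_def)
        show "t \<le> 1 / 2" unfolding t_def by (rule min.cobounded1)
        have "t \<le> e / (2 * (norm B + 1))" by (simp add: t_def)
        then show "2 * (norm B + 1) * t \<le> e" using pos by (simp add: pos_le_divide_eq mult.commute)
      qed
      have "t *\<^sub>R z \<in> polyball m n" by (rule polyball_scaleR[OF z]) (use t in auto)
      then have "of_real t * (coord z (i, j) - \<rho> z (\<Phi> 1 B)) =
        \<rho> (t *\<^sub>R z) B - \<rho> 0 B - of_real t * \<rho> z (\<Phi> 1 B)"
        by (simp add: eq 0 ring_distribs)
      then have "t * cmod (coord z (i, j) - \<rho> z (\<Phi> 1 B)) =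
        cmod (\<rho> (t *\<^sub>R z) B - \<rho> 0 B - of_real t * \<rho> z (\<Phi> 1 B))"
        using t by (metis abs_of_pos norm_mult norm_of_real)
      also have "\<dots> \<le> 2 * t\<^sup>2 * norm B" by (rule rho_first_order[OF z _ t(2) B]) (use t in simp)
      finally have "cmod (coord z (i, j) - \<rho> z (\<Phi> 1 B)) \<le> 2 * norm B * t"
        using t by (simp add: power2_eq_square mult_ac)
      also have "\<dots> \<le> 2 * (norm B + 1) * t" using t by (intro mult_right_mono) auto
      finally show ?thesis using t by simp
    qed
    then have "cmod (coord z (i, j) - \<rho> z (\<Phi> 1 B)) \<le> 0" by (rule field_le_epsilon)
    then show ?thesis by simp
  qed
  have "\<delta> B p = (if p = (i, j) then 1 else 0)" if "p \<in> I" for p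
    using r[OF half_basis_in_polyball[OF that]] by (auto simp: \<delta>_def coord_basis_vec mult.commute)
  then have "\<Phi> 1 B x = (\<Sum>p\<in>I. if p = (i, j) then s i j x else 0)" for x
    unfolding Phi_1_apply[OF B] by (intro sum.cong) auto
  then show "\<Phi> 1 B = s i j" using p by (intro blinfun_eqI) simp
qed

text \<open>
  Iterating an endomorphism \<open>s\<^sub>i\<^sub>j \<mapsto> s\<^sub>i\<^sub>j + P\<^sub>i\<^sub>j + \<dots>\<close>, with \<open>P\<^sub>i\<^sub>j\<close> of degree \<open>k\<close> and the dots of higher
  degree, multiplies \<open>P\<^sub>i\<^sub>j\<close> by the number of iterations, while the homogeneous components stay bounded.
\<close>

lemma endomorphism_eq_id:
  assumes \<phi>: "cc_hom \<A> \<phi>" "\<phi> ` \<A> \<subseteq> \<A>"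
    and \<phi>0: "\<And>i j. i < m \<Longrightarrow> j < n i \<Longrightarrow> \<Phi> 0 (\<phi> (s i j)) = 0"
    and \<phi>1: "\<And>i j. i < m \<Longrightarrow> j < n i \<Longrightarrow> \<Phi> 1 (\<phi> (s i j)) = s i j"
    and A: "A \<in> \<A>"
  shows "\<phi> A = A"
proof -
  have \<phi>A [simp]: "\<phi> A \<in> \<A>" if "A \<in> \<A>" for A using that \<phi> by auto
  have high: "\<forall>i<m. \<forall>j<n i. \<Phi> k (\<phi> (s i j)) = 0" if "k \<ge> 2" for k
    using that
  proof (induction k rule: less_induct)
    case (less k)
    \<comment> \<open>By the outer induction \<open>\<phi>\<close> changes generators only in
      degrees at least \<open>k\<close>. In a word of two or more letters such a change reaches only
      degrees above \<open>k\<close>, because the images of the other letters have no constant term.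
      The correction in degree \<open>k\<close> thus comes from the linear part alone.\<close>
    have step: "(\<forall>l<k. \<Phi> l (\<phi> A) = \<Phi> l A) \<and> \<Phi> k (\<phi> A) = \<Phi> k A + \<Phi> k (\<phi> (\<Phi> 1 A))"
      if "A \<in> \<A>" for A
      using that
    proof (induction rule: dense_induct)
      case (gen i j)
      have "\<Phi> l (\<phi> (s i j)) = \<Phi> l (s i j)" if "l < k" for l
      proof -
        consider "l = 0" | "l = 1" | "l \<ge> 2" by linarith
        then show ?thesis
          by cases (use gen \<phi>0 \<phi>1 less that in \<open>auto simp: Phi_s\<close>)
      qed
      then show ?case using gen less.prems by (simp add: Phi_s)
    next
      case (scalar c)
      then show ?case using less.prems by (simp add: cc_hom_simps[OF \<phi>(1)] Phi_scalar Phi_zero)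
    next
      case (add A B)
      then show ?case by (simp add: cc_hom_simps[OF \<phi>(1)] Phi_add)
    next
      case (mult A B)
      have lo: "\<Phi> l (\<phi> A) = \<Phi> l A" "\<Phi> l (\<phi> B) = \<Phi> l B" if "l < k" for l
        using mult that by auto
      have "\<Phi> l (\<phi> (A o\<^sub>L B)) = \<Phi> l (A o\<^sub>L B)" if "l < k" for l
        using mult(1,2) that by (simp add: cc_hom_simps[OF \<phi>(1)] Phi_mult lo)
      moreover have "\<Phi> k (\<phi> (A o\<^sub>L B)) = \<Phi> k (A o\<^sub>L B) + \<Phi> k (\<phi> (\<Phi> 1 (A o\<^sub>L B)))"
      proof -
        obtain k' where k': "k = Suc (Suc k')" using less.prems by (metis add_2_eq_Suc le_Suc_ex)
        \<comment> \<open>Only the two end terms of the convolution contain a component of degree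
          \<open>k\<close>; in the middle both degrees are below \<open>k\<close>, where
          \<open>\<phi>\<close> acts trivially. As \<open>k \<ge> 2\<close>, the ends are distinct
          and degree 1 is among the trivial ones.\<close>
        have split: "(\<Sum>j\<le>k. f j) = f 0 + (\<Sum>j\<le>k'. f (Suc j)) + f k" for f :: "nat \<Rightarrow> 'a op"
          unfolding k' by (simp only: sum.atMost_Suc[of _ "Suc k'"] sum.atMost_Suc_shift[of _ k'])
        have 0: "\<Phi> 0 (\<phi> A) = scalar_op (\<rho> 0 A)" "\<Phi> 0 (\<phi> B) = scalar_op (\<rho> 0 B)"
          using lo[of 0] less.prems mult(1,2) by (simp_all add: Phi_0)
        have mid: "(\<Sum>j\<le>k'. \<Phi> (k - Suc j) (\<phi> A) o\<^sub>L \<Phi> (Suc j) (\<phi> B)) =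
            (\<Sum>j\<le>k'. \<Phi> (k - Suc j) A o\<^sub>L \<Phi> (Suc j) B)"
          by (rule sum.cong) (auto simp: lo k')
        have E: "\<Phi> k (\<phi> (\<Phi> 1 (A o\<^sub>L B))) = (\<Phi> k (\<phi> (\<Phi> 1 A)) o\<^sub>L scalar_op (\<rho> 0 B)) +
            (scalar_op (\<rho> 0 A) o\<^sub>L \<Phi> k (\<phi> (\<Phi> 1 B)))"
          using mult(1,2)
          by (simp only: Phi_1_mult) (simp add: cc_hom_simps[OF \<phi>(1)] Phi_add Phi_scalar_mult)
        have kA: "\<Phi> k (\<phi> A) = \<Phi> k A + \<Phi> k (\<phi> (\<Phi> 1 A))"
          and kB: "\<Phi> k (\<phi> B) = \<Phi> k B + \<Phi> k (\<phi> (\<Phi> 1 B))"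
          using mult by auto
        have "\<Phi> k (\<phi> (A o\<^sub>L B)) = (\<Phi> k (\<phi> A) o\<^sub>L scalar_op (\<rho> 0 B)) +
            (\<Sum>j\<le>k'. \<Phi> (k - Suc j) A o\<^sub>L \<Phi> (Suc j) B) + (scalar_op (\<rho> 0 A) o\<^sub>L \<Phi> k (\<phi> B))"
          using mult(1,2) by (simp only: cc_hom_simps[OF \<phi>(1)] Phi_mult \<phi>A split mid) (simp add: 0)
        moreover have "\<Phi> k (A o\<^sub>L B) = (\<Phi> k A o\<^sub>L scalar_op (\<rho> 0 B)) +
            (\<Sum>j\<le>k'. \<Phi> (k - Suc j) A o\<^sub>L \<Phi> (Suc j) B) + (scalar_op (\<rho> 0 A) o\<^sub>L \<Phi> k B)"
          using mult(1,2) by (simp only: Phi_mult split) (simp add: Phi_0)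
        ultimately show ?thesis
          unfolding E kA kB
          by (intro blinfun_eqI) (simp add: blinfun.add_left blinfun.add_right cscale_add)
      qed
      ultimately show ?case by blast
    next
      case (lim X A)
      have l: "(\<lambda>N. \<Phi> l (X N)) \<longlonglongrightarrow> \<Phi> l A" "(\<lambda>N. \<Phi> l (\<phi> (X N))) \<longlonglongrightarrow> \<Phi> l (\<phi> A)"
        "(\<lambda>N. \<Phi> k (\<phi> (\<Phi> 1 (X N)))) \<longlonglongrightarrow> \<Phi> k (\<phi> (\<Phi> 1 A))" for l
        by (intro Phi_tendsto cc_hom_tendsto[OF \<phi>(1)] \<phi>A Phi_in lim)+
      have "\<Phi> l (\<phi> A) = \<Phi> l A" if "l < k" for l
        using l(1,2)[of l] lim(4) that by (auto intro: LIMSEQ_unique)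
      moreover have "(\<lambda>N. \<Phi> k (\<phi> (X N))) \<longlonglongrightarrow> \<Phi> k A + \<Phi> k (\<phi> (\<Phi> 1 A))"
        using tendsto_add[OF l(1)[of k] l(3)] lim(4) by simp
      then have "\<Phi> k (\<phi> A) = \<Phi> k A + \<Phi> k (\<phi> (\<Phi> 1 A))" by (rule LIMSEQ_unique[OF l(2)])
      ultimately show ?case by blast
    qed
    show ?case
    proof (intro allI impI)
      fix i j assume ij: "i < m" "j < n i"
      define P where "P = \<Phi> k (\<phi> (s i j))"
      \<comment> \<open>The linear part of each iterate is still \<open>s i j\<close>, so
        \<open>step\<close> adds the same \<open>P\<close> every time.\<close>
      have it: "(\<phi> ^^ N) (s i j) \<in> \<A> \<and> norm ((\<phi> ^^ N) (s i j)) \<le> 1 \<and> \<Phi> 1 ((\<phi> ^^ N) (s i j)) = s i j \<and>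
          \<Phi> k ((\<phi> ^^ N) (s i j)) = real N *\<^sub>R P" for N
      proof (induction N)
        case 0
        then show ?case using ij less.prems norm_s_le by (simp add: Phi_s)
      next
        case (Suc N)
        let ?B = "(\<phi> ^^ N) (s i j)"
        have "norm (\<phi> ?B) \<le> 1" using cc_hom_simps(7)[OF \<phi>(1), of ?B] Suc by simp
        then show ?case
          using step[of ?B] Suc less.prems by (simp add: P_def[symmetric] scaleR_left_distrib)
      qed
      have "real N * norm P \<le> 1" for N
        using norm_Phi_le[of "(\<phi> ^^ N) (s i j)" k] it[of N] by simp
      then have "norm P = 0"
        by (metis mult.commute norm_ge_zero not_le order_le_less reals_Archimedean3)
      then show "\<Phi> k (\<phi> (s i j)) = 0" by (simp add: P_def)
    qed
  qed
  have gens: "\<phi> (s i j) = s i j" if ij: "i < m" "j < n i" for i j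
  proof (rule Phi_eqI)
    fix k :: nat
    consider "k = 0" | "k = 1" | "k \<ge> 2" by linarith
    then show "\<Phi> k (\<phi> (s i j)) = \<Phi> k (s i j)"
      by cases (use ij \<phi>0 \<phi>1 high in \<open>auto simp: Phi_s\<close>)
  qed (use ij in auto)
  show ?thesis
    using A
  proof (induction rule: dense_induct)
    case (lim X A)
    then show ?case using LIMSEQ_unique[OF cc_hom_tendsto[OF \<phi>(1) lim(1-3)]] by simp
  qed (simp_all add: gens cc_hom_simps[OF \<phi>(1)])
qed

end

section \<open>Moebius transformations\<close>

text \<open>A total function, so that \<open>moebius\<close> can be written for arbitrary operators;
  where it is used, invertibility comes from the Neumann series.\<close>

definition inv_op :: "'a op \<Rightarrow> 'a op"
  where "inv_op B = (THE X. X o\<^sub>L B = id_blinfun \<and> B o\<^sub>L X = id_blinfun)"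

lemma inv_op_eqI:
  assumes "X o\<^sub>L B = id_blinfun" "B o\<^sub>L X = id_blinfun"
  shows "inv_op B = X"
  unfolding inv_op_def
proof (rule the_equality)
  show "X o\<^sub>L B = id_blinfun \<and> B o\<^sub>L X = id_blinfun" using assms by simp
  show "Y = X" if Y: "Y o\<^sub>L B = id_blinfun \<and> B o\<^sub>L Y = id_blinfun" for Y
  proof -
    have "Y o\<^sub>L (B o\<^sub>L X) = (Y o\<^sub>L B) o\<^sub>L X" by (rule blinfun_eqI) simp
    then show ?thesis using assms Y by (simp add: op_compose_id) (metis blinfun_apply_blinfun_compose blinfun_eqI id_blinfun.rep_eq)
  qed
qed

text \<open>The operator counterpart of the inner product \<langle>z, a\<rangle>, linear in
  \<open>T\<close> and conjugate linear in \<open>a\<close>.\<close>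

definition lin_comb :: "nat \<Rightarrow> (nat \<Rightarrow> complex) \<Rightarrow> (nat \<Rightarrow> 'a op) \<Rightarrow> 'a op"
  where "lin_comb k a T = (\<Sum>j<k. scalar_op (cnj (a j)) o\<^sub>L T j)"

definition defect :: "nat \<Rightarrow> (nat \<Rightarrow> complex) \<Rightarrow> real"
  where "defect k a = sqrt (1 - (\<Sum>j<k. (cmod (a j))\<^sup>2))"

text \<open>
  The noncommutative version of
  \<open>z \<mapsto> (a (1 + \<langle>z, a\<rangle> / (1 + c)) + c z) / (1 + \<langle>z, a\<rangle>)\<close> with \<open>c\<^sup>2 = 1 - |a|\<^sup>2\<close>, which is the automorphism
  of the ball mapping \<open>0\<close> to \<open>a\<close>.
\<close>

definition moebius :: "nat \<Rightarrow> (nat \<Rightarrow> complex) \<Rightarrow> (nat \<Rightarrow> 'a op) \<Rightarrow> nat \<Rightarrow> 'a op"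
  where "moebius k a T j = inv_op (id_blinfun + lin_comb k a T) o\<^sub>L
    ((scalar_op (a j) o\<^sub>L (id_blinfun + (scalar_op (1 / (1 + defect k a)) o\<^sub>L lin_comb k a T))) +
     (scalar_op (defect k a) o\<^sub>L T j))"

lemma defect:
  assumes "(\<Sum>j<k. (cmod (a j))\<^sup>2) < 1"
  shows "defect k a > 0" "(defect k a)\<^sup>2 = 1 - (\<Sum>j<k. (cmod (a j))\<^sup>2)"
  using assms by (simp_all add: defect_def)

lemma adjoint_ident [simp]: "adjoint (\<lambda>x :: 'a ell2. x) y = y"
  using adjoint_simps(4)[of y] by simp

text \<open>With \<open>y = adjoint X x\<close>, the defect of the transformed row at
  \<open>x\<close> equals \<open>c\<^sup>2\<close> times the defect of \<open>T\<close> at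
  \<open>y\<close>, the operator form of the classical formula for one minus the squared norm of a
  Moebius image. Nonnegativity therefore carries over.\<close>

lemma row_contraction_moebius:
  fixes T :: "nat \<Rightarrow> 'a op"
  assumes T: "row_contraction k T" and a: "(\<Sum>j<k. (cmod (a j))\<^sup>2) < 1"
    and X: "inv_op (id_blinfun + lin_comb k a T) \<in> bounded_ops"
      "inv_op (id_blinfun + lin_comb k a T) o\<^sub>L (id_blinfun + lin_comb k a T) = id_blinfun"
  shows "row_contraction k (moebius k a T)"
  unfolding row_contraction_adjoint
proof (intro conjI allI impI)
  define S where "S = lin_comb k a T"
  define X where "X = inv_op (id_blinfun + S)"
  define c where "c = defect k a"
  define \<kappa> where "\<kappa> = 1 / (1 + c)"
  note c = defect[OF a, folded c_def]
  have Tb: "T j \<in> bounded_ops" if "j < k" for j using T that by (simp add: row_contraction_def)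
  have Sb: "S \<in> bounded_ops"
  proof -
    have "(\<Sum>j<l. scalar_op (cnj (a j)) o\<^sub>L T j) \<in> bounded_ops" if "l \<le> k" for l
      using that by (induction l) (auto intro!: bounded_ops_intros Tb)
    then show ?thesis by (simp add: S_def lin_comb_def)
  qed
  have M: "moebius k a T j = X o\<^sub>L ((scalar_op (a j) o\<^sub>L (id_blinfun + (scalar_op (complex_of_real \<kappa>) o\<^sub>L S))) +
      (scalar_op (complex_of_real c) o\<^sub>L T j))" for j
    by (simp add: moebius_def X_def S_def c_def \<kappa>_def)
  show "moebius k a T j \<in> bounded_ops" if "j < k" for j
    unfolding M X_def by (intro bounded_ops_intros Sb Tb that) (use X in \<open>simp add: S_def\<close>)
  fix x
  \<comment> \<open>This substitution removes the inverse: taking adjoints in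
    \<open>X o\<^sub>L (id_blinfun + S) = id_blinfun\<close> gives \<open>x = y + w\<close>.\<close>
  define y where "y = adjoint X x"
  define w where "w = adjoint S y"
  define u where "u = y + \<kappa> *\<^sub>R w"
  have "adjoint (blinfun_apply (X o\<^sub>L (id_blinfun + S))) x = x"
    unfolding X_def S_def X(2) by (rule adjoint_simps)
  then have "y + w = x" by (simp only: adjoint_simps y_def w_def)
  then have x: "x = y + w" by simp
  have wsum: "w = (\<Sum>j<k. a j *\<^sub>C adjoint (T j) y)"
    unfolding w_def S_def lin_comb_def adjoint_sum
    by (rule sum.cong) (auto simp: adjoint_simps Tb)
  have M_adj: "adjoint (moebius k a T j) x = cnj (a j) *\<^sub>C u + c *\<^sub>R adjoint (T j) y" if "j < k" for j
    unfolding M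
    by (simp add: adjoint_simps Tb that Sb y_def[symmetric] w_def[symmetric] u_def cscale_of_real
        adjoint_simps(7)[OF Sb] cscale_add cscale_scaleR mult.commute)
      (simp add: cscale_of_real[symmetric] adjoint_simps(7)[OF Sb] adjoint_simps(7)[OF Tb[OF that]] w_def mult.commute)
  have "(\<Sum>j<k. (norm (adjoint (moebius k a T j) x))\<^sup>2) =
    (\<Sum>j<k. (cmod (a j))\<^sup>2 * (norm u)\<^sup>2 + 2 * c * (u \<bullet> (a j *\<^sub>C adjoint (T j) y)) + c\<^sup>2 * (norm (adjoint (T j) y))\<^sup>2)"
  proof (rule sum.cong)
    fix j assume "j \<in> {..<k}"
    then show "(norm (adjoint (moebius k a T j) x))\<^sup>2 = (cmod (a j))\<^sup>2 * (norm u)\<^sup>2 +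
        2 * c * (u \<bullet> (a j *\<^sub>C adjoint (T j) y)) + c\<^sup>2 * (norm (adjoint (T j) y))\<^sup>2"
      using dot_norm[of "cnj (a j) *\<^sub>C u" "c *\<^sub>R adjoint (T j) y"]
      by (simp add: M_adj inner_cscale_left norm_cscale power_mult_distrib field_simps)
  qed simp
  also have "\<dots> = (1 - c\<^sup>2) * (norm u)\<^sup>2 + 2 * c * (u \<bullet> w) + c\<^sup>2 * (\<Sum>j<k. (norm (adjoint (T j) y))\<^sup>2)"
    by (simp add: sum.distrib sum_distrib_left[symmetric] sum_distrib_right[symmetric] wsum inner_sum_right c)
  also have "\<dots> \<le> (1 - c\<^sup>2) * (norm u)\<^sup>2 + 2 * c * (u \<bullet> w) + c\<^sup>2 * (norm y)\<^sup>2"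
    using T by (intro add_left_mono mult_left_mono) (auto simp: row_contraction_adjoint)
  also have "\<dots> = (norm x)\<^sup>2"
  proof -
    \<comment> \<open>The choice of \<open>\<kappa>\<close> is what makes the coefficients of
      \<open>y \<bullet> w\<close> and of the square of \<open>norm w\<close> agree with those of
      the expanded square of \<open>norm (y + w)\<close>.\<close>
    have k1: "\<kappa> * (1 + c) = 1" using c(1) by (simp add: \<kappa>_def)
    have u2: "(norm u)\<^sup>2 = (norm y)\<^sup>2 + 2 * \<kappa> * (y \<bullet> w) + \<kappa>\<^sup>2 * (norm w)\<^sup>2"
      unfolding u_def power2_norm_eq_inner
      by (simp add: inner_add_left inner_add_right inner_commute[of w y] power2_eq_square algebra_simps)
    have uw: "u \<bullet> w = y \<bullet> w + \<kappa> * (norm w)\<^sup>2"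
      unfolding u_def power2_norm_eq_inner by (simp add: inner_add_left)
    have x2: "(norm x)\<^sup>2 = (norm y)\<^sup>2 + 2 * (y \<bullet> w) + (norm w)\<^sup>2"
      unfolding x power2_norm_eq_inner
      by (simp add: inner_add_left inner_add_right inner_commute[of w y])
    have "(1 - c\<^sup>2) * \<kappa> + c = \<kappa> * (1 + c) * (1 - c) + c" by algebra
    then have e1: "(1 - c\<^sup>2) * \<kappa> + c = 1" using k1 by simp
    have "(1 - c\<^sup>2) * \<kappa>\<^sup>2 + 2 * c * \<kappa> = \<kappa> * (\<kappa> * (1 + c) * (1 - c) + 2 * c)" by algebra
    also have "\<dots> = 1" using k1 by (simp add: algebra_simps)
    finally have e2: "(1 - c\<^sup>2) * \<kappa>\<^sup>2 + 2 * c * \<kappa> = 1" .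
    have "(1 - c\<^sup>2) * (norm u)\<^sup>2 + 2 * c * (u \<bullet> w) + c\<^sup>2 * (norm y)\<^sup>2 = (norm y)\<^sup>2 +
      2 * ((1 - c\<^sup>2) * \<kappa> + c) * (y \<bullet> w) + ((1 - c\<^sup>2) * \<kappa>\<^sup>2 + 2 * c * \<kappa>) * (norm w)\<^sup>2"
      unfolding u2 uw by (simp add: algebra_simps)
    then show ?thesis unfolding e1 e2 x2 by simp
  qed
  finally show "(\<Sum>j<k. (norm (adjoint (moebius k a T j) x))\<^sup>2) \<le> (norm x)\<^sup>2" .
qed

text \<open>The linear combination \<open>S'\<close> formed from the transformed row satisfies
  \<open>id_blinfun + S' = c\<^sup>2 X\<close>. Its inverse is therefore
  \<open>id_blinfun + S\<close> divided by \<open>c\<^sup>2\<close>, and the rest is cancellation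
  using \<open>\<kappa> * (1 + c) = 1\<close>.\<close>

lemma moebius_inverse:
  fixes T :: "nat \<Rightarrow> 'a op"
  assumes T: "\<And>j. j < k \<Longrightarrow> T j \<in> bounded_ops" and a: "(\<Sum>j<k. (cmod (a j))\<^sup>2) < 1" and j: "j < k"
    and X: "inv_op (id_blinfun + lin_comb k a T) \<in> bounded_ops"
      "inv_op (id_blinfun + lin_comb k a T) o\<^sub>L (id_blinfun + lin_comb k a T) = id_blinfun"
      "(id_blinfun + lin_comb k a T) o\<^sub>L inv_op (id_blinfun + lin_comb k a T) = id_blinfun"
  shows "moebius k (\<lambda>j. - a j) (moebius k a T) j = T j"
proof -
  define S where "S = lin_comb k a T"
  define X where "X = inv_op (id_blinfun + S)"
  define c where "c = complex_of_real (defect k a)"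
  define \<kappa> where "\<kappa> = 1 / (1 + c)"
  have c: "c \<noteq> 0" "1 + c \<noteq> 0" "c\<^sup>2 = 1 - (\<Sum>j<k. cnj (a j) * a j)"
  proof -
    show "c \<noteq> 0" using defect[OF a] by (simp add: c_def)
    have "Re (1 + c) > 0" using defect[OF a] by (simp add: c_def)
    then show "1 + c \<noteq> 0" by (metis less_irrefl zero_complex.simps(1))
    have "c\<^sup>2 = complex_of_real ((defect k a)\<^sup>2)" by (simp add: c_def)
    also have "\<dots> = 1 - (\<Sum>j<k. cnj (a j) * a j)"
      unfolding defect(2)[OF a] by (simp add: complex_norm_square mult.commute del: of_real_power)
    finally show "c\<^sup>2 = 1 - (\<Sum>j<k. cnj (a j) * a j)" .
  qed
  have \<kappa>: "\<kappa> * (1 + c) = 1" using c by (simp add: \<kappa>_def)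
  have Sx: "S x = (\<Sum>j<k. cnj (a j) *\<^sub>C T j x)" for x
    by (simp add: S_def lin_comb_def blinfun.sum_left)
  have Sb: "S \<in> bounded_ops"
    unfolding bounded_ops_def by (auto simp: Sx blinfun_cscale T cscale_sum mult.commute intro!: sum.cong)
  have Xb: "X \<in> bounded_ops" using X(1) by (simp add: X_def S_def)
  have XS: "X (x + S x) = x" and SX: "X x + S (X x) = x" for x
    using arg_cong[OF X(2), of "\<lambda>A. blinfun_apply A x"] arg_cong[OF X(3), of "\<lambda>A. blinfun_apply A x"]
    by (simp_all add: X_def S_def blinfun.add_left)
  \<comment> \<open>The entries of \<open>T\<close> need not commute, but the inverse of
    \<open>id_blinfun + S\<close> commutes with \<open>S\<close>.\<close>
  have comm: "X (S x) = S (X x)" for x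
    using XS[of x] SX[of x] by (simp add: blinfun.add_right) (metis add_left_cancel)
  have d: "defect k (\<lambda>j. - a j) = defect k a" by (simp add: defect_def)
  define T' where "T' = moebius k a T"
  define S' where "S' = lin_comb k (\<lambda>j. - a j) T'"
  have T': "T' j x = X (a j *\<^sub>C (x + \<kappa> *\<^sub>C S x) + c *\<^sub>C T j x)" for j x
    by (simp add: T'_def moebius_def X_def S_def c_def \<kappa>_def blinfun.add_left cscale_add)
  have S': "S' x = c\<^sup>2 *\<^sub>C X x - x" for x
  proof -
    have "S' x = (\<Sum>j<k. - cnj (a j) *\<^sub>C T' j x)"
      by (simp add: S'_def lin_comb_def blinfun.sum_left)
    also have "\<dots> = (\<Sum>j<k. - X ((cnj (a j) * a j) *\<^sub>C (x + \<kappa> *\<^sub>C S x) + c *\<^sub>C cnj (a j) *\<^sub>C T j x))"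
      unfolding T' by (rule sum.cong) (auto simp: blinfun_cscale[OF Xb] blinfun.add_right cscale_add mult_ac)
    also have "\<dots> = - X ((1 - c\<^sup>2) *\<^sub>C (x + \<kappa> *\<^sub>C S x) + c *\<^sub>C S x)"
      by (simp only: sum_negf blinfun.sum_right[symmetric] sum.distrib sum_cscale_left[symmetric]
          cscale_sum[symmetric] Sx[symmetric] c(3)) simp
    also have "(1 - c\<^sup>2) *\<^sub>C (x + \<kappa> *\<^sub>C S x) + c *\<^sub>C S x = (x + S x) - c\<^sup>2 *\<^sub>C x"
    proof -
      have "(1 - c\<^sup>2) * \<kappa> + c = \<kappa> * (1 + c) * (1 - c) + c" by algebra
      then have "(1 - c\<^sup>2) * \<kappa> + c = 1" unfolding \<kappa> by simp
      then have "((1 - c\<^sup>2) * \<kappa> + c) *\<^sub>C S x = S x" by simp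
      then show ?thesis by (simp add: cscale_add cscale_add_left cscale_diff_left)
    qed
    also have "- X \<dots> = c\<^sup>2 *\<^sub>C X x - x"
      by (simp add: blinfun.diff_right XS blinfun_cscale[OF Xb])
    finally show ?thesis .
  qed
  have inv: "inv_op (id_blinfun + S') = scalar_op (1 / c\<^sup>2) o\<^sub>L (id_blinfun + S)"
    by (rule inv_op_eqI; rule blinfun_eqI)
       (use c(1) in \<open>simp_all add: S' blinfun.add_left blinfun.add_right SX XS[simplified blinfun.add_right] blinfun_cscale[OF Xb] blinfun_cscale[OF Sb] cscale_add[symmetric] comm\<close>)
  have "moebius k (\<lambda>j. - a j) T' j x = T j x" for x
  proof -
    have "moebius k (\<lambda>j. - a j) T' j x = (scalar_op (1 / c\<^sup>2) o\<^sub>L (id_blinfun + S))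
      (- a j *\<^sub>C (x + \<kappa> *\<^sub>C (c\<^sup>2 *\<^sub>C X x - x)) + c *\<^sub>C T' j x)"
      unfolding moebius_def S'_def[symmetric] inv d
      by (simp add: c_def[symmetric] \<kappa>_def[symmetric] S' blinfun.add_left)
    also have "- a j *\<^sub>C (x + \<kappa> *\<^sub>C (c\<^sup>2 *\<^sub>C X x - x)) + c *\<^sub>C T' j x =
      - (a j * (1 - \<kappa>)) *\<^sub>C x + X ((- (a j * \<kappa> * c\<^sup>2) + c * a j) *\<^sub>C x + (c * a j * \<kappa>) *\<^sub>C S x + c\<^sup>2 *\<^sub>C T j x)"
      unfolding T'
      by (rule ell2_eqI)
         (simp add: blinfun.add_right blinfun.diff_right blinfun_cscale[OF Xb] power2_eq_square algebra_simps)
    also have "(scalar_op (1 / c\<^sup>2) o\<^sub>L (id_blinfun + S)) \<dots> = (1 / c\<^sup>2) *\<^sub>C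
      (- (a j * (1 - \<kappa>)) *\<^sub>C (x + S x) +
        ((- (a j * \<kappa> * c\<^sup>2) + c * a j) *\<^sub>C x + (c * a j * \<kappa>) *\<^sub>C S x + c\<^sup>2 *\<^sub>C T j x))"
    proof -
      have "(id_blinfun + S) (\<alpha> *\<^sub>C x + X v) = \<alpha> *\<^sub>C (x + S x) + v" for \<alpha> v
        using SX[of v] by (simp add: blinfun.add_left blinfun.add_right blinfun_cscale[OF Sb] cscale_add)
      then show ?thesis by (simp only: blinfun_apply_blinfun_compose scalar_op_apply)
    qed
    also have "\<dots> = (1 / c\<^sup>2) *\<^sub>C ((a j * (\<kappa> * (1 + c) - 1)) *\<^sub>C S x +
        (a j * (\<kappa> * (1 + c) * (1 - c) - 1 + c)) *\<^sub>C x + c\<^sup>2 *\<^sub>C T j x)"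
      by (rule ell2_eqI) (simp add: power2_eq_square algebra_simps)
    also have "\<dots> = T j x" unfolding \<kappa> using c(1) by simp
    finally show ?thesis .
  qed
  then show ?thesis by (intro blinfun_eqI) (simp add: T'_def)
qed

lemma has_derivative_cscale_const:
  assumes "(f has_derivative f') F"
  shows "((\<lambda>x. f x *\<^sub>C b) has_derivative (\<lambda>v. f' v *\<^sub>C b)) F"
  by (rule bounded_linear.has_derivative[OF bounded_bilinear.bounded_linear_left[OF bounded_bilinear_cscale] assms])

lemma uminus_in_polyball: "z \<in> polyball m n \<Longrightarrow> - z \<in> polyball m n"
  by (auto simp: polyball_def)

section \<open>Moebius automorphisms of the algebra and their action on characters\<close>

context free_prod
begin

lemma cc_hom_inv_op:
  assumes \<phi>: "cc_hom \<A> \<phi>" and A: "X \<in> \<A>" "B \<in> \<A>"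
    and X: "X o\<^sub>L B = id_blinfun" "B o\<^sub>L X = id_blinfun"
  shows "\<phi> (inv_op B) = inv_op (\<phi> B)"
proof -
  have "inv_op (\<phi> B) = \<phi> X"
    using arg_cong[OF X(1), of \<phi>] arg_cong[OF X(2), of \<phi>] A
    by (intro inv_op_eqI) (simp_all add: cc_hom_simps[OF \<phi>])
  then show ?thesis using inv_op_eqI[OF X] by simp
qed

lemma lin_comb_in: "(\<And>j. j < k \<Longrightarrow> T j \<in> \<A>) \<Longrightarrow> lin_comb k a T \<in> \<A>"
  unfolding lin_comb_def by (intro sum_in) auto

text \<open>Apply the row inequality to the column with entries
  \<open>cnj (a j) *\<^sub>C x\<close>. For \<open>a\<close> in the ball the bound is below 1, which
  is what the Neumann series requires.\<close>

lemma norm_lin_comb_le: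
  fixes T :: "nat \<Rightarrow> 'b op"
  assumes T: "row_contraction k T"
  shows "norm (lin_comb k a T) \<le> sqrt (\<Sum>j<k. (cmod (a j))\<^sup>2)"
proof (rule norm_blinfun_bound)
  fix x
  have "lin_comb k a T x = (\<Sum>j<k. T j (cnj (a j) *\<^sub>C x))"
    using T by (simp add: lin_comb_def blinfun.sum_left blinfun_cscale row_contraction_def)
  then have "(norm (lin_comb k a T x))\<^sup>2 \<le> (\<Sum>j<k. (norm (cnj (a j) *\<^sub>C x))\<^sup>2)"
    using T[unfolded row_contraction_iff, THEN conjunct2, rule_format, of "\<lambda>j. cnj (a j) *\<^sub>C x"] by simp
  also have "\<dots> = (sqrt (\<Sum>j<k. (cmod (a j))\<^sup>2) * norm x)\<^sup>2"
    by (simp add: norm_cscale power_mult_distrib sum_distrib_right sum_nonneg)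
  finally show "norm (lin_comb k a T x) \<le> sqrt (\<Sum>j<k. (cmod (a j))\<^sup>2) * norm x"
    by (rule power2_le_imp_le) (intro mult_nonneg_nonneg real_sqrt_ge_zero sum_nonneg; simp)
qed (simp add: sum_nonneg)

lemma moebius_inverse_exists:
  assumes "row_contraction k T" and TA: "\<And>j. j < k \<Longrightarrow> T j \<in> \<A>" and "(\<Sum>j<k. (cmod (a j))\<^sup>2) < 1"
  shows "inv_op (id_blinfun + lin_comb k a T) \<in> \<A>"
    "inv_op (id_blinfun + lin_comb k a T) o\<^sub>L (id_blinfun + lin_comb k a T) = id_blinfun"
    "(id_blinfun + lin_comb k a T) o\<^sub>L inv_op (id_blinfun + lin_comb k a T) = id_blinfun"
proof -
  have "norm (lin_comb k a T) \<le> sqrt (\<Sum>j<k. (cmod (a j))\<^sup>2)" by (rule norm_lin_comb_le[OF assms(1)])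
  also have "\<dots> < 1" using assms(3) by simp
  finally have l: "norm (lin_comb k a T) < 1" .
  have "lin_comb k a T \<in> \<A>" by (rule lin_comb_in[OF TA])
  from neumann[OF this l] obtain X where X: "X \<in> \<A>" "X o\<^sub>L (id_blinfun + lin_comb k a T) = id_blinfun"
    "(id_blinfun + lin_comb k a T) o\<^sub>L X = id_blinfun"
    by (elim bexE conjE)
  then have "inv_op (id_blinfun + lin_comb k a T) = X" by (intro inv_op_eqI)
  then show "inv_op (id_blinfun + lin_comb k a T) \<in> \<A>"
    "inv_op (id_blinfun + lin_comb k a T) o\<^sub>L (id_blinfun + lin_comb k a T) = id_blinfun"
    "(id_blinfun + lin_comb k a T) o\<^sub>L inv_op (id_blinfun + lin_comb k a T) = id_blinfun"
    using X by simp_all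
qed

lemma lin_comb_cong: "(\<And>j. j < k \<Longrightarrow> T j = T' j) \<Longrightarrow> lin_comb k a T = lin_comb k a T'"
  unfolding lin_comb_def by (rule sum.cong) auto

lemma moebius_cong:
  "(\<And>j. j < k \<Longrightarrow> T j = T' j) \<Longrightarrow> j < k \<Longrightarrow> moebius k a T j = moebius k a T' j"
  using lin_comb_cong[of k T T' a] by (simp add: moebius_def)

lemma cc_hom_moebius:
  assumes \<phi>: "cc_hom \<A> \<phi>" and T: "row_contraction k T" "\<And>j. j < k \<Longrightarrow> T j \<in> \<A>"
    and a: "(\<Sum>j<k. (cmod (a j))\<^sup>2) < 1" and j: "j < k"
  shows "\<phi> (moebius k a T j) = moebius k a (\<lambda>j. \<phi> (T j)) j"
proof -
  note X = moebius_inverse_exists[OF T a]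
  have S: "lin_comb k a T \<in> \<A>" by (rule lin_comb_in[OF T(2)])
  have "\<phi> (lin_comb k a T) = (\<Sum>j<k. \<phi> (scalar_op (cnj (a j)) o\<^sub>L T j))"
    unfolding lin_comb_def by (rule cc_hom_sum[OF \<phi>]) (use T in auto)
  also have "\<dots> = lin_comb k a (\<lambda>j. \<phi> (T j))"
    unfolding lin_comb_def by (rule sum.cong) (auto simp: cc_hom_simps[OF \<phi>] T)
  finally have l: "\<phi> (lin_comb k a T) = lin_comb k a (\<lambda>j. \<phi> (T j))" .
  have "\<phi> (inv_op (id_blinfun + lin_comb k a T)) = inv_op (id_blinfun + lin_comb k a (\<lambda>j. \<phi> (T j)))"
    using cc_hom_inv_op[OF \<phi> X(1) _ X(2,3)] S by (simp add: cc_hom_simps[OF \<phi>] l)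
  then show ?thesis
    using X(1) S T(2)[OF j] by (simp add: moebius_def cc_hom_simps[OF \<phi>] l)
qed

lemma moebius_in:
  assumes "row_contraction k T" "\<And>j. j < k \<Longrightarrow> T j \<in> \<A>" "(\<Sum>j<k. (cmod (a j))\<^sup>2) < 1" "j < k"
  shows "moebius k a T j \<in> \<A>"
  using moebius_inverse_exists(1)[OF assms(1-3)] lin_comb_in[OF assms(2)] assms(2)[OF assms(4)]
  by (simp add: moebius_def)

text \<open>All blocks are transformed simultaneously, block \<open>i\<close> by the part of
  \<open>a\<close> in that block. On characters this moves 0 to \<open>a\<close>, see
  \<open>rho_0_mob\<close>.\<close>

definition mob :: "(nat \<times> nat) ell2 \<Rightarrow> 'a op \<Rightarrow> 'a op"
  where "mob a = rep (\<lambda>i. moebius (n i) (\<lambda>j. coord a (i, j)) (s i))"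

lemma
  assumes a: "a \<in> polyball m n"
  shows mob_hom: "cc_hom \<A> (mob a)"
    and mob_s: "i < m \<Longrightarrow> j < n i \<Longrightarrow> mob a (s i j) = moebius (n i) (\<lambda>j. coord a (i, j)) (s i) j"
    and mob_image: "mob a ` \<A> \<subseteq> \<A>"
proof -
  have r: "row_contraction (n i) (moebius (n i) (\<lambda>j. coord a (i, j)) (s i))" if "i < m" for i
    by (rule row_contraction_moebius)
       (use moebius_inverse_exists[of "n i" "s i" "\<lambda>j. coord a (i, j)"] row_s[OF that] that
          polyballD(2)[OF a that] A_bounded_ops in auto)
  show 1: "cc_hom \<A> (mob a)"
    and 2: "i < m \<Longrightarrow> j < n i \<Longrightarrow> mob a (s i j) = moebius (n i) (\<lambda>j. coord a (i, j)) (s i) j" for i j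
    unfolding mob_def by (simp_all add: rep_hom rep_s r)
  show "mob a ` \<A> \<subseteq> \<A>"
    by (rule cc_hom_image[OF 1]) (simp add: 2 moebius_in row_s polyballD(2)[OF a])
qed

text \<open>A homomorphism commutes with the formula for \<open>moebius\<close>, so on a generator
  the composition is the transformation with \<open>a\<close> applied to the one with
  \<open>- a\<close>.\<close>

lemma mob_inverse:
  assumes a: "a \<in> polyball m n" and A: "A \<in> \<A>"
  shows "mob (- a) (mob a A) = A"
proof (rule cc_hom_eqI[OF cc_hom_compose[OF mob_hom[OF a] mob_image[OF a] mob_hom[OF uminus_in_polyball[OF a]]] _ _ A])
  show "cc_hom \<A> (\<lambda>A. A)"
    unfolding cc_hom_def unital_hom_def completely_contractive_def using A_bounded_ops by auto
  fix i j assume ij: "i < m" "j < n i"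
  let ?a = "\<lambda>j. coord a (i, j)"
  note sA = s_in[OF ij(1)] and r = row_s[OF ij(1)] and a1 = polyballD(2)[OF a ij(1)]
  have a2: "(\<Sum>j<n i. (cmod (- coord a (i, j)))\<^sup>2) < 1" using a1 by simp
  have "mob (- a) (mob a (s i j)) = moebius (n i) ?a (\<lambda>j. mob (- a) (s i j)) j"
    by (simp only: mob_s[OF a ij] cc_hom_moebius[OF mob_hom[OF uminus_in_polyball[OF a]] r sA a1 ij(2)])
  also have "\<dots> = moebius (n i) ?a (moebius (n i) (\<lambda>j. - ?a j) (s i)) j"
    by (rule moebius_cong) (simp_all add: ij mob_s uminus_in_polyball[OF a])
  also have "\<dots> = s i j"
    using moebius_inverse[of "n i" "s i" "\<lambda>j. - ?a j" j] moebius_inverse_exists[OF r sA a2] ij a2 A_bounded_ops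
    by simp
  finally show "mob (- a) (mob a (s i j)) = s i j" .
qed

lemma mob_inverse': "a \<in> polyball m n \<Longrightarrow> A \<in> \<A> \<Longrightarrow> mob a (mob (- a) A) = A"
  using mob_inverse[OF uminus_in_polyball, of a A] by simp

definition pairing :: "(nat \<times> nat) ell2 \<Rightarrow> nat \<Rightarrow> (nat \<times> nat) ell2 \<Rightarrow> complex"
  where "pairing a i z = (\<Sum>j<n i. cnj (coord a (i, j)) * coord z (i, j))"

text \<open>A character turns the operator inverse into a reciprocal; that the denominator does not
  vanish is thus a consequence of invertibility in \<open>\<A>\<close>.\<close>

lemma rho_mob:
  fixes a i
  defines "c \<equiv> complex_of_real (defect (n i) (\<lambda>j. coord a (i, j)))"
  assumes a: "a \<in> polyball m n" and z: "z \<in> polyball m n" and ij: "i < m" "j < n i"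
  shows "1 + pairing a i z \<noteq> 0"
    and "\<rho> z (mob a (s i j)) =
      (coord a (i, j) * (1 + 1 / (1 + c) * pairing a i z) + c * coord z (i, j)) / (1 + pairing a i z)"
proof -
  let ?S = "lin_comb (n i) (\<lambda>j. coord a (i, j)) (s i)"
  note sA = s_in[OF ij(1)] and r = row_s[OF ij(1)] and a1 = polyballD(2)[OF a ij(1)]
  note X = moebius_inverse_exists[OF r sA a1]
  have S: "?S \<in> \<A>" by (rule lin_comb_in[OF sA])
  have "\<rho> z ?S = (\<Sum>j<n i. \<rho> z (scalar_op (cnj (coord a (i, j))) o\<^sub>L s i j))"
    unfolding lin_comb_def by (rule rho_sum[OF z]) (use ij in auto)
  also have "\<dots> = pairing a i z"
    unfolding pairing_def by (rule sum.cong) (auto simp: rho_simps[OF z] rho_s[OF z] ij)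
  finally have Sz: "\<rho> z ?S = pairing a i z" .
  have "\<rho> z (inv_op (id_blinfun + ?S)) * (1 + pairing a i z) = 1"
    using arg_cong[OF X(2), of "\<rho> z"] X(1) S by (simp add: rho_simps[OF z] Sz)
  then show 1: "1 + pairing a i z \<noteq> 0" by auto
  then have "\<rho> z (inv_op (id_blinfun + ?S)) = 1 / (1 + pairing a i z)"
    using \<open>\<rho> z (inv_op (id_blinfun + ?S)) * (1 + pairing a i z) = 1\<close> by (simp add: eq_divide_eq)
  then show "\<rho> z (mob a (s i j)) =
      (coord a (i, j) * (1 + 1 / (1 + c) * pairing a i z) + c * coord z (i, j)) / (1 + pairing a i z)"
    using X(1) S ij by (simp add: mob_s[OF a] moebius_def rho_simps[OF z] rho_s[OF z] Sz c_def)
qed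

lemma rho_0_mob:
  assumes a: "a \<in> polyball m n" and A: "A \<in> \<A>"
  shows "\<rho> 0 (mob a A) = \<rho> a A"
  by (rule rho_compose_apply[OF mob_hom[OF a] mob_image[OF a] zero_in_polyball a _ A])
     (simp add: rho_mob[OF a] pairing_def)

text \<open>An explicit form of \<open>star\<close>: the new point has as coordinates the values of
  \<open>\<rho> z \<circ> \<phi>\<close> at the generators. It makes sense before this point is
  known to lie in the polyball.\<close>

definition val :: "('a op \<Rightarrow> 'a op) \<Rightarrow> (nat \<times> nat) ell2 \<Rightarrow> (nat \<times> nat) ell2"
  where "val \<phi> z = finite_vec I (\<lambda>p. \<rho> z (\<phi> (sg p)))"

lemma coord_val: "coord (val \<phi> z) (i, j) = (if i < m \<and> j < n i then \<rho> z (\<phi> (s i j)) else 0)"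
  by (simp add: val_def coord_finite_vec)

text \<open>If the image had norm at least \<open>1\<close> in some block, the maximum principle would apply to a linear polynomial.\<close>

lemma val_in_polyball:
  assumes \<phi>: "cc_hom \<A> \<phi>" "\<phi> ` \<A> \<subseteq> \<A>" "inj_on \<phi> \<A>" and z: "z \<in> polyball m n"
  shows "val \<phi> z \<in> polyball m n"
  unfolding polyball_def
proof (intro CollectI conjI allI impI)
  show "coord (val \<phi> z) (i, j) = 0" if "\<not> (i < m \<and> j < n i)" for i j using that by (auto simp: coord_val)
  fix i assume i: "i < m"
  define w where "w j = \<rho> z (\<phi> (s i j))" for j
  define R where "R = (\<Sum>j<n i. (cmod (w j))\<^sup>2)"
  have \<phi>A: "\<phi> A \<in> \<A>" if "A \<in> \<A>" for A using that \<phi> by auto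
  have "R < 1"
  proof (rule ccontr)
    assume "\<not> R < 1"
    then have R: "R \<ge> 1" by simp
    \<comment> \<open>The weights \<open>w j / R\<close> are chosen so that
      \<open>\<rho> z (\<phi> B) = 1\<close>, while the norm of \<open>B\<close> is at most
      \<open>1 / sqrt R \<le> 1\<close>.\<close>
    define B where "B = lin_comb (n i) (\<lambda>j. w j / of_real R) (s i)"
    have B: "B \<in> \<A>" unfolding B_def by (rule lin_comb_in) (use i in auto)
    have "norm B \<le> sqrt (\<Sum>j<n i. (cmod (w j / of_real R))\<^sup>2)"
      unfolding B_def by (rule norm_lin_comb_le[OF row_s[OF i]])
    also have "(\<Sum>j<n i. (cmod (w j / of_real R))\<^sup>2) = R / R\<^sup>2"
      using R by (simp add: norm_divide power_divide sum_divide_distrib[symmetric] R_def[symmetric])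
    also have "\<dots> \<le> 1" using R by (simp add: power2_eq_square)
    finally have nB: "norm B \<le> 1" using R by simp
    have Bterm: "\<tau> B = (\<Sum>j<n i. cnj (w j / of_real R) * \<tau> (s i j))" if "\<tau> \<in> characters \<A>" for \<tau>
      unfolding B_def lin_comb_def
      by (subst character_sum[OF that]) (use i in \<open>auto simp: character_simps[OF that]\<close>)
    have "\<rho> z (\<phi> B) = compose \<A> (\<rho> z) \<phi> B" using B by (simp add: compose_eq)
    also have "\<dots> = (\<Sum>j<n i. cnj (w j / of_real R) * compose \<A> (\<rho> z) \<phi> (s i j))"
      by (rule Bterm[OF compose_rho_character[OF \<phi>(1,2) z]])
    also have "\<dots> = (\<Sum>j<n i. of_real ((cmod (w j))\<^sup>2) / of_real R)"
      using i by (intro sum.cong) (auto simp: compose_eq w_def[symmetric] complex_norm_square mult.commute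
        simp del: of_real_power)
    also have "\<dots> = of_real R / of_real R" by (simp only: sum_divide_distrib[symmetric] R_def of_real_sum)
    also have "\<dots> = 1" using R by simp
    finally have "\<rho> 0 (mob z (\<phi> B)) = 1" using B by (simp add: rho_0_mob z \<phi>A)
    moreover have "norm (mob z (\<phi> B)) \<le> 1"
      using cc_hom_simps(7)[OF mob_hom[OF z], of "\<phi> B"] cc_hom_simps(7)[OF \<phi>(1) B] nB \<phi>A B by simp
    moreover have "mob z (\<phi> B) \<in> \<A>" using mob_image[OF z] \<phi>A[OF B] by auto
    \<comment> \<open>\<open>mob z\<close> has moved the evaluation from \<open>z\<close> to 0,
      where the maximum principle is available.\<close>
    ultimately have "mob z (\<phi> B) = id_blinfun" by (intro maximum_principle)
    then have "mob (- z) (mob z (\<phi> B)) = id_blinfun"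
      by (simp add: cc_hom_simps[OF mob_hom[OF uminus_in_polyball[OF z]]])
    \<comment> \<open>Injectivity brings the identity back to \<open>B\<close>, which is impossible
      since \<open>B\<close> has no constant term.\<close>
    then have "\<phi> B = \<phi> id_blinfun" by (simp add: mob_inverse z \<phi>A B cc_hom_simps[OF \<phi>(1)])
    then have "B = id_blinfun" using inj_onD[OF \<phi>(3)] B by blast
    moreover have "\<rho> 0 B = 0" using i by (simp add: Bterm rho_character rho_s)
    ultimately show False by (simp add: rho_simps)
  qed
  then show "(\<Sum>j<n i. (cmod (coord (val \<phi> z) (i, j)))\<^sup>2) < 1"
    using i by (simp add: coord_val R_def w_def)
qed

lemma rho_val:
  assumes \<phi>: "cc_hom \<A> \<phi>" "\<phi> ` \<A> \<subseteq> \<A>" "inj_on \<phi> \<A>" and z: "z \<in> polyball m n"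
  shows "compose \<A> (\<rho> z) \<phi> = \<rho> (val \<phi> z)"
  by (rule rho_compose[OF \<phi>(1,2) z val_in_polyball[OF \<phi> z]]) (simp add: coord_val)

lemma rho_val_apply:
  assumes "cc_hom \<A> \<phi>" "\<phi> ` \<A> \<subseteq> \<A>" "inj_on \<phi> \<A>" "z \<in> polyball m n" "A \<in> \<A>"
  shows "\<rho> z (\<phi> A) = \<rho> (val \<phi> z) A"
  using fun_cong[OF rho_val[OF assms(1-4)], of A] assms(5) by (simp add: compose_eq)

lemma polyball_eqI:
  assumes "z \<in> polyball m n" "w \<in> polyball m n" "\<And>i j. i < m \<Longrightarrow> j < n i \<Longrightarrow> coord z (i, j) = coord w (i, j)"
  shows "z = w"
  by (rule ell2_eqI) (metis assms polyballD(1) surj_pair)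

lemma star_apply:
  assumes \<phi>: "cc_hom \<A> \<phi>" "\<phi> ` \<A> \<subseteq> \<A>" "inj_on \<phi> \<A>" and z: "z \<in> polyball m n"
  shows "star m n \<A> s \<phi> z = val \<phi> z"
proof -
  have "(THE w. w \<in> polyball m n \<and> compose \<A> (\<rho> z) \<phi> = \<rho> w) = val \<phi> z"
  proof (rule the_equality)
    show "val \<phi> z \<in> polyball m n \<and> compose \<A> (\<rho> z) \<phi> = \<rho> (val \<phi> z)"
      using val_in_polyball[OF \<phi> z] rho_val[OF \<phi> z] by simp
    fix w assume w: "w \<in> polyball m n \<and> compose \<A> (\<rho> z) \<phi> = \<rho> w"
    show "w = val \<phi> z"
    proof (rule polyball_eqI)
      fix i j assume ij: "i < m" "j < n i"
      have "coord w (i, j) = \<rho> w (s i j)" using w ij by (simp add: rho_s)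
      also have "\<dots> = compose \<A> (\<rho> z) \<phi> (s i j)" using w by simp
      finally show "coord w (i, j) = coord (val \<phi> z) (i, j)"
        using ij by (simp add: compose_eq coord_val)
    qed (use w val_in_polyball[OF \<phi> z] in auto)
  qed
  then show ?thesis using z by (simp add: star_def)
qed

lemma mob_inj: "a \<in> polyball m n \<Longrightarrow> inj_on (mob a) \<A>"
  by (rule inj_on_inverseI[where g = "mob (- a)"]) (simp add: mob_inverse)

lemma val_mob_self:
  assumes a: "a \<in> polyball m n"
  shows "val (mob (- a)) a = 0"
proof (rule polyball_eqI)
  note a' = uminus_in_polyball[OF a]
  show "val (mob (- a)) a \<in> polyball m n"
    by (rule val_in_polyball[OF mob_hom mob_image mob_inj]) (auto simp: a a')
  fix i j assume ij: "i < m" "j < n i"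
  have "\<rho> a (mob (- a) (s i j)) = \<rho> 0 (mob a (mob (- a) (s i j)))"
    using mob_image[OF a'] ij by (intro rho_0_mob[OF a, symmetric]) auto
  also have "\<dots> = 0" using ij by (simp add: mob_inverse' a rho_s)
  finally show "coord (val (mob (- a)) a) (i, j) = coord 0 (i, j)" by (simp add: coord_val)
qed simp

section \<open>Holomorphy of the induced maps\<close>

lemma pairing_cscale: "pairing a i (c *\<^sub>C v) = c * pairing a i v"
  by (simp add: pairing_def sum_distrib_left mult_ac)

lemma bounded_linear_pairing: "bounded_linear (pairing a i)"
  unfolding pairing_def by (intro bounded_linear_sum bounded_linear_const_mult bounded_linear_coord)

lemma val_has_derivative:
  assumes "\<And>p. p \<in> I \<Longrightarrow> \<exists>f'. ((\<lambda>z. \<rho> z (\<phi> (sg p))) has_derivative f') (at z within polyball m n) \<and>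
      (\<forall>c v. f' (c *\<^sub>C v) = c * f' v)"
  shows "\<exists>f'. (val \<phi> has_derivative f') (at z within polyball m n) \<and> (\<forall>c v. f' (c *\<^sub>C v) = c *\<^sub>C f' v)"
proof -
  obtain f' where f': "\<And>p. p \<in> I \<Longrightarrow> ((\<lambda>z. \<rho> z (\<phi> (sg p))) has_derivative f' p) (at z within polyball m n)"
      "\<And>p c v. p \<in> I \<Longrightarrow> f' p (c *\<^sub>C v) = c * f' p v"
    using assms by metis
  show ?thesis
  proof (intro exI conjI allI)
    show "(val \<phi> has_derivative (\<lambda>v. \<Sum>p\<in>I. f' p v *\<^sub>C basis_vec p)) (at z within polyball m n)"
      unfolding val_def finite_vec_def by (intro has_derivative_sum has_derivative_cscale_const f')
    show "(\<Sum>p\<in>I. f' p (c *\<^sub>C v) *\<^sub>C basis_vec p) = c *\<^sub>C (\<Sum>p\<in>I. f' p v *\<^sub>C basis_vec p)" for c v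
      by (simp add: f' cscale_sum)
  qed
qed

lemma val_mob_has_derivative:
  assumes a: "a \<in> polyball m n" and z: "z \<in> polyball m n"
  shows "\<exists>f'. (val (mob a) has_derivative f') (at z within polyball m n) \<and> (\<forall>c v. f' (c *\<^sub>C v) = c *\<^sub>C f' v)"
proof (rule val_has_derivative)
  fix p assume "p \<in> I"
  then obtain i j where p: "p = (i, j)" and ij: "i < m" "j < n i" by auto
  define c where "c = complex_of_real (defect (n i) (\<lambda>j. coord a (i, j)))"
  define N where "N z = coord a (i, j) * (1 + 1 / (1 + c) * pairing a i z) + c * coord z (i, j)" for z
  define N' where "N' v = coord a (i, j) * (1 / (1 + c) * pairing a i v) + c * coord v (i, j)" for v
  define D where "D z = 1 + pairing a i z" for z
  have ld: "(pairing a i has_derivative pairing a i) F" "((\<lambda>z. coord z (i, j)) has_derivative (\<lambda>z. coord z (i, j))) F" for F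
    by (rule bounded_linear_imp_has_derivative, rule bounded_linear_pairing bounded_linear_coord)+
  have "((\<lambda>z. N z / D z) has_derivative
      (\<lambda>v. - N z * (inverse (D z) * pairing a i v * inverse (D z)) + N' v / D z)) (at z within polyball m n)"
  proof (rule has_derivative_divide)
    show "(N has_derivative N') (at z within polyball m n)"
      unfolding N_def N'_def by (rule has_derivative_eq_rhs, (rule derivative_intros ld)+) simp
    show "(D has_derivative pairing a i) (at z within polyball m n)"
      unfolding D_def by (rule has_derivative_eq_rhs, (rule derivative_intros ld)+) simp
    show "D z \<noteq> 0" using rho_mob(1)[OF a z ij] by (simp add: D_def)
  qed
  then have "((\<lambda>z. \<rho> z (mob a (sg p))) has_derivative
      (\<lambda>v. - N z * (inverse (D z) * pairing a i v * inverse (D z)) + N' v / D z)) (at z within polyball m n)"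
    by (rule has_derivative_transform[OF z, rotated])
       (simp add: p rho_mob(2)[OF a _ ij] N_def D_def c_def)
  moreover have "- N z * (inverse (D z) * pairing a i (c *\<^sub>C v) * inverse (D z)) + N' (c *\<^sub>C v) / D z =
      c * (- N z * (inverse (D z) * pairing a i v * inverse (D z)) + N' v / D z)" for c v
    by (simp add: N'_def pairing_cscale algebra_simps add_divide_distrib diff_divide_distrib)
  ultimately show "\<exists>f'. ((\<lambda>z. \<rho> z (mob a (sg p))) has_derivative f') (at z within polyball m n) \<and>
      (\<forall>c v. f' (c *\<^sub>C v) = c * f' v)"
    by blast
qed

text \<open>By \<open>\<rho>\<^sub>z = \<rho>\<^bsub>g z\<^esub> \<circ> mob a\<close>, with \<open>g\<close> moving \<open>a\<close> to \<open>0\<close>, it suffices to differentiate at \<open>0\<close>.\<close>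

lemma rho_has_derivative:
  assumes A: "A \<in> \<A>" and a: "a \<in> polyball m n"
  shows "\<exists>f'. ((\<lambda>z. \<rho> z A) has_derivative f') (at a within polyball m n) \<and> (\<forall>c v. f' (c *\<^sub>C v) = c * f' v)"
proof -
  note a' = uminus_in_polyball[OF a]
  note m = mob_hom[OF a'] mob_image[OF a'] mob_inj[OF a']
  define g where "g = val (mob (- a))"
  have mA: "mob a A \<in> \<A>" using mob_image[OF a] A by auto
  obtain g' where g': "(g has_derivative g') (at a within polyball m n)" "\<And>c v. g' (c *\<^sub>C v) = c *\<^sub>C g' v"
    using val_mob_has_derivative[OF a' a] by (auto simp: g_def)
  define D where "D v = (\<Sum>p\<in>I. \<delta> (mob a A) p * coord v p)" for v
  have "((\<lambda>w. \<rho> w (mob a A)) has_derivative D) (at (g a) within g ` polyball m n)"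
    unfolding g_def val_mob_self[OF a] D_def
    by (rule has_derivative_subset[OF rho_has_derivative_0[OF mA]])
       (use val_in_polyball[OF m] in auto)
  then have "((\<lambda>z. \<rho> (g z) (mob a A)) has_derivative (\<lambda>v. D (g' v))) (at a within polyball m n)"
    by (rule has_derivative_in_compose[OF g'(1)])
  then have "((\<lambda>z. \<rho> z A) has_derivative (\<lambda>v. D (g' v))) (at a within polyball m n)"
    by (rule has_derivative_transform[OF a, rotated])
       (simp add: g_def rho_val_apply[OF m _ mA, symmetric] mob_inverse a A)
  moreover have "D (g' (c *\<^sub>C v)) = c * D (g' v)" for c v
    by (simp add: D_def g' sum_distrib_left mult_ac)
  ultimately show ?thesis by blast
qed

lemma star_holomorphic:
  assumes \<phi>: "cc_hom \<A> \<phi>" "\<phi> ` \<A> \<subseteq> \<A>" "inj_on \<phi> \<A>"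
  shows "polyball_holomorphic m n (star m n \<A> s \<phi>)"
  unfolding polyball_holomorphic_def
proof
  fix z assume z: "z \<in> polyball m n"
  obtain f' where f': "(val \<phi> has_derivative f') (at z within polyball m n)" "\<And>c v. f' (c *\<^sub>C v) = c *\<^sub>C f' v"
    using val_has_derivative[OF rho_has_derivative[OF _ z], of \<phi>] \<phi>(2) by fastforce
  have "(star m n \<A> s \<phi> has_derivative f') (at z within polyball m n)"
    by (rule has_derivative_transform[OF z _ f'(1)]) (simp add: star_apply[OF \<phi>])
  then show "\<exists>f'. (star m n \<A> s \<phi> has_derivative f') (at z within polyball m n) \<and>
      (\<forall>c v. f' (c *\<^sub>C v) = c *\<^sub>C f' v)"
    using f'(2) by blast
qed

end

section \<open>Holomorphic maps of the polyball\<close>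

definition block_space :: "nat \<Rightarrow> (nat \<Rightarrow> nat) \<Rightarrow> (nat \<times> nat) ell2 set"
  where "block_space m n = {v. \<forall>i j. \<not> (i < m \<and> j < n i) \<longrightarrow> coord v (i, j) = 0}"

text \<open>The polyball is the open unit ball of \<open>block_space\<close> for the maximum of
  these over the blocks.\<close>

definition block_norm :: "(nat \<Rightarrow> nat) \<Rightarrow> (nat \<times> nat) ell2 \<Rightarrow> nat \<Rightarrow> real"
  where "block_norm n v i = L2_set (\<lambda>j. cmod (coord v (i, j))) {..<n i}"

lemma block_norm_nonneg [simp]: "0 \<le> block_norm n v i"
  by (simp add: block_norm_def)

lemma block_norm_sq: "(block_norm n v i)\<^sup>2 = (\<Sum>j<n i. (cmod (coord v (i, j)))\<^sup>2)"
  by (simp add: block_norm_def L2_set_def sum_nonneg)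

lemma polyball_iff: "z \<in> polyball m n \<longleftrightarrow> z \<in> block_space m n \<and> (\<forall>i<m. block_norm n z i < 1)"
  by (auto simp: polyball_def block_space_def block_norm_def L2_set_def)

lemma block_space_intros [simp, intro]:
  "0 \<in> block_space m n"
  "v \<in> block_space m n \<Longrightarrow> w \<in> block_space m n \<Longrightarrow> v + w \<in> block_space m n"
  "v \<in> block_space m n \<Longrightarrow> w \<in> block_space m n \<Longrightarrow> v - w \<in> block_space m n"
  "v \<in> block_space m n \<Longrightarrow> c *\<^sub>C v \<in> block_space m n"
  "v \<in> block_space m n \<Longrightarrow> r *\<^sub>R v \<in> block_space m n"
  "i < m \<Longrightarrow> j < n i \<Longrightarrow> basis_vec (i, j) \<in> block_space m n"
  by (auto simp: block_space_def coord_basis_vec)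

lemma block_space_eqI:
  assumes "v \<in> block_space m n" "w \<in> block_space m n"
    and "\<And>i j. i < m \<Longrightarrow> j < n i \<Longrightarrow> coord v (i, j) = coord w (i, j)"
  shows "v = w"
proof (rule ell2_eqI)
  fix p :: "nat \<times> nat"
  obtain i j where p: "p = (i, j)" by (cases p)
  show "coord v p = coord w p"
    using assms unfolding p by (cases "i < m \<and> j < n i") (auto simp: block_space_def)
qed

lemma block_norm_cscale: "block_norm n (c *\<^sub>C v) i = cmod c * block_norm n v i"
  by (simp add: block_norm_def norm_mult L2_set_right_distrib)

lemma block_norm_scaleR: "block_norm n (r *\<^sub>R v) i = \<bar>r\<bar> * block_norm n v i"
  using block_norm_cscale[of n "of_real r" v i] by (simp add: cscale_of_real)

lemma block_norm_le_norm: "block_norm n v i \<le> norm v"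
  using sum_coord_le_norm[of v i "n i"] by (simp add: block_norm_def L2_set_def real_le_lsqrt sum_nonneg)

lemma block_norm_basis_vec:
  assumes "j < n i"
  shows "block_norm n (basis_vec (i, j)) k = (if k = i then 1 else 0)"
proof -
  have "(block_norm n (basis_vec (i, j)) k)\<^sup>2 = (\<Sum>l<n k. if k = i \<and> l = j then 1 else 0)"
    unfolding block_norm_sq by (rule sum.cong) (auto simp: coord_basis_vec)
  also have "\<dots> = (if k = i then 1 else 0)\<^sup>2"
    using assms by (cases "k = i") simp_all
  finally show ?thesis by (rule power2_eq_imp_eq) auto
qed

lemma block_norm_eq_0: "block_norm n v i = 0 \<longleftrightarrow> (\<forall>j<n i. coord v (i, j) = 0)"
  by (auto simp: block_norm_def L2_set_eq_0_iff)

text \<open>Source of the strict convexity used in \<open>isometry_block_structure\<close>.\<close>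

lemma block_norm_parallelogram:
  "(block_norm n (v + w) i)\<^sup>2 + (block_norm n (v - w) i)\<^sup>2 = 2 * (block_norm n v i)\<^sup>2 + 2 * (block_norm n w i)\<^sup>2"
proof -
  have "(cmod (a + b))\<^sup>2 + (cmod (a - b))\<^sup>2 = 2 * (cmod a)\<^sup>2 + 2 * (cmod b)\<^sup>2" for a b
    by (simp add: cmod_power2) (simp add: power2_eq_square algebra_simps)
  then show ?thesis
    by (simp add: block_norm_sq sum.distrib[symmetric] sum_distrib_left)
qed

lemma complex_cauchy_schwarz:
  "cmod (\<Sum>j<k. cnj (c j) * w j) \<le> L2_set (\<lambda>j. cmod (c j)) {..<k} * L2_set (\<lambda>j. cmod (w j)) {..<k}"
proof -
  have "cmod (\<Sum>j<k. cnj (c j) * w j) \<le> (\<Sum>j<k. \<bar>cmod (c j)\<bar> * \<bar>cmod (w j)\<bar>)"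
    by (rule order_trans[OF norm_sum]) (simp add: norm_mult)
  also have "\<dots> \<le> L2_set (\<lambda>j. cmod (c j)) {..<k} * L2_set (\<lambda>j. cmod (w j)) {..<k}"
    by (rule L2_set_mult_ineq)
  finally show ?thesis .
qed

text \<open>The normalised vector \<open>w / N\<close> is the extremal \<open>c\<close>. This
  reduces vector-valued Schwarz estimates to scalar functions on the disc.\<close>

lemma L2_set_le_by_duality:
  assumes "\<And>c. L2_set (\<lambda>j. cmod (c j)) {..<k} \<le> 1 \<Longrightarrow> cmod (\<Sum>j<k. cnj (c j) * w j) \<le> r"
  shows "L2_set (\<lambda>j. cmod (w j)) {..<k} \<le> r"
proof -
  define N where "N = L2_set (\<lambda>j. cmod (w j)) {..<k}"
  show ?thesis
  proof (cases "N = 0")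
    case True
    then show ?thesis using assms[of "\<lambda>_. 0"] by (simp add: N_def L2_set_def)
  next
    case False
    then have N: "N > 0" by (simp add: N_def less_le)
    have "L2_set (\<lambda>j. cmod (w j / of_real N)) {..<k} = (1 / N) * N"
      unfolding N_def using N by (subst L2_set_right_distrib) (simp_all add: norm_divide N_def)
    then have "cmod (\<Sum>j<k. cnj (w j / of_real N) * w j) \<le> r" using N by (intro assms) simp
    also have "(\<Sum>j<k. cnj (w j / of_real N) * w j) = of_real ((\<Sum>j<k. (cmod (w j))\<^sup>2) / N)"
      by (simp add: sum_divide_distrib complex_norm_square mult.commute del: of_real_power)
    also have "(\<Sum>j<k. (cmod (w j))\<^sup>2) = N\<^sup>2" by (simp add: N_def L2_set_def sum_nonneg)
    finally show ?thesis using N by (simp add: N_def[symmetric] power2_eq_square)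
  qed
qed

lemma finite_uniform_bound:
  assumes "\<And>k. k < m \<Longrightarrow> f k < (1 :: real)"
  shows "\<exists>r. 0 < r \<and> r < 1 \<and> (\<forall>k<(m :: nat). f k \<le> r)"
proof (intro exI conjI allI impI)
  \<comment> \<open>The additional 1/2 keeps the set nonempty and its maximum positive.\<close>
  define S where "S = insert (1 / 2) (f ` {..<m})"
  have S: "finite S" "S \<noteq> {}" by (auto simp: S_def)
  have "1 / 2 \<le> Max S" by (rule Max_ge) (auto simp: S_def)
  then show "0 < Max S" by linarith
  show "Max S < 1" using assms by (subst Max_less_iff[OF S]) (auto simp: S_def)
  show "f k \<le> Max S" if "k < m" for k using that by (intro Max_ge) (auto simp: S_def)
qed

text \<open>Restricted to a complex line, a complex-homogeneous derivative is multiplication by a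
  complex number. The derivative within the polyball becomes an ordinary one because the parameters
  range over an open set.\<close>

lemma slice_has_field_derivative:
  assumes f: "(f has_derivative f') (at (x + t *\<^sub>C v) within polyball m n)" "\<And>c v. f' (c *\<^sub>C v) = c *\<^sub>C f' v"
    and U: "open U" "t \<in> U" "\<And>\<tau>. \<tau> \<in> U \<Longrightarrow> x + \<tau> *\<^sub>C v \<in> polyball m n"
  shows "((\<lambda>\<tau>. coord (f (x + \<tau> *\<^sub>C v)) p) has_field_derivative coord (f' v) p) (at t)"
proof -
  have h: "((\<lambda>\<tau>. x + \<tau> *\<^sub>C v) has_derivative (\<lambda>\<tau>. \<tau> *\<^sub>C v)) (at t within U)"
    by (rule has_derivative_eq_rhs, (rule derivative_intros has_derivative_cscale_const)+) simp
  have "(f has_derivative f') (at (x + t *\<^sub>C v) within (\<lambda>\<tau>. x + \<tau> *\<^sub>C v) ` U)"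
    by (rule has_derivative_subset[OF f(1)]) (use U in auto)
  then have "((\<lambda>\<tau>. f (x + \<tau> *\<^sub>C v)) has_derivative (\<lambda>\<tau>. f' (\<tau> *\<^sub>C v))) (at t within U)"
    by (rule has_derivative_in_compose[OF h])
  from bounded_linear.has_derivative[OF bounded_linear_coord this, of p]
  have "((\<lambda>\<tau>. coord (f (x + \<tau> *\<^sub>C v)) p) has_derivative (\<lambda>\<tau>. coord (f' v) p * \<tau>)) (at t within U)"
    by (simp only: f(2) coord_cscale mult.commute)
  then show ?thesis
    by (simp only: has_field_derivative_def at_within_open[OF U(2,1)])
qed

lemma slice_holomorphic:
  assumes f: "polyball_holomorphic m n f"
    and U: "open U" "\<And>\<tau>. \<tau> \<in> U \<Longrightarrow> x + \<tau> *\<^sub>C v \<in> polyball m n"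
  shows "(\<lambda>\<tau>. coord (f (x + \<tau> *\<^sub>C v)) p) holomorphic_on U"
proof (rule holomorphic_onI)
  fix t assume t: "t \<in> U"
  obtain f' where "(f has_derivative f') (at (x + t *\<^sub>C v) within polyball m n)" "\<And>c v. f' (c *\<^sub>C v) = c *\<^sub>C f' v"
    using f U(2)[OF t] by (auto simp: polyball_holomorphic_def)
  from slice_has_field_derivative[OF this U(1) t U(2)]
  show "(\<lambda>\<tau>. coord (f (x + \<tau> *\<^sub>C v)) p) field_differentiable at t within U"
    unfolding field_differentiable_def by (blast intro: has_field_derivative_at_within)
qed

lemma scaled_in_polyball:
  assumes "z \<in> block_space m n" "\<And>i. i < m \<Longrightarrow> block_norm n z i \<le> 1" "cmod t < 1"
  shows "t *\<^sub>C z \<in> polyball m n"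
proof -
  have "cmod t * block_norm n z i < 1" if "i < m" for i
    using mult_left_mono[OF assms(2)[OF that], of "cmod t"] assms(3) by simp
  then show ?thesis using assms(1) by (auto simp: polyball_iff block_norm_cscale)
qed

context
  fixes m n f f'
  assumes hol: "polyball_holomorphic m n f" and maps: "f ` polyball m n \<subseteq> polyball m n"
    and f0: "f 0 = 0" and f': "(f has_derivative f') (at 0 within polyball m n)"
    and f'_scale: "\<And>c v. f' (c *\<^sub>C v) = c *\<^sub>C f' v"
begin

text \<open>Pairing block \<open>i\<close> of \<open>f\<close> along a line through 0 with a vector
  of norm at most 1 gives a self-map of the disc fixing 0, to which the one-variable Schwarz lemma
  applies.\<close>

lemma schwarz_slice:
  fixes z i c
  defines "h \<equiv> \<lambda>t. \<Sum>j<n i. cnj (c j) * coord (f (t *\<^sub>C z)) (i, j)"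
  assumes z: "z \<in> block_space m n" "\<And>i. i < m \<Longrightarrow> block_norm n z i \<le> 1" and i: "i < m"
    and c: "L2_set (\<lambda>j. cmod (c j)) {..<n i} \<le> 1"
  shows "h holomorphic_on ball 0 1" "h 0 = 0" "\<And>t. cmod t < 1 \<Longrightarrow> cmod (h t) < 1"
    "(h has_field_derivative (\<Sum>j<n i. cnj (c j) * coord (f' z) (i, j))) (at 0)"
proof -
  have U: "0 + t *\<^sub>C z \<in> polyball m n" if "t \<in> ball 0 1" for t
    using scaled_in_polyball[OF z, of t] that by simp
  have "(\<lambda>t. coord (f (0 + t *\<^sub>C z)) (i, j)) holomorphic_on ball 0 1" for j
    by (rule slice_holomorphic[OF hol open_ball U])
  then show "h holomorphic_on ball 0 1" unfolding h_def by (auto intro!: holomorphic_intros)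
  show "h 0 = 0" by (simp add: h_def f0)
  have "((\<lambda>t. coord (f (0 + t *\<^sub>C z)) (i, j)) has_field_derivative coord (f' z) (i, j)) (at 0)" for j
    by (rule slice_has_field_derivative[where U = "ball 0 1", OF _ f'_scale _ _ U]) (use f' in auto)
  then show "(h has_field_derivative (\<Sum>j<n i. cnj (c j) * coord (f' z) (i, j))) (at 0)"
    unfolding h_def by (auto intro!: DERIV_sum DERIV_cmult)
  fix t assume "cmod t < 1"
  then have "f (t *\<^sub>C z) \<in> polyball m n" using U[of t] maps by auto
  then have b: "block_norm n (f (t *\<^sub>C z)) i < 1" using i by (simp add: polyball_iff)
  have "cmod (h t) \<le> L2_set (\<lambda>j. cmod (c j)) {..<n i} * block_norm n (f (t *\<^sub>C z)) i"
    unfolding h_def block_norm_def by (rule complex_cauchy_schwarz)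
  also have "\<dots> \<le> 1 * block_norm n (f (t *\<^sub>C z)) i" by (intro mult_right_mono c) simp
  finally show "cmod (h t) < 1" using b by simp
qed

lemma schwarz_polyball:
  assumes z: "z \<in> block_space m n" "\<And>i. i < m \<Longrightarrow> block_norm n z i \<le> 1" and i: "i < m"
  shows "cmod t < 1 \<Longrightarrow> block_norm n (f (t *\<^sub>C z)) i \<le> cmod t" and "block_norm n (f' z) i \<le> 1"
proof -
  show "block_norm n (f' z) i \<le> 1"
    unfolding block_norm_def
  proof (rule L2_set_le_by_duality)
    fix c :: "nat \<Rightarrow> complex" assume c: "L2_set (\<lambda>j. cmod (c j)) {..<n i} \<le> 1"
    note h = schwarz_slice[OF z i c]
    have "cmod (deriv (\<lambda>t. \<Sum>j<n i. cnj (c j) * coord (f (t *\<^sub>C z)) (i, j)) 0) \<le> 1"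
      by (rule Schwarz_Lemma(2)[OF h(1,2,3), of 0]) auto
    then show "cmod (\<Sum>j<n i. cnj (c j) * coord (f' z) (i, j)) \<le> 1" by (simp add: DERIV_imp_deriv[OF h(4)])
  qed
  show "block_norm n (f (t *\<^sub>C z)) i \<le> cmod t" if "cmod t < 1"
    unfolding block_norm_def
  proof (rule L2_set_le_by_duality)
    fix c :: "nat \<Rightarrow> complex" assume c: "L2_set (\<lambda>j. cmod (c j)) {..<n i} \<le> 1"
    note h = schwarz_slice[OF z i c]
    show "cmod (\<Sum>j<n i. cnj (c j) * coord (f (t *\<^sub>C z)) (i, j)) \<le> cmod t"
      by (rule Schwarz_Lemma(1)[OF h(1,2,3), of t]) (use that in auto)
  qed
qed

text \<open>
  In the blocks where the norm of \<open>z\<close> is maximal this is the equality case of the Schwarz lemma;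
  the other blocks follow by analytic continuation in the size of the block.
\<close>

lemma eq_id_if_derivative_eq_id_max:
  assumes id: "\<And>v. v \<in> block_space m n \<Longrightarrow> f' v = v"
    and z: "z \<in> block_space m n" "\<And>i. i < m \<Longrightarrow> block_norm n z i \<le> 1" and i: "i < m" "block_norm n z i = 1"
    and t: "cmod t < 1" and j: "j < n i"
  shows "coord (f (t *\<^sub>C z)) (i, j) = t * coord z (i, j)"
proof -
  let ?c = "\<lambda>j. coord z (i, j)"
  define h where "h t = (\<Sum>j<n i. cnj (?c j) * coord (f (t *\<^sub>C z)) (i, j))" for t
  have "L2_set (\<lambda>j. cmod (?c j)) {..<n i} \<le> 1" using i(2) by (simp add: block_norm_def)
  note h = schwarz_slice[OF z i(1) this, folded h_def]
  have sq: "(\<Sum>j<n i. (cmod (?c j))\<^sup>2) = 1" using block_norm_sq[of n z i] i(2) by simp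
  have "(\<Sum>j<n i. cnj (?c j) * coord (f' z) (i, j)) = of_real (\<Sum>j<n i. (cmod (?c j))\<^sup>2)"
    by (simp add: id z(1) complex_norm_square mult.commute del: of_real_power)
  then have d1: "(h has_field_derivative 1) (at 0)" using h(4) by (simp add: sq)
  then have "cmod (deriv h 0) = 1" by (simp add: DERIV_imp_deriv)
  then obtain \<alpha> where \<alpha>: "\<And>t. cmod t < 1 \<Longrightarrow> h t = \<alpha> * t"
    using Schwarz_Lemma(3)[OF h(1,2,3), of 0] by auto
  have "((\<lambda>t. \<alpha> * t) has_field_derivative 1) (at 0)"
    by (rule has_field_derivative_transform_within_open[OF d1 open_ball[of 0 1]]) (auto simp: \<alpha>)
  moreover have "((\<lambda>t. \<alpha> * t) has_field_derivative \<alpha>) (at 0)" by (auto intro!: derivative_eq_intros)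
  ultimately have "\<alpha> = 1" by (rule DERIV_unique[rotated])
  then have ht: "h t = t" using \<alpha> t by simp
  let ?g = "\<lambda>j. coord (f (t *\<^sub>C z)) (i, j)"
  \<comment> \<open>Summed over the block, the right side is at most
    \<open>|t|\<^sup>2 - 2 |t|\<^sup>2 + |t|\<^sup>2 = 0\<close>: the first term by the Schwarz
    bound, the second by \<open>h t = t\<close>, the third since \<open>z\<close> has norm 1 in
    block \<open>i\<close>.\<close>
  have expand: "(cmod (g - t * w))\<^sup>2 = (cmod g)\<^sup>2 - 2 * Re (cnj t * (cnj w * g)) + (cmod t)\<^sup>2 * (cmod w)\<^sup>2" for g w
    by (simp add: cmod_power2) (simp add: power2_eq_square algebra_simps)
  have "(\<Sum>j<n i. (cmod (?g j - t * ?c j))\<^sup>2) =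
    (\<Sum>j<n i. (cmod (?g j))\<^sup>2) - 2 * Re (cnj t * h t) + (cmod t)\<^sup>2 * (\<Sum>j<n i. (cmod (?c j))\<^sup>2)"
    unfolding expand h_def
    by (simp only: sum.distrib sum_subtractf sum_distrib_left[symmetric] Re_sum)
       (simp only: sum_distrib_left Re_sum)
  also have "cnj t * h t = of_real ((cmod t)\<^sup>2)"
    unfolding ht complex_norm_square by (rule mult.commute)
  also have "(\<Sum>j<n i. (cmod (?g j))\<^sup>2) \<le> (cmod t)\<^sup>2"
    unfolding block_norm_sq[symmetric] by (rule power_mono[OF schwarz_polyball(1)[OF z i(1) t]]) auto
  finally have "(\<Sum>j<n i. (cmod (?g j - t * ?c j))\<^sup>2) \<le> 0" by (simp add: sq)
  then have "(\<Sum>j<n i. (cmod (?g j - t * ?c j))\<^sup>2) = 0" by (simp add: antisym sum_nonneg)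
  then show ?thesis using j by (simp add: sum_nonneg_eq_0_iff)
qed

lemma eq_id_if_derivative_eq_id:
  assumes id: "\<And>v. v \<in> block_space m n \<Longrightarrow> f' v = v" and n: "\<And>i. i < m \<Longrightarrow> n i \<ge> 1"
    and w: "w \<in> polyball m n"
  shows "f w = w"
proof (rule block_space_eqI)
  have "f w \<in> polyball m n" using w maps by auto
  then show "f w \<in> block_space m n" "w \<in> block_space m n" using w by (auto simp: polyball_iff)
  fix i j assume i: "i < m" and j: "j < n i"
  define P where "P = finite_vec (Pair i ` {..<n i}) (coord w)"
  have P: "coord P (k, l) = (if k = i \<and> l < n i then coord w (k, l) else 0)" for k l
    by (auto simp: P_def coord_finite_vec)
  have Pb: "P \<in> block_space m n" using i by (auto simp: block_space_def P)
  have w0: "coord (w - P) (i, l) = 0" if "l < n i" for l using that by (simp add: P)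
  have wk: "coord (w - P) (k, l) = coord w (k, l)" if "k \<noteq> i" for k l using that by (simp add: P)
  have nP: "block_norm n P i = block_norm n w i"
    unfolding block_norm_def by (rule L2_set_cong) (auto simp: P)
  \<comment> \<open>Block \<open>i\<close> of \<open>w\<close> as a multiple of a unit vector
    \<open>v\<close> of that block. If it vanishes, any unit vector will do, and
    \<open>n i \<ge> 1\<close> provides \<open>basis_vec (i, 0)\<close>.\<close>
  obtain v \<zeta>0 where v: "v \<in> block_space m n" "block_norm n v i = 1" "\<And>k l. k \<noteq> i \<Longrightarrow> coord v (k, l) = 0"
    and \<zeta>0: "cmod \<zeta>0 < 1" "P = \<zeta>0 *\<^sub>C v"
  proof (cases "block_norm n w i = 0")
    case True
    show ?thesis
    proof (rule that[of "basis_vec (i, 0)" 0])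
      have "P = 0" using True nP Pb by (intro block_space_eqI[OF Pb]) (auto simp: block_norm_eq_0 P)
      then show "P = 0 *\<^sub>C basis_vec (i, 0)" by simp
    qed (use i n[OF i] in \<open>auto simp: block_norm_basis_vec coord_basis_vec\<close>)
  next
    case False
    let ?b = "block_norm n w i"
    show ?thesis
    proof (rule that[of "of_real (1 / ?b) *\<^sub>C P" "of_real ?b"])
      show "P = of_real ?b *\<^sub>C of_real (1 / ?b) *\<^sub>C P" using False by simp
      show "cmod (of_real ?b) < 1" using w i by (simp add: polyball_iff)
      show "block_norm n (of_real (1 / ?b) *\<^sub>C P) i = 1"
        using False by (simp add: block_norm_cscale nP norm_divide)
    qed (use Pb in \<open>auto simp: P\<close>)
  qed
  obtain r where r: "0 < r" "r < 1" "\<And>k. k < m \<Longrightarrow> block_norm n w k \<le> r"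
    using finite_uniform_bound[of m "block_norm n w"] w by (auto simp: polyball_iff)
  \<comment> \<open>Only block \<open>i\<close> varies, with norm \<open>cmod \<zeta>\<close>; the
    parameter \<open>\<zeta>0\<close> returns \<open>w\<close>.\<close>
  define x where "x \<zeta> = (w - P) + \<zeta> *\<^sub>C v" for \<zeta>
  have xb: "x \<zeta> \<in> block_space m n" for \<zeta> using w Pb v by (auto simp: x_def polyball_iff)
  have xi: "coord (x \<zeta>) (i, l) = \<zeta> * coord v (i, l)" if "l < n i" for \<zeta> l
    using w0[OF that] by (simp add: x_def)
  have nxi: "block_norm n (x \<zeta>) i = cmod \<zeta>" for \<zeta>
  proof -
    have "block_norm n (x \<zeta>) i = block_norm n (\<zeta> *\<^sub>C v) i"
      unfolding block_norm_def by (rule L2_set_cong) (auto simp: xi)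
    then show ?thesis by (simp add: block_norm_cscale v)
  qed
  have nxk: "block_norm n (x \<zeta>) k = block_norm n w k" if "k \<noteq> i" for \<zeta> k
    unfolding block_norm_def by (rule L2_set_cong) (use that in \<open>auto simp: x_def wk[simplified] v\<close>)
  have xp: "x \<zeta> \<in> polyball m n" if "cmod \<zeta> < 1" for \<zeta>
    unfolding polyball_iff
  proof (intro conjI xb allI impI)
    show "block_norm n (x \<zeta>) k < 1" if "k < m" for k
      using nxi[of \<zeta>] nxk[of k \<zeta>] r(2) r(3)[OF that] \<open>cmod \<zeta> < 1\<close> by (cases "k = i") auto
  qed
  \<comment> \<open>On the annulus between radius \<open>r\<close> and 1, block \<open>i\<close>
    dominates all others and the extremal case applies. Both sides are holomorphic on the whole
    disc, which contains \<open>\<zeta>0\<close>.\<close>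
  have "coord (f (x \<zeta>0)) (i, j) = \<zeta>0 * coord v (i, j)"
  proof (rule analytic_continuation_open[where f = "\<lambda>\<zeta>. coord (f (x \<zeta>)) (i, j)" and
        g = "\<lambda>\<zeta>. \<zeta> * coord v (i, j)" and s = "ball 0 1 - cball 0 r" and s' = "ball 0 1"])
    show "open (ball 0 1 - cball (0 :: complex) r)" by (intro open_Diff) auto
    have "complex_of_real ((r + 1) / 2) \<in> ball 0 1 - cball 0 r" using r by simp
    then show "ball 0 1 - cball (0 :: complex) r \<noteq> {}" by blast
    show "(\<lambda>\<zeta>. coord (f (x \<zeta>)) (i, j)) holomorphic_on ball 0 1"
      unfolding x_def by (rule slice_holomorphic[OF hol]) (use xp in \<open>auto simp: x_def\<close>)
    fix \<zeta> :: complex assume "\<zeta> \<in> ball 0 1 - cball 0 r"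
    then have \<zeta>: "cmod \<zeta> < 1" "r < cmod \<zeta>" by auto
    \<comment> \<open>Rescaling by \<open>cmod \<zeta>\<close> gives block \<open>i\<close> norm
      exactly 1 and keeps the other blocks within the unit ball.\<close>
    define t where "t = complex_of_real (cmod \<zeta>)"
    define z where "z = (1 / t) *\<^sub>C x \<zeta>"
    have t: "t \<noteq> 0" "cmod t = cmod \<zeta>" using \<zeta> r(1) by (auto simp: t_def)
    have xz: "x \<zeta> = t *\<^sub>C z" using t by (simp add: z_def)
    have "coord (f (t *\<^sub>C z)) (i, j) = t * coord z (i, j)"
    proof (rule eq_id_if_derivative_eq_id_max[OF id _ _ i _ _ j])
      show "z \<in> block_space m n" using xb by (simp add: z_def)
      have nz: "block_norm n z k = block_norm n (x \<zeta>) k / cmod \<zeta>" for k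
        by (simp add: z_def block_norm_cscale norm_divide t)
      show "block_norm n z i = 1" using \<zeta> r(1) by (auto simp: nz nxi)
      show "block_norm n z k \<le> 1" if "k < m" for k
        using \<zeta> r(1) r(3)[OF that] by (cases "k = i") (auto simp: nz nxi nxk divide_le_eq)
    qed (use \<zeta> t in simp_all)
    then show "coord (f (x \<zeta>)) (i, j) = \<zeta> * coord v (i, j)"
      using xi[OF j, of \<zeta>] by (simp add: xz)
  qed (use \<zeta>0 in \<open>auto intro!: holomorphic_intros\<close>)
  moreover have "x \<zeta>0 = w" using \<zeta>0 by (simp add: x_def)
  ultimately show "coord (f w) (i, j) = coord w (i, j)" using xi[OF j, of \<zeta>0] by simp
qed

end

section \<open>Linear automorphisms\<close>

text \<open>Contractions of \<open>block_space\<close> for the norm that has the polyball as unit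
  ball. The map is defined on the ambient space because derivatives are; two of them that are
  mutually inverse on \<open>block_space\<close> are isometries there.\<close>

definition block_contraction ::
    "nat \<Rightarrow> (nat \<Rightarrow> nat) \<Rightarrow> ((nat \<times> nat) ell2 \<Rightarrow> (nat \<times> nat) ell2) \<Rightarrow> bool"
  where "block_contraction m n L \<longleftrightarrow> bounded_linear L \<and> (\<forall>c v. L (c *\<^sub>C v) = c *\<^sub>C L v) \<and>
    L ` block_space m n \<subseteq> block_space m n \<and>
    (\<forall>v\<in>block_space m n. (\<forall>i<m. block_norm n v i \<le> 1) \<longrightarrow> (\<forall>i<m. block_norm n (L v) i \<le> 1))"

lemma block_contractionD:
  assumes "block_contraction m n L"
  shows "bounded_linear L" "L (c *\<^sub>C v) = c *\<^sub>C L v"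
    "v \<in> block_space m n \<Longrightarrow> L v \<in> block_space m n"
    "v \<in> block_space m n \<Longrightarrow> (\<And>i. i < m \<Longrightarrow> block_norm n v i \<le> 1) \<Longrightarrow> i < m \<Longrightarrow> block_norm n (L v) i \<le> 1"
  using assms by (auto simp: block_contraction_def)

lemma block_contraction_bound:
  assumes L: "block_contraction m n L" and v: "v \<in> block_space m n"
    and R: "\<And>i. i < m \<Longrightarrow> block_norm n v i \<le> R" and i: "i < m"
  shows "block_norm n (L v) i \<le> R"
proof -
  interpret L: bounded_linear L by (rule block_contractionD[OF L])
  have R0: "R \<ge> 0" using R[OF i] block_norm_nonneg[of n v i] by linarith
  show ?thesis
  proof (cases "R = 0")
    case True
    have "block_norm n v k = 0" if "k < m" for k
      using R[OF that] block_norm_nonneg[of n v k] True by simp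
    then have "v = 0" by (intro block_space_eqI[OF v]) (auto simp: block_norm_eq_0)
    then show ?thesis using True by (simp add: L.zero block_norm_def L2_set_def)
  next
    case False
    then have Rp: "R > 0" using R0 by simp
    have "block_norm n (L ((1 / R) *\<^sub>R v)) i \<le> 1"
      using Rp R by (intro block_contractionD(4)[OF L] block_space_intros v i)
        (simp add: block_norm_scaleR)
    then show ?thesis using Rp by (simp add: L.scaleR block_norm_scaleR)
  qed
qed

text \<open>
  For a unit vector \<open>x\<close> in block \<open>i\<close>, some block \<open>k\<close> of \<open>M x\<close> has norm \<open>1\<close>.  If the blocks of \<open>y\<close> have
  norm at most \<open>1\<close> and block \<open>i\<close> of \<open>y\<close> vanishes, the blocks of \<open>x \<plusminus> y\<close> have norm at most \<open>1\<close>,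
  so that block \<open>k\<close> of \<open>M y\<close> vanishes by strict convexity.
\<close>

lemma isometry_block_structure:
  assumes M: "block_contraction m n M" and L: "block_contraction m n L"
    and inv2: "\<And>v. v \<in> block_space m n \<Longrightarrow> L (M v) = v" and n: "\<And>i. i < m \<Longrightarrow> n i \<ge> 1"
    and k: "k < m"
  shows "\<exists>i<m. \<forall>v\<in>block_space m n. block_norm n v i = 0 \<longrightarrow> block_norm n (M v) k = 0"
proof -
  interpret M: bounded_linear M by (rule block_contractionD[OF M])
  define e where "e i = basis_vec (i, 0 :: nat)" for i :: nat
  have e: "e i \<in> block_space m n" "block_norm n (e i) l = (if l = i then 1 else 0)" if "i < m" for i l
    using n[OF that] that by (auto simp: e_def block_norm_basis_vec)
  \<comment> \<open>Otherwise all blocks of \<open>M (e i)\<close> have norm at most some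
    \<open>r < 1\<close>, and the contraction \<open>L\<close> could not restore the unit vector
    \<open>e i\<close>.\<close>
  have ex: "\<exists>k<m. block_norm n (M (e i)) k = 1" if i: "i < m" for i
  proof (rule ccontr)
    assume "\<not> ?thesis"
    then have ne: "block_norm n (M (e i)) k \<noteq> 1" if "k < m" for k using that by blast
    have "block_norm n (M (e i)) k < 1" if "k < m" for k
    proof -
      have "block_norm n (M (e i)) k \<le> 1"
        by (rule block_contractionD(4)[OF M _ _ that]) (use e i in auto)
      then show ?thesis using ne[OF that] by simp
    qed
    then obtain r where r: "r < 1" "\<And>k. k < m \<Longrightarrow> block_norm n (M (e i)) k \<le> r"
      using finite_uniform_bound by blast
    have "block_norm n (L (M (e i))) i \<le> r"
      by (rule block_contraction_bound[OF L _ r(2) i]) (use block_contractionD(3)[OF M] e i in auto)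
    then show False using r e i inv2 by simp
  qed
  then obtain \<kappa> where \<kappa>: "\<And>i. i < m \<Longrightarrow> \<kappa> i < m" "\<And>i. i < m \<Longrightarrow> block_norm n (M (e i)) (\<kappa> i) = 1"
    by metis
  have vanish: "block_norm n (M y) (\<kappa> i) = 0"
    if i: "i < m" and y: "y \<in> block_space m n" "block_norm n y i = 0" for i y
  proof -
    \<comment> \<open>Scaling brings all blocks of \<open>y\<close> into the unit ball; adding 1
      makes \<open>R\<close> positive for \<open>y = 0\<close> as well.\<close>
    define R where "R = norm y + 1"
    have R: "R > 0" by (simp add: R_def add_nonneg_pos)
    define w where "w = (1 / R) *\<^sub>R y"
    have w: "w \<in> block_space m n" "\<And>l. block_norm n w l \<le> 1" "block_norm n w i = 0"
    proof -
      show "block_norm n w l \<le> 1" for l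
        using block_norm_le_norm[of n y l] R by (simp add: w_def block_norm_scaleR R_def)
    qed (use y in \<open>simp_all add: w_def block_norm_scaleR\<close>)
    have wi: "coord w (i, j) = 0" if "j < n i" for j using w(3) that by (simp add: block_norm_eq_0)
    have le: "block_norm n (M v) (\<kappa> i) \<le> 1"
      if v: "v = e i + w \<or> v = e i - w" for v
    proof (rule block_contractionD(4)[OF M _ _ \<kappa>(1)[OF i]])
      show "v \<in> block_space m n" using v e[OF i] w by auto
      fix l assume "l < m"
      show "block_norm n v l \<le> 1"
      proof (cases "l = i")
        case True
        have "block_norm n v i = block_norm n (e i) i"
          unfolding block_norm_def by (rule L2_set_cong) (use v wi in auto)
        then show ?thesis using e[OF i] True by simp
      next
        case False
        have "block_norm n v l = block_norm n w l"
          unfolding block_norm_def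
          by (rule L2_set_cong) (use v False in \<open>auto simp: e_def coord_basis_vec\<close>)
        then show ?thesis using w by simp
      qed
    qed
    have sq: "(block_norm n (M v) (\<kappa> i))\<^sup>2 \<le> 1" if "v = e i + w \<or> v = e i - w" for v
      using le[OF that] by (simp add: power_le_one)
    have "(block_norm n (M (e i)) (\<kappa> i))\<^sup>2 = 1" using \<kappa>(2)[OF i] by simp
    then have "(block_norm n (M w) (\<kappa> i))\<^sup>2 \<le> 0"
      using block_norm_parallelogram[of n "M (e i)" "M w" "\<kappa> i"] sq[OF disjI1[OF refl]] sq[OF disjI2[OF refl]]
      unfolding M.add M.diff by linarith
    then have "block_norm n (M w) (\<kappa> i) = 0" by simp
    then show ?thesis using R by (simp add: w_def M.scaleR block_norm_scaleR)
  qed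
  \<comment> \<open>If two blocks had the same target, \<open>vanish\<close> would contradict the
    norm 1 there. An injective self-map of a finite set is onto, so every \<open>k\<close> is a
    target.\<close>
  have "inj_on \<kappa> {..<m}"
  proof (rule inj_onI)
    fix i l assume il: "i \<in> {..<m}" "l \<in> {..<m}" "\<kappa> i = \<kappa> l"
    show "i = l"
    proof (rule ccontr)
      assume "i \<noteq> l"
      then have "block_norm n (M (e i)) (\<kappa> l) = 0" using il e by (intro vanish) auto
      then show False using \<kappa>(2)[of i] il by simp
    qed
  qed
  then have "\<kappa> ` {..<m} = {..<m}" using \<kappa>(1) by (intro endo_inj_surj) auto
  then obtain i where "i < m" "k = \<kappa> i" using k by (metis imageE lessThan_iff)
  then show ?thesis using vanish by blast
qed

lemma block_space_expand:
  assumes L: "block_contraction m n L" and v: "v \<in> block_space m n"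
  shows "L v = (\<Sum>q\<in>(SIGMA i:{..<m}. {..<n i}). coord v q *\<^sub>C L (basis_vec q))"
proof -
  interpret L: bounded_linear L by (rule block_contractionD[OF L])
  have "v = finite_vec (SIGMA i:{..<m}. {..<n i}) (coord v)"
    using v by (intro block_space_eqI) (auto simp: block_space_def coord_finite_vec)
  then have "L v = L (finite_vec (SIGMA i:{..<m}. {..<n i}) (coord v))" by simp
  also have "\<dots> = (\<Sum>q\<in>(SIGMA i:{..<m}. {..<n i}). coord v q *\<^sub>C L (basis_vec q))"
    by (simp add: finite_vec_def L.sum block_contractionD(2)[OF L])
  finally show ?thesis .
qed

lemma has_sum_sum_nat:
  fixes f :: "nat \<Rightarrow> 'b \<Rightarrow> real"
  assumes "\<And>l. l < q \<Longrightarrow> (f l has_sum S l) A"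
  shows "((\<lambda>a. \<Sum>l<q. f l a) has_sum (\<Sum>l<q. S l)) A"
  using assms by (induction q) (auto intro: has_sum_add)

text \<open>A matrix and its transpose have the same norm: with \<open>\<eta>\<close> the conjugate
  of the image vector, moving \<open>C\<close> to the other side and Cauchy-Schwarz give
  \<open>S\<^sup>2 \<le> S * X\<close>.\<close>

lemma transpose_contraction_scalar:
  fixes C :: "nat \<Rightarrow> nat \<Rightarrow> complex"
  assumes C: "\<And>z. (\<Sum>j<p. (cmod (\<Sum>l<q. C j l * z l))\<^sup>2) \<le> (\<Sum>l<q. (cmod (z l))\<^sup>2)"
  shows "(\<Sum>l<q. (cmod (\<Sum>j<p. C j l * \<xi> j))\<^sup>2) \<le> (\<Sum>j<p. (cmod (\<xi> j))\<^sup>2)"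
proof -
  define \<eta> where "\<eta> l = cnj (\<Sum>j<p. C j l * \<xi> j)" for l
  have c\<eta>: "cnj (\<eta> l) = (\<Sum>j<p. C j l * \<xi> j)" for l by (simp add: \<eta>_def)
  define S where "S = L2_set (\<lambda>l. cmod (\<eta> l)) {..<q}"
  define X where "X = L2_set (\<lambda>j. cmod (\<xi> j)) {..<p}"
  have S2: "S\<^sup>2 = (\<Sum>l<q. (cmod (\<eta> l))\<^sup>2)" and S0: "S \<ge> 0" and X0: "X \<ge> 0" and X2: "X\<^sup>2 = (\<Sum>j<p. (cmod (\<xi> j))\<^sup>2)"
    by (simp_all add: S_def X_def L2_set_def sum_nonneg)
  have "complex_of_real (S\<^sup>2) = (\<Sum>l<q. \<eta> l * cnj (\<eta> l))"
    unfolding S2 by (simp only: of_real_sum complex_norm_square)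
  also have "\<dots> = (\<Sum>l<q. \<Sum>j<p. C j l * \<eta> l * \<xi> j)"
    by (simp only: c\<eta> sum_distrib_left mult_ac)
  also have "\<dots> = (\<Sum>j<p. cnj (cnj (\<Sum>l<q. C j l * \<eta> l)) * \<xi> j)"
    by (subst sum.swap) (simp add: sum_distrib_right)
  finally have "S\<^sup>2 = cmod (\<Sum>j<p. cnj (cnj (\<Sum>l<q. C j l * \<eta> l)) * \<xi> j)"
    by (metis norm_of_real abs_of_nonneg zero_le_power2)
  also have "\<dots> \<le> L2_set (\<lambda>j. cmod (cnj (\<Sum>l<q. C j l * \<eta> l))) {..<p} * X"
    unfolding X_def by (rule complex_cauchy_schwarz)
  also have "\<dots> \<le> S * X"
  proof (rule mult_right_mono[OF _ X0])
    have "(L2_set (\<lambda>j. cmod (cnj (\<Sum>l<q. C j l * \<eta> l))) {..<p})\<^sup>2 \<le> S\<^sup>2"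
      unfolding S2 using C[of \<eta>] by (simp only: complex_mod_cnj L2_set_def real_sqrt_pow2 sum_nonneg zero_le_power2)
    then show "L2_set (\<lambda>j. cmod (cnj (\<Sum>l<q. C j l * \<eta> l))) {..<p} \<le> S"
      using S0 by (rule power2_le_imp_le)
  qed
  finally have "S * S \<le> S * X" by (simp add: power2_eq_square)
  then have "S \<le> X" using S0 X0 by (cases "S = 0") auto
  then have "S\<^sup>2 \<le> X\<^sup>2" using S0 by (rule power_mono)
  moreover have "cmod (\<eta> l) = cmod (\<Sum>j<p. C j l * \<xi> j)" for l
    unfolding c\<eta>[symmetric] by simp
  ultimately show ?thesis unfolding S2 X2 by simp
qed

text \<open>The squared norm in \<open>ell2\<close> is the sum over coordinates of scalar
  expressions, so the scalar inequality can be applied in each coordinate and summed.\<close>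

lemma transpose_contraction:
  fixes C :: "nat \<Rightarrow> nat \<Rightarrow> complex" and x :: "nat \<Rightarrow> 'a ell2"
  assumes C: "\<And>z. (\<Sum>j<p. (cmod (\<Sum>l<q. C j l * z l))\<^sup>2) \<le> (\<Sum>l<q. (cmod (z l))\<^sup>2)"
  shows "(\<Sum>l<q. (norm (\<Sum>j<p. C j l *\<^sub>C x j))\<^sup>2) \<le> (\<Sum>j<p. (norm (x j))\<^sup>2)"
proof (rule has_sum_mono)
  have *: "((\<lambda>a. (cmod (coord y a))\<^sup>2) has_sum (norm y)\<^sup>2) UNIV" for y :: "'a ell2"
    unfolding norm_ell2_sq by (rule has_sum_infsum[OF coord_summable])
  show "((\<lambda>a. \<Sum>l<q. (cmod (coord (\<Sum>j<p. C j l *\<^sub>C x j) a))\<^sup>2) has_sum (\<Sum>l<q. (norm (\<Sum>j<p. C j l *\<^sub>C x j))\<^sup>2)) UNIV"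
    by (rule has_sum_sum_nat, rule *)
  show "((\<lambda>a. \<Sum>j<p. (cmod (coord (x j) a))\<^sup>2) has_sum (\<Sum>j<p. (norm (x j))\<^sup>2)) UNIV"
    by (rule has_sum_sum_nat, rule *)
  show "(\<Sum>l<q. (cmod (coord (\<Sum>j<p. C j l *\<^sub>C x j) a))\<^sup>2) \<le> (\<Sum>j<p. (cmod (coord (x j) a))\<^sup>2)" for a
    using transpose_contraction_scalar[where p = p and q = q and C = C and \<xi> = "\<lambda>j. coord (x j) a"] C by simp
qed

context free_prod
begin

text \<open>Substitution of the coordinate functions of \<open>L\<close>, with the generators in
  place of the coordinates of \<open>z\<close>; by \<open>val_lift\<close> the induced map of the
  polyball is \<open>L\<close> itself.\<close>

definition lift :: "((nat \<times> nat) ell2 \<Rightarrow> (nat \<times> nat) ell2) \<Rightarrow> 'a op \<Rightarrow> 'a op"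
  where "lift L = rep (\<lambda>i j. \<Sum>q\<in>I. scalar_op (coord (L (basis_vec q)) (i, j)) o\<^sub>L sg q)"

text \<open>The block hypothesis leaves only generators of the single row \<open>k\<close>. The new
  row is then the row \<open>s k\<close> composed with the transpose of the matrix \<open>C\<close>,
  both contractive.\<close>

lemma row_contraction_linear:
  assumes L: "block_contraction m n L" and i: "i < m" and k: "k < m"
    and block: "\<And>v. v \<in> block_space m n \<Longrightarrow> block_norm n v k = 0 \<Longrightarrow> block_norm n (L v) i = 0"
  shows "row_contraction (n i) (\<lambda>j. \<Sum>q\<in>I. scalar_op (coord (L (basis_vec q)) (i, j)) o\<^sub>L sg q)"
    (is "row_contraction _ ?T")
  unfolding row_contraction_iff
proof (intro conjI allI impI)
  show "?T j \<in> bounded_ops" for j by (intro A_bounded_ops sum_in) auto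
  define C where "C j l = coord (L (basis_vec (k, l))) (i, j)" for j l
  have restr: "(\<Sum>q\<in>I. g q) = (\<Sum>l<n k. g (k, l))"
    if "\<And>q. q \<in> I \<Longrightarrow> fst q \<noteq> k \<Longrightarrow> g q = 0" for g :: "nat \<times> nat \<Rightarrow> 'a ell2"
  proof -
    have "(\<Sum>q\<in>I. g q) = (\<Sum>q\<in>Pair k ` {..<n k}. g q)"
    proof (rule sum.mono_neutral_right; (intro ballI)?)
      fix q assume "q \<in> I - Pair k ` {..<n k}"
      then show "g q = 0" by (intro that) force+
    qed (use k in auto)
    then show ?thesis by (simp add: sum.reindex inj_on_def)
  qed
  have T: "?T j x = (\<Sum>l<n k. C j l *\<^sub>C s k l x)" if j: "j < n i" for j x
  proof -
    have "?T j x = (\<Sum>q\<in>I. coord (L (basis_vec q)) (i, j) *\<^sub>C sg q x)"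
      by (simp add: blinfun.sum_left)
    also have "\<dots> = (\<Sum>l<n k. coord (L (basis_vec (k, l))) (i, j) *\<^sub>C sg (k, l) x)"
    proof (rule restr)
      fix q assume q: "q \<in> I" "fst q \<noteq> k"
      then have "block_norm n (L (basis_vec q)) i = 0"
        by (intro block) (auto simp: block_norm_basis_vec)
      then show "coord (L (basis_vec q)) (i, j) *\<^sub>C sg q x = 0" using j by (simp add: block_norm_eq_0)
    qed
    finally show ?thesis by (simp add: C_def)
  qed
  have C: "(\<Sum>j<n i. (cmod (\<Sum>l<n k. C j l * z l))\<^sup>2) \<le> (\<Sum>l<n k. (cmod (z l))\<^sup>2)" for z
  proof -
    interpret L: bounded_linear L by (rule block_contractionD[OF L])
    define v where "v = finite_vec (Pair k ` {..<n k}) (\<lambda>q. z (snd q))"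
    have v: "coord v (a, l) = (if a = k \<and> l < n k then z l else 0)" for a l
      by (auto simp: v_def coord_finite_vec)
    have vb: "v \<in> block_space m n" using k by (auto simp: block_space_def v)
    have nv: "block_norm n v k = L2_set (\<lambda>l. cmod (z l)) {..<n k}"
      unfolding block_norm_def by (rule L2_set_cong) (auto simp: v)
    have nv0: "block_norm n v a = 0" if "a \<noteq> k" for a using that by (simp add: block_norm_eq_0 v)
    have "block_norm n (L v) i \<le> block_norm n v k"
      by (rule block_contraction_bound[OF L vb _ i]) (metis nv0 block_norm_nonneg order_refl)
    then have "(block_norm n (L v) i)\<^sup>2 \<le> (block_norm n v k)\<^sup>2" by (rule power_mono) simp
    moreover have "coord (L v) (i, j) = (\<Sum>l<n k. C j l * z l)" for j
    proof -
      have "L v = (\<Sum>q\<in>Pair k ` {..<n k}. z (snd q) *\<^sub>C L (basis_vec q))"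
        by (simp add: v_def finite_vec_def L.sum block_contractionD(2)[OF L])
      then show ?thesis by (simp add: sum.reindex inj_on_def C_def mult.commute)
    qed
    ultimately show ?thesis by (simp add: block_norm_sq nv L2_set_def sum_nonneg)
  qed
  fix x :: "nat \<Rightarrow> 'a ell2"
  have "(\<Sum>j<n i. ?T j (x j)) = (\<Sum>l<n k. s k l (\<Sum>j<n i. C j l *\<^sub>C x j))"
  proof -
    have "(\<Sum>j<n i. ?T j (x j)) = (\<Sum>j<n i. \<Sum>l<n k. C j l *\<^sub>C s k l (x j))"
      by (rule sum.cong) (simp_all add: T)
    also have "\<dots> = (\<Sum>l<n k. \<Sum>j<n i. C j l *\<^sub>C s k l (x j))" by (rule sum.swap)
    also have "\<dots> = (\<Sum>l<n k. s k l (\<Sum>j<n i. C j l *\<^sub>C x j))"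
      by (rule sum.cong) (use k in \<open>simp_all add: blinfun.sum_right blinfun_cscale A_bounded_ops\<close>)
    finally show ?thesis .
  qed
  then have "(norm (\<Sum>j<n i. ?T j (x j)))\<^sup>2 \<le> (\<Sum>l<n k. (norm (\<Sum>j<n i. C j l *\<^sub>C x j))\<^sup>2)"
    using row_s[OF k, unfolded row_contraction_iff, THEN conjunct2, rule_format, of "\<lambda>l. \<Sum>j<n i. C j l *\<^sub>C x j"]
    by simp
  also have "\<dots> \<le> (\<Sum>j<n i. (norm (x j))\<^sup>2)" by (rule transpose_contraction[OF C])
  finally show "(norm (\<Sum>j<n i. ?T j (x j)))\<^sup>2 \<le> (\<Sum>j<n i. (norm (x j))\<^sup>2)" .
qed

lemma
  assumes L: "block_contraction m n L" and M: "block_contraction m n M"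
    and inv1: "\<And>v. v \<in> block_space m n \<Longrightarrow> M (L v) = v" and n: "\<And>i. i < m \<Longrightarrow> n i \<ge> 1"
  shows lift_hom: "cc_hom \<A> (lift L)"
    and lift_s: "i < m \<Longrightarrow> j < n i \<Longrightarrow> lift L (s i j) = (\<Sum>q\<in>I. scalar_op (coord (L (basis_vec q)) (i, j)) o\<^sub>L sg q)"
    and lift_image: "lift L ` \<A> \<subseteq> \<A>"
proof -
  have r: "row_contraction (n i) (\<lambda>j. \<Sum>q\<in>I. scalar_op (coord (L (basis_vec q)) (i, j)) o\<^sub>L sg q)" if i: "i < m" for i
  proof -
    obtain k where "k < m" "\<forall>v\<in>block_space m n. block_norm n v k = 0 \<longrightarrow> block_norm n (L v) i = 0"
      using isometry_block_structure[OF L M inv1 n i] by blast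
    then show ?thesis by (intro row_contraction_linear[OF L i, of k]) auto
  qed
  show 1: "cc_hom \<A> (lift L)"
    and 2: "i < m \<Longrightarrow> j < n i \<Longrightarrow> lift L (s i j) = (\<Sum>q\<in>I. scalar_op (coord (L (basis_vec q)) (i, j)) o\<^sub>L sg q)" for i j
    unfolding lift_def by (simp_all add: rep_hom rep_s r)
  show "lift L ` \<A> \<subseteq> \<A>" by (rule cc_hom_image[OF 1]) (auto simp: 2 intro!: sum_in)
qed

text \<open>Substitution reverses composition, so the matrix that appears is that of
  \<open>L\<close> after \<open>M\<close>.\<close>

lemma lift_inverse:
  assumes L: "block_contraction m n L" and M: "block_contraction m n M"
    and inv1: "\<And>v. v \<in> block_space m n \<Longrightarrow> M (L v) = v" and inv2: "\<And>v. v \<in> block_space m n \<Longrightarrow> L (M v) = v"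
    and n: "\<And>i. i < m \<Longrightarrow> n i \<ge> 1" and A: "A \<in> \<A>"
  shows "lift M (lift L A) = A"
proof (rule cc_hom_eqI[OF cc_hom_compose[OF lift_hom[OF L M inv1 n] lift_image[OF L M inv1 n] lift_hom[OF M L inv2 n]] _ _ A])
  show "cc_hom \<A> (\<lambda>A. A)"
    unfolding cc_hom_def unital_hom_def completely_contractive_def using A_bounded_ops by auto
  note hM = lift_hom[OF M L inv2 n]
  fix i j assume ij: "i < m" "j < n i"
  have "lift M (lift L (s i j)) = (\<Sum>q\<in>I. scalar_op (coord (L (basis_vec q)) (i, j)) o\<^sub>L lift M (sg q))"
  proof -
    have "lift L (s i j) = (\<Sum>q\<in>I. scalar_op (coord (L (basis_vec q)) (i, j)) o\<^sub>L sg q)"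
      by (rule lift_s[OF L M inv1 n ij])
    also have "lift M \<dots> = (\<Sum>q\<in>I. lift M (scalar_op (coord (L (basis_vec q)) (i, j)) o\<^sub>L sg q))"
      by (rule cc_hom_sum[OF hM]) auto
    also have "\<dots> = (\<Sum>q\<in>I. scalar_op (coord (L (basis_vec q)) (i, j)) o\<^sub>L lift M (sg q))"
      by (rule sum.cong) (auto simp: cc_hom_simps[OF hM])
    finally show ?thesis .
  qed
  also have "\<dots> = s i j"
  proof (rule blinfun_eqI)
    fix x
    have "(\<Sum>q\<in>I. scalar_op (coord (L (basis_vec q)) (i, j)) o\<^sub>L lift M (sg q)) x =
      (\<Sum>q\<in>I. \<Sum>r\<in>I. (coord (M (basis_vec r)) q * coord (L (basis_vec q)) (i, j)) *\<^sub>C sg r x)"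
      unfolding blinfun.sum_left
    proof (rule sum.cong[OF refl])
      fix q assume "q \<in> I"
      then have "lift M (sg q) x = (\<Sum>r\<in>I. coord (M (basis_vec r)) q *\<^sub>C sg r x)"
        by (auto simp: lift_s[OF M L inv2 n] blinfun.sum_left)
      then show "(scalar_op (coord (L (basis_vec q)) (i, j)) o\<^sub>L lift M (sg q)) x =
        (\<Sum>r\<in>I. (coord (M (basis_vec r)) q * coord (L (basis_vec q)) (i, j)) *\<^sub>C sg r x)"
        by (simp add: cscale_sum mult.commute)
    qed
    also have "\<dots> = (\<Sum>r\<in>I. (\<Sum>q\<in>I. coord (M (basis_vec r)) q * coord (L (basis_vec q)) (i, j)) *\<^sub>C sg r x)"
      by (subst sum.swap) (simp add: sum_cscale_left)
    also have "\<dots> = (\<Sum>r\<in>I. if r = (i, j) then s i j x else 0)"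
    proof (rule sum.cong[OF refl])
      fix r assume r: "r \<in> I"
      then have b: "basis_vec r \<in> block_space m n" by auto
      then have Mb: "M (basis_vec r) \<in> block_space m n" by (rule block_contractionD[OF M])
      have "(\<Sum>q\<in>I. coord (M (basis_vec r)) q * coord (L (basis_vec q)) (i, j)) = coord (L (M (basis_vec r))) (i, j)"
        unfolding block_space_expand[OF L Mb] by simp
      also have "\<dots> = (if r = (i, j) then 1 else 0)" using inv2[OF b] by (simp add: coord_basis_vec)
      finally show "(\<Sum>q\<in>I. coord (M (basis_vec r)) q * coord (L (basis_vec q)) (i, j)) *\<^sub>C sg r x =
        (if r = (i, j) then s i j x else 0)" by simp
    qed
    also have "\<dots> = s i j x" using ij by simp
    finally show "(\<Sum>q\<in>I. scalar_op (coord (L (basis_vec q)) (i, j)) o\<^sub>L lift M (sg q)) x = s i j x" .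
  qed
  finally show "lift M (lift L (s i j)) = s i j" .
qed

lemma val_lift:
  assumes L: "block_contraction m n L" and M: "block_contraction m n M"
    and inv1: "\<And>v. v \<in> block_space m n \<Longrightarrow> M (L v) = v" and n: "\<And>i. i < m \<Longrightarrow> n i \<ge> 1"
    and z: "z \<in> polyball m n"
  shows "val (lift L) z = L z"
proof (rule block_space_eqI)
  have zb: "z \<in> block_space m n" using z by (simp add: polyball_iff)
  show "L z \<in> block_space m n" by (rule block_contractionD(3)[OF L zb])
  show "val (lift L) z \<in> block_space m n" by (auto simp: block_space_def coord_val)
  fix i j assume ij: "i < m" "j < n i"
  have "coord (val (lift L) z) (i, j) = (\<Sum>q\<in>I. \<rho> z (scalar_op (coord (L (basis_vec q)) (i, j)) o\<^sub>L sg q))"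
    using ij by (simp add: coord_val lift_s[OF L M inv1 n]) (rule rho_sum[OF z], auto)
  also have "\<dots> = (\<Sum>q\<in>I. coord z q * coord (L (basis_vec q)) (i, j))"
    by (rule sum.cong) (auto simp: rho_simps[OF z] rho_s[OF z] mult.commute)
  also have "\<dots> = coord (L z) (i, j)" unfolding block_space_expand[OF L zb] by simp
  finally show "coord (val (lift L) z) (i, j) = coord (L z) (i, j)" .
qed

end

section \<open>The automorphism groups\<close>

lemma mat_norm_cong:
  assumes "\<And>p q. p < N \<Longrightarrow> q < N \<Longrightarrow> A p q = B p q"
  shows "mat_norm N A = mat_norm N B"
proof -
  have "L2_set (\<lambda>p. norm (\<Sum>q<N. blinfun_apply (A p q) (x q))) {..<N} =
      L2_set (\<lambda>p. norm (\<Sum>q<N. blinfun_apply (B p q) (x q))) {..<N}" for x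
    by (rule L2_set_cong) (simp_all add: assms)
  then show ?thesis by (simp add: mat_norm_def)
qed

lemma polyball_holomorphic_cong:
  assumes "polyball_holomorphic m n f" "\<And>z. z \<in> polyball m n \<Longrightarrow> g z = f z"
  shows "polyball_holomorphic m n g"
  unfolding polyball_holomorphic_def
proof
  fix z assume z: "z \<in> polyball m n"
  obtain f' where f': "(f has_derivative f') (at z within polyball m n)" "\<forall>c v. f' (c *\<^sub>C v) = c *\<^sub>C f' v"
    using assms(1) z by (auto simp: polyball_holomorphic_def)
  have "(g has_derivative f') (at z within polyball m n)"
    by (rule has_derivative_transform[OF z assms(2) f'(1)])
  then show "\<exists>f'. (g has_derivative f') (at z within polyball m n) \<and> (\<forall>c v. f' (c *\<^sub>C v) = c *\<^sub>C f' v)"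
    using f'(2) by blast
qed

lemma polyball_holomorphic_compose:
  assumes f: "polyball_holomorphic m n f" "f ` polyball m n \<subseteq> polyball m n" and g: "polyball_holomorphic m n g"
  shows "polyball_holomorphic m n (\<lambda>z. g (f z))"
  unfolding polyball_holomorphic_def
proof
  fix z assume z: "z \<in> polyball m n"
  then have fz: "f z \<in> polyball m n" using f(2) by auto
  obtain f' where f': "(f has_derivative f') (at z within polyball m n)" "\<And>c v. f' (c *\<^sub>C v) = c *\<^sub>C f' v"
    using f(1) z by (auto simp: polyball_holomorphic_def)
  obtain g' where g': "(g has_derivative g') (at (f z) within polyball m n)" "\<And>c v. g' (c *\<^sub>C v) = c *\<^sub>C g' v"
    using g fz by (auto simp: polyball_holomorphic_def)
  have "((\<lambda>z. g (f z)) has_derivative (\<lambda>v. g' (f' v))) (at z within polyball m n)"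
    by (rule has_derivative_in_compose[OF f'(1) has_derivative_subset[OF g'(1) f(2)]])
  then show "\<exists>h'. ((\<lambda>z. g (f z)) has_derivative h') (at z within polyball m n) \<and>
      (\<forall>c v. h' (c *\<^sub>C v) = c *\<^sub>C h' v)"
    using f'(2) g'(2) by (intro exI[of _ "\<lambda>v. g' (f' v)"]) simp
qed

text \<open>A derivative within the polyball is constrained only in directions of
  \<open>block_space\<close>; there it can be read off from complex lines, and so it is
  unique.\<close>

lemma derivative_at_0_along:
  assumes f: "(f has_derivative f') (at 0 within polyball m n)" "\<And>c v. f' (c *\<^sub>C v) = c *\<^sub>C f' v"
    and v: "v \<in> block_space m n"
    and eq: "\<And>t. t *\<^sub>C v \<in> polyball m n \<Longrightarrow> coord (f (t *\<^sub>C v)) p = t * d"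
  shows "coord (f' v) p = d"
proof -
  \<comment> \<open>For parameters in this disc all blocks of \<open>t *\<^sub>C v\<close> have norm
    below 1.\<close>
  define r where "r = 1 / (norm v + 1)"
  have r: "r > 0" by (simp add: r_def add_nonneg_pos)
  have U: "t *\<^sub>C v \<in> polyball m n" if "t \<in> ball 0 r" for t
    unfolding polyball_iff
  proof (intro conjI allI impI block_space_intros v)
    fix i
    have "cmod t * block_norm n v i \<le> cmod t * norm v"
      by (intro mult_left_mono block_norm_le_norm) simp
    also have "\<dots> \<le> r * norm v" using that by (intro mult_right_mono) auto
    also have "\<dots> < 1" using add_nonneg_pos[of "norm v" 1] by (simp add: r_def divide_less_eq)
    finally show "block_norm n (t *\<^sub>C v) i < 1" by (simp add: block_norm_cscale)
  qed
  have "((\<lambda>t. coord (f (0 + t *\<^sub>C v)) p) has_field_derivative coord (f' v) p) (at 0)"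
    by (rule slice_has_field_derivative[where U = "ball 0 r", OF _ f(2)]) (use f(1) r U in auto)
  then have "((\<lambda>t. t * d) has_field_derivative coord (f' v) p) (at 0)"
    by (rule has_field_derivative_transform_within_open[OF _ open_ball[of 0 r]]) (use r U eq in auto)
  moreover have "((\<lambda>t. t * d) has_field_derivative d) (at 0)" by (auto intro!: derivative_eq_intros)
  ultimately show ?thesis by (rule DERIV_unique)
qed

lemma derivative_block_contraction:
  assumes hol: "polyball_holomorphic m n f" and maps: "f ` polyball m n \<subseteq> polyball m n" and f0: "f 0 = 0"
    and f': "(f has_derivative f') (at 0 within polyball m n)" "\<And>c v. f' (c *\<^sub>C v) = c *\<^sub>C f' v"
  shows "block_contraction m n f'"
  unfolding block_contraction_def
proof (intro conjI allI ballI impI)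
  show "bounded_linear f'" by (rule has_derivative_bounded_linear[OF f'(1)])
  show "f' (c *\<^sub>C v) = c *\<^sub>C f' v" for c v by (rule f')
  have "coord (f' v) (i, j) = 0" if v: "v \<in> block_space m n" and ij: "\<not> (i < m \<and> j < n i)" for v i j
  proof (rule derivative_at_0_along[OF f' v])
    fix t assume "t *\<^sub>C v \<in> polyball m n"
    then have "f (t *\<^sub>C v) \<in> polyball m n" using maps by auto
    then show "coord (f (t *\<^sub>C v)) (i, j) = t * 0" using polyballD(1)[of "f (t *\<^sub>C v)" m n i j] ij by simp
  qed
  then show "f' ` block_space m n \<subseteq> block_space m n" by (auto simp: block_space_def)
  show "block_norm n (f' v) i \<le> 1"
    if "v \<in> block_space m n" "\<forall>i<m. block_norm n v i \<le> 1" "i < m" for v i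
    by (rule schwarz_polyball(2)[OF hol maps f0 f']) (use that in auto)
qed

lemma derivative_inverse:
  assumes maps: "f ` polyball m n \<subseteq> polyball m n" and f0: "f 0 = 0"
    and f': "(f has_derivative f') (at 0 within polyball m n)" "\<And>c v. f' (c *\<^sub>C v) = c *\<^sub>C f' v"
    and g': "(g has_derivative g') (at 0 within polyball m n)" "\<And>c v. g' (c *\<^sub>C v) = c *\<^sub>C g' v"
    and gf: "\<And>z. z \<in> polyball m n \<Longrightarrow> g (f z) = z" and v: "v \<in> block_space m n"
  shows "g' (f' v) = v"
proof (rule ell2_eqI)
  fix p
  have "(g has_derivative g') (at (f 0) within f ` polyball m n)"
    unfolding f0 by (rule has_derivative_subset[OF g'(1) maps])
  then have "((\<lambda>z. g (f z)) has_derivative (\<lambda>v. g' (f' v))) (at 0 within polyball m n)"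
    by (rule has_derivative_in_compose[OF f'(1)])
  then show "coord (g' (f' v)) p = coord v p"
    by (rule derivative_at_0_along[OF _ _ v]) (simp_all add: f' g' gf)
qed

text \<open>With \<open>L\<close> and \<open>M\<close> the derivatives of \<open>f\<close> and
  \<open>g\<close> at 0, the map \<open>\<lambda>z. M (f z)\<close> fixes 0 and has the identity as
  derivative there, hence is the identity on the polyball. Applying \<open>L\<close> shows that
  \<open>f\<close> agrees with \<open>L\<close>.\<close>

lemma automorphism_fixing_0_linear:
  assumes f: "polyball_holomorphic m n f" "f ` polyball m n \<subseteq> polyball m n" "f 0 = 0"
    and g: "polyball_holomorphic m n g" "g ` polyball m n \<subseteq> polyball m n" "g 0 = 0"
    and gf: "\<And>z. z \<in> polyball m n \<Longrightarrow> g (f z) = z" and fg: "\<And>z. z \<in> polyball m n \<Longrightarrow> f (g z) = z"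
    and n: "\<And>i. i < m \<Longrightarrow> n i \<ge> 1"
  shows "\<exists>L M. block_contraction m n L \<and> block_contraction m n M \<and>
    (\<forall>v\<in>block_space m n. M (L v) = v) \<and> (\<forall>v\<in>block_space m n. L (M v) = v) \<and>
    (\<forall>z\<in>polyball m n. f z = L z)"
proof -
  have 0: "0 \<in> polyball m n" by (simp add: polyball_def)
  obtain L where L: "(f has_derivative L) (at 0 within polyball m n)" "\<And>c v. L (c *\<^sub>C v) = c *\<^sub>C L v"
    using f(1) 0 by (auto simp: polyball_holomorphic_def)
  obtain M where M: "(g has_derivative M) (at 0 within polyball m n)" "\<And>c v. M (c *\<^sub>C v) = c *\<^sub>C M v"
    using g(1) 0 by (auto simp: polyball_holomorphic_def)
  have bL: "block_contraction m n L" by (rule derivative_block_contraction[OF f L])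
  have bM: "block_contraction m n M" by (rule derivative_block_contraction[OF g M])
  have left: "M (L v) = v" if "v \<in> block_space m n" for v
    by (rule derivative_inverse[OF f(2,3) L M gf that])
  have right: "L (M v) = v" if "v \<in> block_space m n" for v
    by (rule derivative_inverse[OF g(2,3) M L fg that])
  interpret M: bounded_linear M by (rule block_contractionD[OF bM])
  \<comment> \<open>Contractivity preserves non-strict bounds only; a common bound
    \<open>r < 1\<close> for the finitely many blocks keeps the image in the open polyball.\<close>
  have Mmaps: "M ` polyball m n \<subseteq> polyball m n"
  proof safe
    fix z assume z: "z \<in> polyball m n"
    then obtain r where r: "r < 1" "\<And>k. k < m \<Longrightarrow> block_norm n z k \<le> r"
      using finite_uniform_bound[of m "block_norm n z"] by (auto simp: polyball_iff)
    have zb: "z \<in> block_space m n" using z by (simp add: polyball_iff)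
    have "block_norm n (M z) i < 1" if "i < m" for i
      using block_contraction_bound[OF bM zb r(2) that] r(1) by simp
    then show "M z \<in> polyball m n" using block_contractionD(3)[OF bM zb] by (simp add: polyball_iff)
  qed
  have Mhol: "polyball_holomorphic m n M"
    unfolding polyball_holomorphic_def
    using bounded_linear_imp_has_derivative[OF M.bounded_linear_axioms] M(2) by blast
  have fL: "f z = L z" if z: "z \<in> polyball m n" for z
  proof -
    have "M (f z) = z"
    proof (rule eq_id_if_derivative_eq_id[where f = "\<lambda>z. M (f z)" and f' = "\<lambda>v. M (L v)"])
      show "polyball_holomorphic m n (\<lambda>z. M (f z))" by (rule polyball_holomorphic_compose[OF f(1,2) Mhol])
      show "(\<lambda>z. M (f z)) ` polyball m n \<subseteq> polyball m n" using f(2) Mmaps by auto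
      show "((\<lambda>z. M (f z)) has_derivative (\<lambda>v. M (L v))) (at 0 within polyball m n)"
        by (rule M.has_derivative[OF L(1)])
    qed (use n in \<open>simp_all add: f(3) M.zero L(2) M(2) left z\<close>)
    moreover have "f z \<in> polyball m n" using f(2) z by auto
    then have "f z \<in> block_space m n" by (simp add: polyball_iff)
    ultimately show ?thesis using right[of "f z"] by simp
  qed
  show ?thesis using bL bM left right fL by blast
qed

section \<open>The correspondence between the two groups\<close>

context free_prod
begin

lemma cc_hom_cong:
  assumes \<phi>: "cc_hom \<A> \<phi>" and eq: "\<And>A. A \<in> \<A> \<Longrightarrow> \<psi> A = \<phi> A"
  shows "cc_hom \<A> \<psi>"
  unfolding cc_hom_def
proof (intro conjI)
  show "unital_hom \<A> \<psi>"
    unfolding unital_hom_def by (intro conjI allI ballI) (simp_all add: eq cc_hom_simps[OF \<phi>])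
  show "\<psi> ` \<A> \<subseteq> bounded_ops" using cc_hom_simps(8)[OF \<phi>] eq by auto
  show "completely_contractive \<A> \<psi>"
    unfolding completely_contractive_def
  proof (intro allI impI)
    fix N and A :: "nat \<Rightarrow> nat \<Rightarrow> 'a op"
    assume A: "\<forall>p<N. \<forall>q<N. A p q \<in> \<A>"
    have "mat_norm N (\<lambda>p q. \<psi> (A p q)) = mat_norm N (\<lambda>p q. \<phi> (A p q))"
      by (rule mat_norm_cong) (use A in \<open>simp add: eq\<close>)
    then show "mat_norm N (\<lambda>p q. \<psi> (A p q)) \<le> mat_norm N A"
      using \<phi> A by (simp add: cc_hom_def completely_contractive_def)
  qed
qed

lemma Aut_ciD:
  assumes "\<phi> \<in> carrier (Aut_ci \<A>)"
  shows "cc_hom \<A> \<phi>" "\<phi> ` \<A> \<subseteq> \<A>" "inj_on \<phi> \<A>" "\<phi> ` \<A> = \<A>" "\<phi> \<in> extensional \<A>"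
    "\<phi> \<in> Bij \<A>" "completely_isometric \<A> \<phi>"
proof -
  have \<phi>: "\<phi> \<in> Bij \<A>" "unital_hom \<A> \<phi>" "completely_isometric \<A> \<phi>"
    using assms by (auto simp: Aut_ci_def)
  then show "\<phi> \<in> Bij \<A>" "completely_isometric \<A> \<phi>" by auto
  show im: "\<phi> ` \<A> = \<A>" "inj_on \<phi> \<A>" "\<phi> \<in> extensional \<A>"
    using \<phi>(1) by (auto simp: Bij_def bij_betw_def)
  then show "\<phi> ` \<A> \<subseteq> \<A>" by simp
  show "cc_hom \<A> \<phi>"
    using \<phi>(2,3) im(1) A_bounded_ops
    by (auto simp: cc_hom_def completely_isometric_def completely_contractive_def)
qed

text \<open>Complete contractivity of the inverse gives the lower bound for the matrix
  norms.\<close>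

lemma Aut_ciI:
  assumes \<phi>: "cc_hom \<A> \<phi>" "\<phi> ` \<A> \<subseteq> \<A>" and \<psi>: "cc_hom \<A> \<psi>" "\<psi> ` \<A> \<subseteq> \<A>"
    and inv1: "\<And>A. A \<in> \<A> \<Longrightarrow> \<psi> (\<phi> A) = A" and inv2: "\<And>A. A \<in> \<A> \<Longrightarrow> \<phi> (\<psi> A) = A"
  shows "restrict \<phi> \<A> \<in> carrier (Aut_ci \<A>)"
proof -
  have \<phi>A: "\<phi> A \<in> \<A>" if "A \<in> \<A>" for A using that \<phi> by auto
  have "bij_betw \<phi> \<A> \<A>"
    by (rule bij_betw_byWitness[where f' = \<psi>]) (use inv1 inv2 \<phi> \<psi> in auto)
  then have "restrict \<phi> \<A> \<in> Bij \<A>" by (simp add: Bij_def)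
  moreover have "unital_hom \<A> (restrict \<phi> \<A>)"
    using cc_hom_cong[OF \<phi>(1), of "restrict \<phi> \<A>"] by (simp add: cc_hom_def)
  moreover have "completely_isometric \<A> (restrict \<phi> \<A>)"
    unfolding completely_isometric_def
  proof (intro allI impI)
    fix N and A :: "nat \<Rightarrow> nat \<Rightarrow> 'a op"
    assume A: "\<forall>p<N. \<forall>q<N. A p q \<in> \<A>"
    have 1: "mat_norm N (\<lambda>p q. restrict \<phi> \<A> (A p q)) = mat_norm N (\<lambda>p q. \<phi> (A p q))"
      by (rule mat_norm_cong) (use A in simp)
    have 2: "mat_norm N (\<lambda>p q. \<phi> (A p q)) \<le> mat_norm N A"
      using \<phi>(1) A by (simp add: cc_hom_def completely_contractive_def)
    have "mat_norm N (\<lambda>p q. \<psi> (\<phi> (A p q))) \<le> mat_norm N (\<lambda>p q. \<phi> (A p q))"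
      using \<psi>(1) A \<phi>A by (simp add: cc_hom_def completely_contractive_def)
    moreover have "mat_norm N (\<lambda>p q. \<psi> (\<phi> (A p q))) = mat_norm N A"
      by (rule mat_norm_cong) (use A inv1 in simp)
    ultimately show "mat_norm N (\<lambda>p q. restrict \<phi> \<A> (A p q)) = mat_norm N A" using 1 2 by simp
  qed
  ultimately show ?thesis by (simp add: Aut_ci_def)
qed

definition ci_inv :: "('a op \<Rightarrow> 'a op) \<Rightarrow> 'a op \<Rightarrow> 'a op"
  where "ci_inv \<phi> = restrict (inv_into \<A> \<phi>) \<A>"

lemma ci_inv:
  assumes \<phi>: "\<phi> \<in> carrier (Aut_ci \<A>)"
  shows "ci_inv \<phi> \<in> carrier (Aut_ci \<A>)"
    and "A \<in> \<A> \<Longrightarrow> ci_inv \<phi> (\<phi> A) = A" and "A \<in> \<A> \<Longrightarrow> \<phi> (ci_inv \<phi> A) = A"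
proof -
  note d = Aut_ciD[OF \<phi>]
  have \<phi>A: "\<phi> A \<in> \<A>" if "A \<in> \<A>" for A using that d by auto
  show inv1: "A \<in> \<A> \<Longrightarrow> ci_inv \<phi> (\<phi> A) = A" and inv2: "A \<in> \<A> \<Longrightarrow> \<phi> (ci_inv \<phi> A) = A" for A
    using d by (simp_all add: ci_inv_def \<phi>A f_inv_into_f)
  have inA: "ci_inv \<phi> A \<in> \<A>" if "A \<in> \<A>" for A
    using that d by (simp add: ci_inv_def inv_into_into)
  have eqI: "ci_inv \<phi> B = C" if "B \<in> \<A>" "C \<in> \<A>" "\<phi> C = B" for B C using inv1 that by blast
  have "unital_hom \<A> (ci_inv \<phi>)"
    unfolding unital_hom_def
    by (intro conjI allI ballI; rule eqI) (simp_all add: cc_hom_simps[OF d(1)] inA inv2)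
  moreover have iso: "completely_isometric \<A> (ci_inv \<phi>)"
    unfolding completely_isometric_def
  proof (intro allI impI)
    fix N and A :: "nat \<Rightarrow> nat \<Rightarrow> 'a op"
    assume A: "\<forall>p<N. \<forall>q<N. A p q \<in> \<A>"
    have "mat_norm N (\<lambda>p q. \<phi> (ci_inv \<phi> (A p q))) = mat_norm N (\<lambda>p q. ci_inv \<phi> (A p q))"
      using d(7) A inA by (simp add: completely_isometric_def)
    moreover have "mat_norm N (\<lambda>p q. \<phi> (ci_inv \<phi> (A p q))) = mat_norm N A"
      by (rule mat_norm_cong) (use A inv2 in simp)
    ultimately show "mat_norm N (\<lambda>p q. ci_inv \<phi> (A p q)) = mat_norm N A" by simp
  qed
  moreover have "ci_inv \<phi> \<in> Bij \<A>" unfolding ci_inv_def by (rule restrict_inv_into_Bij[OF d(6)])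
  ultimately show "ci_inv \<phi> \<in> carrier (Aut_ci \<A>)" by (simp add: Aut_ci_def)
qed

text \<open>Passing to characters is composition on the right, so the order of the maps is reversed;
  this is the origin of the reversed product in \<open>star_mult\<close>.\<close>

lemma val_compose:
  assumes \<phi>: "cc_hom \<A> \<phi>" "\<phi> ` \<A> \<subseteq> \<A>" "inj_on \<phi> \<A>" and z: "z \<in> polyball m n"
    and \<psi>: "\<And>i j. i < m \<Longrightarrow> j < n i \<Longrightarrow> \<psi> (s i j) \<in> \<A>"
  shows "val \<psi> (val \<phi> z) = val (\<lambda>A. \<phi> (\<psi> A)) z"
proof (rule block_space_eqI)
  fix i j assume "i < m" "j < n i"
  then show "coord (val \<psi> (val \<phi> z)) (i, j) = coord (val (\<lambda>A. \<phi> (\<psi> A)) z) (i, j)"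
    by (simp add: coord_val rho_val_apply[OF \<phi> z] \<psi>)
qed (auto simp: block_space_def coord_val)

lemma val_eq_self:
  assumes "z \<in> polyball m n" "\<And>i j. i < m \<Longrightarrow> j < n i \<Longrightarrow> \<phi> (s i j) = s i j"
  shows "val \<phi> z = z"
proof (rule block_space_eqI)
  show "z \<in> block_space m n" using assms(1) by (simp add: polyball_iff)
qed (auto simp: block_space_def coord_val assms rho_s)

lemma star_extensional: "star m n \<A> s \<phi> \<in> extensional (polyball m n)"
  by (simp add: star_def)

lemma star_val: "\<phi> \<in> carrier (Aut_ci \<A>) \<Longrightarrow> z \<in> polyball m n \<Longrightarrow> star m n \<A> s \<phi> z = val \<phi> z"
  using star_apply Aut_ciD by blast

lemma star_maps: "\<phi> \<in> carrier (Aut_ci \<A>) \<Longrightarrow> z \<in> polyball m n \<Longrightarrow> star m n \<A> s \<phi> z \<in> polyball m n"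
  using star_val val_in_polyball Aut_ciD by metis

lemma star_star:
  assumes "\<phi> \<in> carrier (Aut_ci \<A>)" "\<psi> \<in> carrier (Aut_ci \<A>)" "z \<in> polyball m n"
  shows "star m n \<A> s \<psi> (star m n \<A> s \<phi> z) = val (\<lambda>A. \<phi> (\<psi> A)) z"
proof -
  have "star m n \<A> s \<psi> (star m n \<A> s \<phi> z) = val \<psi> (val \<phi> z)"
    using star_val[OF assms(2) star_maps[OF assms(1,3)]] star_val[OF assms(1,3)] by simp
  also have "\<dots> = val (\<lambda>A. \<phi> (\<psi> A)) z"
    by (rule val_compose[OF Aut_ciD(1-3)[OF assms(1)] assms(3)]) (use Aut_ciD(2)[OF assms(2)] in auto)
  finally show ?thesis .
qed

lemma star_ci_inv:
  assumes "\<phi> \<in> carrier (Aut_ci \<A>)" "z \<in> polyball m n"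
  shows "star m n \<A> s \<phi> (star m n \<A> s (ci_inv \<phi>) z) = z"
    and "star m n \<A> s (ci_inv \<phi>) (star m n \<A> s \<phi> z) = z"
  using ci_inv[OF assms(1)] assms by (simp_all add: star_star val_eq_self)

lemma star_in_Aut_polyball:
  assumes \<phi>: "\<phi> \<in> carrier (Aut_ci \<A>)"
  shows "star m n \<A> s \<phi> \<in> carrier (Aut_polyball m n)"
proof -
  let ?f = "star m n \<A> s \<phi>" and ?g = "star m n \<A> s (ci_inv \<phi>)"
  have bij: "bij_betw ?f (polyball m n) (polyball m n)"
    by (rule bij_betw_byWitness[where f' = ?g])
       (use star_ci_inv[OF \<phi>] star_maps[OF \<phi>] star_maps[OF ci_inv(1)[OF \<phi>]] in auto)
  have "polyball_holomorphic m n (inv_into (polyball m n) ?f)"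
  proof (rule polyball_holomorphic_cong)
    show "polyball_holomorphic m n ?g" by (rule star_holomorphic[OF Aut_ciD(1-3)[OF ci_inv(1)[OF \<phi>]]])
    show "inv_into (polyball m n) ?f z = ?g z" if "z \<in> polyball m n" for z
      using bij_betw_imp_inj_on[OF bij] star_ci_inv(1)[OF \<phi> that] star_maps[OF ci_inv(1)[OF \<phi>] that]
      by (intro inv_into_f_eq)
  qed
  then show ?thesis
    using bij star_extensional star_holomorphic[OF Aut_ciD(1-3)[OF \<phi>]]
    by (simp add: Aut_polyball_def Bij_def)
qed

lemma compose_in_Aut_ci:
  assumes "\<phi> \<in> carrier (Aut_ci \<A>)" "\<psi> \<in> carrier (Aut_ci \<A>)"
  shows "compose \<A> \<phi> \<psi> \<in> carrier (Aut_ci \<A>)"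
proof -
  note \<phi> = Aut_ciD[OF assms(1)] ci_inv[OF assms(1)] Aut_ciD[OF ci_inv(1)[OF assms(1)]]
  note \<psi> = Aut_ciD[OF assms(2)] ci_inv[OF assms(2)] Aut_ciD[OF ci_inv(1)[OF assms(2)]]
  have inA: "\<phi> A \<in> \<A>" "\<psi> A \<in> \<A>" "ci_inv \<phi> A \<in> \<A>" "ci_inv \<psi> A \<in> \<A>" if "A \<in> \<A>" for A
    using that \<phi>(2,12) \<psi>(2,12) by auto
  have "restrict (\<lambda>A. \<phi> (\<psi> A)) \<A> \<in> carrier (Aut_ci \<A>)"
  proof (rule Aut_ciI[where \<psi> = "\<lambda>A. ci_inv \<psi> (ci_inv \<phi> A)"])
    show "cc_hom \<A> (\<lambda>A. \<phi> (\<psi> A))" by (rule cc_hom_compose[OF \<psi>(1,2) \<phi>(1)])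
    show "cc_hom \<A> (\<lambda>A. ci_inv \<psi> (ci_inv \<phi> A))" by (rule cc_hom_compose[OF \<phi>(11,12) \<psi>(11)])
  qed (auto simp: inA \<phi>(9,10) \<psi>(9,10))
  then show ?thesis by (simp add: compose_def)
qed

lemma Aut_ci_mult:
  "\<phi> \<in> carrier (Aut_ci \<A>) \<Longrightarrow> \<psi> \<in> carrier (Aut_ci \<A>) \<Longrightarrow> \<phi> \<otimes>\<^bsub>Aut_ci \<A>\<^esub> \<psi> = compose \<A> \<phi> \<psi>"
  by (simp add: Aut_ci_def BijGroup_def)

lemma star_mult:
  assumes \<phi>: "\<phi> \<in> carrier (Aut_ci \<A>)" and \<psi>: "\<psi> \<in> carrier (Aut_ci \<A>)"
  shows "star m n \<A> s (\<phi> \<otimes>\<^bsub>Aut_ci \<A>\<^esub> \<psi>) =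
    star m n \<A> s \<psi> \<otimes>\<^bsub>Aut_polyball m n\<^esub> star m n \<A> s \<phi>"
proof -
  have "star m n \<A> s \<psi> \<otimes>\<^bsub>Aut_polyball m n\<^esub> star m n \<A> s \<phi> =
      compose (polyball m n) (star m n \<A> s \<psi>) (star m n \<A> s \<phi>)"
    using star_in_Aut_polyball[OF \<phi>] star_in_Aut_polyball[OF \<psi>]
    by (simp add: Aut_polyball_def BijGroup_def)
  also have "\<dots> = star m n \<A> s (compose \<A> \<phi> \<psi>)"
  proof (rule extensionalityI[of _ "polyball m n"])
    fix z assume z: "z \<in> polyball m n"
    have "val (\<lambda>A. \<phi> (\<psi> A)) z = val (compose \<A> \<phi> \<psi>) z"
      unfolding val_def finite_vec_def by (rule sum.cong) (auto simp: compose_eq)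
    then show "compose (polyball m n) (star m n \<A> s \<psi>) (star m n \<A> s \<phi>) z =
        star m n \<A> s (compose \<A> \<phi> \<psi>) z"
      using z by (simp add: compose_eq star_star[OF \<phi> \<psi> z] star_val[OF compose_in_Aut_ci[OF \<phi> \<psi>] z])
  qed (simp_all add: compose_extensional star_extensional)
  finally show ?thesis using Aut_ci_mult[OF \<phi> \<psi>] by simp
qed

lemma star_inj: "inj_on (star m n \<A> s) (carrier (Aut_ci \<A>))"
proof (rule inj_onI)
  fix \<phi> \<psi>
  assume \<phi>: "\<phi> \<in> carrier (Aut_ci \<A>)" and \<psi>: "\<psi> \<in> carrier (Aut_ci \<A>)"
    and eq: "star m n \<A> s \<phi> = star m n \<A> s \<psi>"
  note d\<phi> = Aut_ciD[OF \<phi>] and d\<psi> = Aut_ciD[OF \<psi>] and inv = ci_inv[OF \<psi>]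
  note di = Aut_ciD[OF inv(1)]
  \<comment> \<open>Equality of the induced maps says that the one induced by
    \<open>\<theta>\<close> is the identity; it remains to see that \<open>\<theta>\<close> is the
    identity on \<open>\<A>\<close>.\<close>
  define \<theta> where "\<theta> A = ci_inv \<psi> (\<phi> A)" for A
  have \<theta>: "cc_hom \<A> \<theta>" unfolding \<theta>_def[abs_def] by (rule cc_hom_compose[OF d\<phi>(1,2) di(1)])
  have \<theta>A: "\<theta> ` \<A> \<subseteq> \<A>" using d\<phi>(2) di(2) by (auto simp: \<theta>_def)
  have val: "val \<theta> z = z" if z: "z \<in> polyball m n" for z
  proof -
    have "val \<theta> z = star m n \<A> s \<phi> (star m n \<A> s (ci_inv \<psi>) z)"
      unfolding star_star[OF inv(1) \<phi> z] by (simp add: \<theta>_def[abs_def])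
    also have "\<dots> = z" unfolding eq by (rule star_ci_inv(1)[OF \<psi> z])
    finally show ?thesis .
  qed
  have r: "\<rho> z (\<theta> (s i j)) = coord z (i, j)" if "z \<in> polyball m n" "i < m" "j < n i" for z i j
    using arg_cong[OF val[OF that(1)], of "\<lambda>w. coord w (i, j)"] that by (simp add: coord_val)
  have "\<theta> A = A" if "A \<in> \<A>" for A
  proof (rule endomorphism_eq_id[OF \<theta> \<theta>A _ _ that])
    fix i j assume ij: "i < m" "j < n i"
    then have "\<theta> (s i j) \<in> \<A>" using \<theta>A by auto
    from Phi_1_of_rho[OF this ij r] ij
    show "\<Phi> 0 (\<theta> (s i j)) = 0" "\<Phi> 1 (\<theta> (s i j)) = s i j" by auto
  qed
  then have "\<phi> A = \<psi> A" if "A \<in> \<A>" for A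
    using inv(3)[of "\<phi> A"] d\<phi>(2) that by (auto simp: \<theta>_def)
  then show "\<phi> = \<psi>" using d\<phi>(5) d\<psi>(5) by (intro extensionalityI[of _ \<A>])
qed

lemma mob_in_Aut_ci: "a \<in> polyball m n \<Longrightarrow> restrict (mob a) \<A> \<in> carrier (Aut_ci \<A>)"
  by (rule Aut_ciI[where \<psi> = "mob (- a)"])
     (simp_all add: mob_hom mob_image mob_inverse mob_inverse' uminus_in_polyball)

lemma star_restrict:
  assumes "restrict \<phi> \<A> \<in> carrier (Aut_ci \<A>)" "z \<in> polyball m n"
  shows "star m n \<A> s (restrict \<phi> \<A>) z = val \<phi> z"
proof -
  have "val (restrict \<phi> \<A>) z = val \<phi> z"
    unfolding val_def finite_vec_def by (rule sum.cong) auto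
  then show ?thesis using star_val[OF assms] by simp
qed

lemma star_surj:
  assumes n: "\<And>i. i < m \<Longrightarrow> n i \<ge> 1" and f: "f \<in> carrier (Aut_polyball m n)"
  shows "\<exists>\<phi>\<in>carrier (Aut_ci \<A>). star m n \<A> s \<phi> = f"
proof -
  let ?B = "polyball m n"
  have ext: "f \<in> extensional ?B" and bij: "bij_betw f ?B ?B"
    and hol: "polyball_holomorphic m n f" "polyball_holomorphic m n (inv_into ?B f)"
    using f by (auto simp: Aut_polyball_def Bij_def)
  define g where "g = inv_into ?B f"
  have fB: "f z \<in> ?B" if "z \<in> ?B" for z using bij that by (auto simp: bij_betw_def)
  have gB: "g z \<in> ?B" and fg: "f (g z) = z" if "z \<in> ?B" for z
    using bij that by (auto simp: bij_betw_def g_def inv_into_into f_inv_into_f)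
  have gf: "g (f z) = z" if "z \<in> ?B" for z
    using bij that by (auto simp: bij_betw_def g_def)
  define a where "a = f 0"
  have a: "a \<in> ?B" by (simp add: a_def fB)
  define \<mu> where "\<mu> = restrict (mob a) \<A>"
  define \<nu> where "\<nu> = restrict (mob (- a)) \<A>"
  have \<mu>: "\<mu> \<in> carrier (Aut_ci \<A>)" and \<nu>: "\<nu> \<in> carrier (Aut_ci \<A>)"
    unfolding \<mu>_def \<nu>_def by (rule mob_in_Aut_ci a uminus_in_polyball)+
  let ?\<mu> = "star m n \<A> s \<mu>" and ?\<nu> = "star m n \<A> s \<nu>"
  have \<mu>\<nu>: "?\<mu> (?\<nu> z) = z" "?\<nu> (?\<mu> z) = z" if "z \<in> ?B" for z
  proof -
    have "\<nu> (\<mu> A) = A \<and> \<mu> (\<nu> A) = A" if A: "A \<in> \<A>" for A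
    proof -
      have "mob a A \<in> \<A>" "mob (- a) A \<in> \<A>"
        using mob_image[OF a] mob_image[OF uminus_in_polyball[OF a]] A by auto
      then show ?thesis using A by (simp add: \<mu>_def \<nu>_def mob_inverse mob_inverse' a)
    qed
    then show "?\<mu> (?\<nu> z) = z" "?\<nu> (?\<mu> z) = z"
      unfolding star_star[OF \<mu> \<nu> that] star_star[OF \<nu> \<mu> that]
      by (intro val_eq_self[OF that]; simp)+
  qed
  have \<nu>a: "?\<nu> a = 0" using star_restrict[OF \<nu>[unfolded \<nu>_def] a] by (simp add: \<nu>_def val_mob_self[OF a])
  then have \<mu>0: "?\<mu> 0 = a" using \<mu>\<nu>(1)[OF a] by simp
  note \<mu>B = star_maps[OF \<mu>] and \<nu>B = star_maps[OF \<nu>]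
  have \<mu>hol: "polyball_holomorphic m n ?\<mu>" and \<nu>hol: "polyball_holomorphic m n ?\<nu>"
    by (rule star_holomorphic; rule Aut_ciD[OF \<mu>] Aut_ciD[OF \<nu>])+
  \<comment> \<open>\<open>?\<nu>\<close> moves \<open>f 0\<close> back to 0, so \<open>h\<close>
    fixes 0; \<open>k\<close> is its inverse.\<close>
  define h where "h z = ?\<nu> (f z)" for z
  define k where "k z = g (?\<mu> z)" for z
  have "\<exists>L M. block_contraction m n L \<and> block_contraction m n M \<and>
    (\<forall>v\<in>block_space m n. M (L v) = v) \<and> (\<forall>v\<in>block_space m n. L (M v) = v) \<and> (\<forall>z\<in>?B. h z = L z)"
  proof (rule automorphism_fixing_0_linear)
    show "polyball_holomorphic m n h"
      unfolding h_def[abs_def] by (rule polyball_holomorphic_compose[OF hol(1) _ \<nu>hol]) (use fB in auto)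
    show "polyball_holomorphic m n k"
      unfolding k_def[abs_def] g_def by (rule polyball_holomorphic_compose[OF \<mu>hol _ hol(2)]) (use \<mu>B in auto)
    show "h ` ?B \<subseteq> ?B" "k ` ?B \<subseteq> ?B" using fB gB \<mu>B \<nu>B by (auto simp: h_def k_def)
    show "h 0 = 0" by (simp add: h_def a_def[symmetric] \<nu>a)
    show "k 0 = 0" by (simp add: k_def \<mu>0) (simp add: a_def gf)
    show "k (h z) = z" "h (k z) = z" if "z \<in> ?B" for z
      using that by (simp_all add: h_def k_def \<mu>\<nu> fB gB \<mu>B fg gf)
  qed (rule n)
  then obtain L M where L: "block_contraction m n L" and M: "block_contraction m n M"
    and inv1: "\<And>v. v \<in> block_space m n \<Longrightarrow> M (L v) = v" and inv2: "\<And>v. v \<in> block_space m n \<Longrightarrow> L (M v) = v"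
    and hL: "\<And>z. z \<in> ?B \<Longrightarrow> h z = L z"
    by blast
  define \<eta> where "\<eta> = restrict (lift L) \<A>"
  have \<eta>: "\<eta> \<in> carrier (Aut_ci \<A>)"
    unfolding \<eta>_def
    by (rule Aut_ciI[where \<psi> = "lift M"])
       (rule lift_hom[OF L M inv1 n] lift_hom[OF M L inv2 n] lift_image[OF L M inv1 n] lift_image[OF M L inv2 n]
         lift_inverse[OF L M inv1 inv2 n] lift_inverse[OF M L inv2 inv1 n]; assumption)+
  have \<eta>h: "star m n \<A> s \<eta> z = h z" if "z \<in> ?B" for z
    using star_restrict[OF \<eta>[unfolded \<eta>_def] that] val_lift[OF L M inv1 n that] hL[OF that] by (simp add: \<eta>_def)
  \<comment> \<open>The factors stand in this order because \<open>star\<close> reverses products: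
    the induced map is \<open>?\<mu>\<close> after \<open>h\<close>, and \<open>?\<mu>\<close>
    undoes \<open>?\<nu>\<close>.\<close>
  have "star m n \<A> s (\<eta> \<otimes>\<^bsub>Aut_ci \<A>\<^esub> \<mu>) = f"
  proof (rule extensionalityI[of _ ?B])
    fix z assume z: "z \<in> ?B"
    have "star m n \<A> s (\<eta> \<otimes>\<^bsub>Aut_ci \<A>\<^esub> \<mu>) z = ?\<mu> (star m n \<A> s \<eta> z)"
      using z star_in_Aut_polyball[OF \<mu>] star_in_Aut_polyball[OF \<eta>]
      by (simp add: star_mult[OF \<eta> \<mu>] Aut_polyball_def BijGroup_def compose_eq)
    then show "star m n \<A> s (\<eta> \<otimes>\<^bsub>Aut_ci \<A>\<^esub> \<mu>) z = f z"
      using z by (simp add: \<eta>h h_def \<mu>\<nu> fB)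
  qed (simp_all add: star_extensional ext)
  then show ?thesis using compose_in_Aut_ci[OF \<eta> \<mu>] Aut_ci_mult[OF \<eta> \<mu>] by metis
qed

lemma star_bij_betw:
  assumes "\<And>i. i < m \<Longrightarrow> n i \<ge> 1"
  shows "bij_betw (star m n \<A> s) (carrier (Aut_ci \<A>)) (carrier (Aut_polyball m n))"
  unfolding bij_betw_def using star_inj star_in_Aut_polyball star_surj[OF assms] by (auto simp: image_iff)

lemma ci_inv_ci_inv: "\<phi> \<in> carrier (Aut_ci \<A>) \<Longrightarrow> ci_inv (ci_inv \<phi>) = \<phi>"
proof (rule extensionalityI[of _ \<A>])
  assume \<phi>: "\<phi> \<in> carrier (Aut_ci \<A>)"
  show "\<phi> \<in> extensional \<A>" by (rule Aut_ciD[OF \<phi>])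
  fix A assume A: "A \<in> \<A>"
  then have "\<phi> A \<in> \<A>" using Aut_ciD(2)[OF \<phi>] by auto
  from ci_inv(2)[OF ci_inv(1)[OF \<phi>] this] show "ci_inv (ci_inv \<phi>) A = \<phi> A"
    using A by (simp add: ci_inv(2)[OF \<phi>])
qed (simp add: ci_inv_def)

lemma ci_inv_mult:
  assumes \<phi>: "\<phi> \<in> carrier (Aut_ci \<A>)" and \<psi>: "\<psi> \<in> carrier (Aut_ci \<A>)"
  shows "ci_inv (\<phi> \<otimes>\<^bsub>Aut_ci \<A>\<^esub> \<psi>) = ci_inv \<psi> \<otimes>\<^bsub>Aut_ci \<A>\<^esub> ci_inv \<phi>"
  unfolding Aut_ci_mult[OF \<phi> \<psi>] Aut_ci_mult[OF ci_inv(1)[OF \<psi>] ci_inv(1)[OF \<phi>]]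
proof (rule extensionalityI[of _ \<A>])
  note c = compose_in_Aut_ci[OF \<phi> \<psi>]
  show "ci_inv (compose \<A> \<phi> \<psi>) \<in> extensional \<A>" by (simp add: ci_inv_def)
  fix A assume A: "A \<in> \<A>"
  have i: "ci_inv \<phi> A \<in> \<A>" "ci_inv \<psi> (ci_inv \<phi> A) \<in> \<A>"
    using A Aut_ciD(2)[OF ci_inv(1)[OF \<phi>]] Aut_ciD(2)[OF ci_inv(1)[OF \<psi>]] by auto
  have "compose \<A> \<phi> \<psi> (ci_inv \<psi> (ci_inv \<phi> A)) = A"
    using i A by (simp add: compose_eq ci_inv(3)[OF \<phi>] ci_inv(3)[OF \<psi>])
  then show "ci_inv (compose \<A> \<phi> \<psi>) A = compose \<A> (ci_inv \<psi>) (ci_inv \<phi>) A"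
    using ci_inv(2)[OF c i(2)] A by (simp add: compose_eq)
qed (rule compose_extensional)

text \<open>\<open>\<phi> \<mapsto> \<phi>\<^sup>*\<close> reverses products, so the isomorphism is \<open>\<phi> \<mapsto> (\<phi>\<^sup>-\<^sup>1)\<^sup>*\<close>.\<close>

lemma Aut_ci_iso:
  assumes "\<And>i. i < m \<Longrightarrow> n i \<ge> 1"
  shows "Aut_ci \<A> \<cong> Aut_polyball m n"
proof -
  have "bij_betw ci_inv (carrier (Aut_ci \<A>)) (carrier (Aut_ci \<A>))"
    by (rule bij_betw_byWitness[where f' = ci_inv]) (auto simp: ci_inv_ci_inv ci_inv(1))
  then have "bij_betw (\<lambda>\<phi>. star m n \<A> s (ci_inv \<phi>)) (carrier (Aut_ci \<A>)) (carrier (Aut_polyball m n))"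
    using bij_betw_trans[OF _ star_bij_betw[OF assms]] by (simp add: o_def)
  moreover have "(\<lambda>\<phi>. star m n \<A> s (ci_inv \<phi>)) \<in> hom (Aut_ci \<A>) (Aut_polyball m n)"
    by (rule homI) (simp_all add: star_in_Aut_polyball ci_inv(1) ci_inv_mult star_mult)
  ultimately have "(\<lambda>\<phi>. star m n \<A> s (ci_inv \<phi>)) \<in> iso (Aut_ci \<A>) (Aut_polyball m n)"
    by (simp add: iso_def)
  then show ?thesis by (auto simp: is_iso_def)
qed

end

theorem theorem2p7:
  fixes m :: nat and n :: "nat \<Rightarrow> nat"
    and \<A> :: "'a op set" and s :: "nat \<Rightarrow> nat \<Rightarrow> 'a op"
  assumes "m \<ge> 1" and "\<forall>i<m. n i \<ge> 1"
    and "is_free_product m n \<A> s"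
  shows "Aut_ci \<A> \<cong> Aut_polyball m n \<and>
    bij_betw (star m n \<A> s) (carrier (Aut_ci \<A>)) (carrier (Aut_polyball m n)) \<and>
    (\<forall>\<phi>\<in>carrier (Aut_ci \<A>). \<forall>\<psi>\<in>carrier (Aut_ci \<A>).
      star m n \<A> s (\<phi> \<otimes>\<^bsub>Aut_ci \<A>\<^esub> \<psi>) =
      star m n \<A> s \<psi> \<otimes>\<^bsub>Aut_polyball m n\<^esub> star m n \<A> s \<phi>)"
proof -
  interpret free_prod m n \<A> s by unfold_locales (rule assms(3))
  have n: "\<And>i. i < m \<Longrightarrow> n i \<ge> 1" using assms(2) by blast
  show ?thesis using Aut_ci_iso[OF n] star_bij_betw[OF n] star_mult by blast
qed

end
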